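(* For every real number $\lambda$, all geodesics of the Finsler metric $$\varphi_\lambda(\mathbf{x},\mathbf{v}) = \frac{(1+\lambda^2\|\mathbf{x}\|^2)\|\mathbf{v}\|^2+\lambda^2\langle \mathbf{x},\mathbf{v}\rangle^2}{\|\mathbf{v}\|}$$ on $\mathbb{R}^3$ are straight lines. However, the only value of $\lambda$ for which all (affine) planes in $\mathbb{R}^3$ are extremals of the Hausdorff $2$-area functional of $\varphi_\lambda$ is $\lambda=0$.
   Context: $\mathbb{R}^3$ carries its standard inner product $\langle\cdot,\cdot\rangle$ and norm $\|\cdot\|$; the tangent bundle $T\mathbb{R}^3$ is identified with $\mathbb{R}^3\times\mathbb{R}^3\ni(\mathbf{x},\mathbf{v})$, and $\varphi_\lambda(\mathbf{x},\mathbf{0})=0$. A Minkowski norm on a finite-dimensional real vector space is a norm $\varphi$ that is smooth away from the origin and such that the Hessian of $\varphi^2$ is positive definite at every nonzero point. A Finsler metric on a manifold is a continuous function on the tangent bundle, smooth away from the zero section, whose restriction to each tangent space is a Minkowski norm. Geodesics are the extremals of the length functional $\gamma\mapsto\int\varphi(\gamma,\dot\gamma)\,dt$, regarded as unparametrized curves. Hausdorff $2$-area integrand of a Finsler metric $\varphi$ on $\mathbb{R}^3$: for $\mathbf{x}\in\mathbb{R}^3$ and a nonzero bivector $\mathbf{a}=\mathbf{v}_1\wedge\mathbf{v}_2\in\Lambda^2\mathbb{R}^3$ (every bivector in $\mathbb{R}^3$ is simple), let $B_{\mathbf{x}}=\{\mathbf{v}:\varphi(\mathbf{x},\mathbf{v})\le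 1\}$ and let $\langle \mathbf{a}\rangle$ be the plane spanned by $\mathbf{v}_1,\mathbf{v}_2$. Then $$\phi(\mathbf{x},\mathbf{a})=\frac{\pi}{\mathrm{vol}(B_{\mathbf{x}}\cap\langle\mathbf{a}\rangle;\mathbf{a})},$$ where $\mathrm{vol}(\cdot\,;\mathbf{a})$ is the Lebesgue measure on $\langle\mathbf{a}\rangle$ for which the parallelogram spanned by $\mathbf{v}_1,\mathbf{v}_2$ has measure $1$; and $\phi(\mathbf{x},\mathbf{0})=0$. The Hausdorff $2$-area functional is $N\mapsto\int_N\phi$ on surfaces $N\subset\mathbb{R}^3$, where in a local parametrization $(s,t)\mapsto \mathbf{r}(s,t)$ the integral is $\int\phi(\mathbf{r},\partial_s\mathbf{r}\wedge\partial_t\mathbf{r})\,ds\,dt$. A surface $N$ is an extremal of this functional if the first variation of $\int\phi$ vanishes for all smooth variations of $N$ that agree with $N$ outside a compact set. *)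

theory Defs
  imports "HOL-Analysis.Analysis"
begin

section \<open>Smooth maps\<close>

text \<open>Intended for open sets. In finite dimension, being differentiable with all directional
  derivatives of class \<open>C\<^sup>k\<close> is the same as being of class \<open>C\<^bsup>k+1\<^esup>\<close>.\<close>

primrec Ck_on :: "nat \<Rightarrow> 'a::euclidean_space set \<Rightarrow> ('a \<Rightarrow> 'b::real_normed_vector) \<Rightarrow> bool" where
  "Ck_on 0 S f \<longleftrightarrow> continuous_on S f"
| "Ck_on (Suc k) S f \<longleftrightarrow> (\<forall>x\<in>S. f differentiable (at x)) \<and>
     (\<forall>v. Ck_on k S (\<lambda>x. frechet_derivative f (at x) v))"

definition smooth_on :: "'a::euclidean_space set \<Rightarrow> ('a \<Rightarrow> 'b::real_normed_vector) \<Rightarrow> bool" where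
  "smooth_on S f \<longleftrightarrow> (\<forall>k. Ck_on k S f)"

section \<open>Finsler metrics\<close>

definition is_norm :: "('a::real_vector \<Rightarrow> real) \<Rightarrow> bool" where
  "is_norm p \<longleftrightarrow> (\<forall>v. 0 \<le> p v) \<and> (\<forall>v. p v = 0 \<longleftrightarrow> v = 0) \<and>
     (\<forall>c v. p (c *\<^sub>R v) = \<bar>c\<bar> * p v) \<and> (\<forall>v w. p (v + w) \<le> p v + p w)"

definition hessian :: "('a::euclidean_space \<Rightarrow> real) \<Rightarrow> 'a \<Rightarrow> 'a \<Rightarrow> 'a \<Rightarrow> real" where
  "hessian f v w1 w2 =
     frechet_derivative (\<lambda>u. frechet_derivative f (at u) w2) (at v) w1"

definition minkowski_norm :: "('a::euclidean_space \<Rightarrow> real) \<Rightarrow> bool" where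
  "minkowski_norm p \<longleftrightarrow> is_norm p \<and> smooth_on (- {0}) p \<and>
     (\<forall>v w. v \<noteq> 0 \<longrightarrow> w \<noteq> 0 \<longrightarrow> hessian (\<lambda>u. (p u)\<^sup>2) v w w > 0)"

text \<open>A Finsler metric \<open>F\<close> on the manifold \<open>'a\<close>, with tangent bundle \<open>'a \<times> 'a\<close>;
  \<open>F x v\<close> is its value at the tangent vector \<open>v\<close> based at \<open>x\<close>.\<close>

definition finsler_metric :: "('a::euclidean_space \<Rightarrow> 'a \<Rightarrow> real) \<Rightarrow> bool" where
  "finsler_metric F \<longleftrightarrow>
     continuous_on UNIV (\<lambda>(x, v). F x v) \<and>
     smooth_on {(x, v). v \<noteq> 0} (\<lambda>(x, v). F x v) \<and>
     (\<forall>x. minkowski_norm (F x))"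

section \<open>Geodesics\<close>

definition regular_curve :: "real set \<Rightarrow> (real \<Rightarrow> 'a::euclidean_space) \<Rightarrow> bool" where
  "regular_curve I \<gamma> \<longleftrightarrow> open I \<and> is_interval I \<and> I \<noteq> {} \<and> smooth_on I \<gamma> \<and>
     (\<forall>t\<in>I. vector_derivative \<gamma> (at t) \<noteq> 0)"

text \<open>\<open>\<Gamma> e\<close>, for \<open>\<bar>e\<bar> < \<delta>\<close>, is a smooth variation of \<open>\<gamma>\<close> that agrees with \<open>\<gamma>\<close> outside
  the compact interval \<open>{a..b}\<close>.\<close>

definition curve_variation ::
  "real set \<Rightarrow> (real \<Rightarrow> 'a::euclidean_space) \<Rightarrow> real \<Rightarrow> real \<Rightarrow> real \<Rightarrow>
   (real \<Rightarrow> real \<Rightarrow> 'a) \<Rightarrow> bool" where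
  "curve_variation I \<gamma> \<delta> a b \<Gamma> \<longleftrightarrow> \<delta> > 0 \<and> {a..b} \<subseteq> I \<and>
     smooth_on ({-\<delta><..<\<delta>} \<times> I) (\<lambda>(e, t). \<Gamma> e t) \<and>
     (\<forall>t\<in>I. \<Gamma> 0 t = \<gamma> t) \<and>
     (\<forall>e\<in>{-\<delta><..<\<delta>}. \<forall>t\<in>I - {a..b}. \<Gamma> e t = \<gamma> t)"

definition curve_length ::
  "('a::euclidean_space \<Rightarrow> 'a \<Rightarrow> real) \<Rightarrow> real \<Rightarrow> real \<Rightarrow> (real \<Rightarrow> 'a) \<Rightarrow> real" where
  "curve_length F a b \<gamma> = integral {a..b} (\<lambda>t. F (\<gamma> t) (vector_derivative \<gamma> (at t)))"

text \<open>A geodesic, given by an arbitrary regular parametrization: no normalization of the speed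
  is imposed, so that the notion is invariant under reparametrization.\<close>

definition geodesic ::
  "('a::euclidean_space \<Rightarrow> 'a \<Rightarrow> real) \<Rightarrow> real set \<Rightarrow> (real \<Rightarrow> 'a) \<Rightarrow> bool" where
  "geodesic F I \<gamma> \<longleftrightarrow> regular_curve I \<gamma> \<and>
     (\<forall>\<delta> a b \<Gamma>. curve_variation I \<gamma> \<delta> a b \<Gamma> \<longrightarrow>
        ((\<lambda>e. curve_length F a b (\<Gamma> e)) has_real_derivative 0) (at 0))"

section \<open>The Hausdorff area functional\<close>

text \<open>\<open>hausdorff_integrand F x v1 v2\<close> is the value at the bivector \<open>v1 \<and> v2\<close>, which vanishes iff
  the cross product of \<open>v1\<close> and \<open>v2\<close> does. The Lebesgue measure on the plane spanned by
  \<open>v1\<close>, \<open>v2\<close> that gives their parallelogram measure 1 is the image of the standard one under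
  \<open>(\<sigma>, \<tau>) \<mapsto> \<sigma> v1 + \<tau> v2\<close>. Pairs with the same wedge product differ by a linear
  map of determinant 1 and hence give the same value.\<close>

definition bivector_volume :: "(real^3) set \<Rightarrow> real^3 \<Rightarrow> real^3 \<Rightarrow> real" where
  "bivector_volume B v1 v2 =
     measure lborel {(\<sigma>::real, \<tau>::real). \<sigma> *\<^sub>R v1 + \<tau> *\<^sub>R v2 \<in> B}"

definition hausdorff_integrand ::
  "(real^3 \<Rightarrow> real^3 \<Rightarrow> real) \<Rightarrow> real^3 \<Rightarrow> real^3 \<Rightarrow> real^3 \<Rightarrow> real" where
  "hausdorff_integrand F x v1 v2 =
     (if cross3 v1 v2 = 0 then 0 else pi / bivector_volume {v. F x v \<le> 1} v1 v2)"

definition partial_s :: "(real \<times> real \<Rightarrow> real^3) \<Rightarrow> real \<times> real \<Rightarrow> real^3" where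
  "partial_s r y = frechet_derivative r (at y) (1, 0)"

definition partial_t :: "(real \<times> real \<Rightarrow> real^3) \<Rightarrow> real \<times> real \<Rightarrow> real^3" where
  "partial_t r y = frechet_derivative r (at y) (0, 1)"

definition hausdorff_area ::
  "(real^3 \<Rightarrow> real^3 \<Rightarrow> real) \<Rightarrow> (real \<times> real) set \<Rightarrow> (real \<times> real \<Rightarrow> real^3) \<Rightarrow> real" where
  "hausdorff_area F K r =
     integral K (\<lambda>y. hausdorff_integrand F (r y) (partial_s r y) (partial_t r y))"

definition local_parametrization ::
  "(real^3) set \<Rightarrow> (real \<times> real) set \<Rightarrow> (real \<times> real \<Rightarrow> real^3) \<Rightarrow> bool" where
  "local_parametrization N U r \<longleftrightarrow> open U \<and> smooth_on U r \<and>
     (\<forall>y\<in>U. cross3 (partial_s r y) (partial_t r y) \<noteq> 0) \<and>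
     (\<exists>g. homeomorphism U (r ` U) r g) \<and> openin (top_of_set N) (r ` U)"

definition is_surface :: "(real^3) set \<Rightarrow> bool" where
  "is_surface N \<longleftrightarrow> (\<forall>p\<in>N. \<exists>U r. local_parametrization N U r \<and> p \<in> r ` U)"

definition surface_variation ::
  "(real \<times> real) set \<Rightarrow> (real \<times> real \<Rightarrow> real^3) \<Rightarrow> real \<Rightarrow> (real \<times> real) set \<Rightarrow>
   (real \<Rightarrow> real \<times> real \<Rightarrow> real^3) \<Rightarrow> bool" where
  "surface_variation U r \<delta> K R \<longleftrightarrow> \<delta> > 0 \<and> compact K \<and> K \<subseteq> U \<and>
     smooth_on ({-\<delta><..<\<delta>} \<times> U) (\<lambda>(e, y). R e y) \<and>
     (\<forall>y\<in>U. R 0 y = r y) \<and>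
     (\<forall>e\<in>{-\<delta><..<\<delta>}. \<forall>y\<in>U - K. R e y = r y)"

text \<open>The compact set outside which a variation agrees with \<open>N\<close> is taken inside the image of a
  local parametrization, where the area is given by an integral in the parameters. For a surface
  with a global parametrization, such as a plane, these are all the compactly supported
  variations; in general nothing is lost, since the first variation is linear in the variation
  field, which can be split by a partition of unity.\<close>

definition hausdorff_extremal :: "(real^3 \<Rightarrow> real^3 \<Rightarrow> real) \<Rightarrow> (real^3) set \<Rightarrow> bool" where
  "hausdorff_extremal F N \<longleftrightarrow> is_surface N \<and>
     (\<forall>U r \<delta> K R. local_parametrization N U r \<and> surface_variation U r \<delta> K R \<longrightarrow>
        ((\<lambda>e. hausdorff_area F K (R e)) has_real_derivative 0) (at 0))"

section \<open>The family of metrics\<close>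

text \<open>For \<open>v = 0\<close> the value is 0, by the convention for division by 0.\<close>

definition phi :: "real \<Rightarrow> real^3 \<Rightarrow> real^3 \<Rightarrow> real" where
  "phi l x v =
     ((1 + l\<^sup>2 * (norm x)\<^sup>2) * (norm v)\<^sup>2 + l\<^sup>2 * (x \<bullet> v)\<^sup>2) / norm v"

end

theory Submission
  imports Defs "HOL-Computational_Algebra.Polynomial"
begin

text \<open>Geodesics. Each \<open>phi l\<close> satisfies Hamel's condition, so the Euler--Lagrange expression of a
  curve \<open>\<gamma>\<close> reduces to the fibre Hessian of \<open>phi l\<close> at \<open>\<gamma>'\<close> applied to \<open>\<gamma>''\<close>, whose kernel is
  spanned by \<open>\<gamma>'\<close>. Varying an extremal in the constant direction \<open>\<gamma>''(t\<^sub>0)\<close>, cut off near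
  \<open>t\<^sub>0\<close>, shows that \<open>\<gamma>''\<close> is a multiple of \<open>\<gamma>'\<close>, i.e. that the unit tangent is constant.

  Area. With \<open>A = 1 + l\<^sup>2 \<parallel>x\<parallel>\<^sup>2\<close> and \<open>B\<close> the squared norm of the projection of \<open>l x\<close> to the plane, the
  area of the section of the unit ball is an elementary integral over slopes, and the area density is
  \<open>2 (A (A + B))\<^bsup>3/2\<^esup> / (2 A + B)\<close> times the Euclidean one. For \<open>l = 0\<close> the first variation at a plane
  is the integral of the divergence of a compactly supported field. For \<open>l \<noteq> 0\<close> take the graphs
  \<open>z = 1 + e u(s, t)\<close> with a bump function \<open>u \<ge> 0\<close>: up to a divergence the first variation has density
  \<open>2 l\<^sup>2 u E\<close> with \<open>E = - 6 (A (A + B))\<^bsup>3/2\<^esup> B\<^sup>3 / ((A + B)\<^sup>2 (2 A + B)\<^sup>3)\<close>, which is negative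
  off the origin.\<close>

text \<open>Write g for the Euclidean form and q(v) = A g(v) + (l <x, v>)^2. Then
  \<open>phi l x v\<close> is q(v) / |v|, and the unit ball meets a plane in the set q^2 <= g.
  Relative to g the restriction of q has eigenvalues A and A + B, and the section has area pi times
  their sum over 2 det^(3/2); this is the origin of the density.

  A plane through the origin is fixed by a reflection that preserves \<open>phi l\<close>, so its
  first variation vanishes and a counterexample needs an offset; hence the height 1. For that plane
  E has the factor B^3 and vanishes to sixth order at the foot of the perpendicular from the origin.
  A low-order expansion there detects nothing, so the Euler-Lagrange expression is computed in
  closed form.

  The Euclidean direction meets another obstacle: extremality quantifies over all local
  parametrizations and all compact sets of parameters. The domain may be disconnected and the
  compact set may have an irregular boundary. Integration by parts therefore goes through extension
  by zero to a box, and the unit normal is only locally constant.\<close>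

section \<open>Smooth maps\<close>

text \<open>A derivative at a point sees only a neighbourhood of it, and \<open>S\<close> is open;
  so agreement on \<open>S\<close> passes to the derivatives of every order.\<close>

lemma Ck_on_cong:
  assumes "open S" "\<And>x. x \<in> S \<Longrightarrow> f x = g x"
  shows "Ck_on k S f \<longleftrightarrow> Ck_on k S g"
  using assms(2)
proof (induction k arbitrary: f g)
  case 0
  then show ?case by (simp cong: continuous_on_cong)
next
  case (Suc k)
  have D: "(f has_derivative f') (at x) \<longleftrightarrow> (g has_derivative f') (at x)" if "x \<in> S" for x f'
    using has_derivative_transform_within_open[OF _ assms(1) that, of f f' UNIV g]
      has_derivative_transform_within_open[OF _ assms(1) that, of g f' UNIV f] Suc.prems by auto
  then have "frechet_derivative f (at x) = frechet_derivative g (at x)" if "x \<in> S" for x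
    using that unfolding frechet_derivative_def by simp
  then have "Ck_on k S (\<lambda>x. frechet_derivative f (at x) v) \<longleftrightarrow>
      Ck_on k S (\<lambda>x. frechet_derivative g (at x) v)" for v
    by (intro Suc.IH) simp
  then show ?case using D by (auto simp: differentiable_def)
qed

text \<open>An explicit derivative replaces the choice-defined \<open>frechet_derivative\<close>, so
  that regularity of closed formulas can be proved by induction on the order.\<close>

lemma Ck_on_SucI:
  assumes "open S" "\<And>x. x \<in> S \<Longrightarrow> (f has_derivative f' x) (at x)"
    "\<And>v. Ck_on k S (\<lambda>x. f' x v)"
  shows "Ck_on (Suc k) S f"
proof -
  have "Ck_on k S (\<lambda>x. frechet_derivative f (at x) v)" for v
    using assms(3)[of v] frechet_derivative_at[OF assms(2)]
    by (subst Ck_on_cong[OF assms(1), where g = "\<lambda>x. f' x v"]) auto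
  then show ?thesis using assms(2) by (auto simp: differentiable_def)
qed

lemma Ck_on_imp_continuous_on:
  assumes "Ck_on k S f" shows "continuous_on S f"
proof (cases k)
  case (Suc j)
  then show ?thesis using assms
    by (auto intro!: continuous_at_imp_continuous_on differentiable_imp_continuous_within)
qed (use assms in simp)

lemma Ck_on_SucD: "Ck_on (Suc k) S f \<Longrightarrow> Ck_on k S f"
proof (induction k arbitrary: f)
  case 0
  then show ?case using Ck_on_imp_continuous_on[of "Suc 0"] by simp
next
  case (Suc k)
  then show ?case by (auto simp del: Ck_on.simps(1))
qed

lemma Ck_on_frechet:
  assumes "Ck_on (Suc k) S f"
  shows "Ck_on k S (\<lambda>x. frechet_derivative f (at x) v)"
    and "x \<in> S \<Longrightarrow> (f has_derivative frechet_derivative f (at x)) (at x)"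
  using assms by (auto simp: frechet_derivative_works)

lemma Ck_on_const: "Ck_on k S (\<lambda>x. c)"
  by (induction k arbitrary: c) auto

lemma Ck_on_bounded_linear:
  assumes "bounded_linear f" "open S" shows "Ck_on k S f"
proof (cases k)
  case (Suc j)
  show ?thesis unfolding Suc
    by (rule Ck_on_SucI[OF assms(2), where f' = "\<lambda>x. f"])
      (auto intro: bounded_linear_imp_has_derivative assms Ck_on_const)
qed (use assms in \<open>auto intro: linear_continuous_on\<close>)

lemma Ck_on_add:
  assumes "open S" "Ck_on k S f" "Ck_on k S g" shows "Ck_on k S (\<lambda>x. f x + g x)"
  using assms(2,3)
proof (induction k arbitrary: f g)
  case 0 then show ?case by (auto intro: continuous_intros)
next
  case (Suc k)
  note d = Ck_on_frechet[OF Suc.prems(1)] Ck_on_frechet[OF Suc.prems(2)]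
  show ?case
    by (rule Ck_on_SucI[OF assms(1) has_derivative_add[OF d(2) d(4)]]) (use d Suc.IH in auto)
qed

lemma Ck_on_sum:
  assumes "open S" "\<And>i. i \<in> I \<Longrightarrow> Ck_on k S (f i)"
  shows "Ck_on k S (\<lambda>x. \<Sum>i\<in>I. f i x)"
  using assms(2)
  by (induction I rule: infinite_finite_induct) (auto intro: Ck_on_const Ck_on_add assms(1))

lemma Ck_on_bilinear:
  assumes "bounded_bilinear h" "open S" "Ck_on k S f" "Ck_on k S g"
  shows "Ck_on k S (\<lambda>x. h (f x) (g x))"
  using assms(3,4)
proof (induction k arbitrary: f g)
  case 0 then show ?case by (auto intro: bounded_bilinear.continuous_on[OF assms(1)])
next
  case (Suc k)
  note d = Ck_on_frechet[OF Suc.prems(1)] Ck_on_frechet[OF Suc.prems(2)]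
  show ?case
    by (rule Ck_on_SucI[OF assms(2) bounded_bilinear.FDERIV[OF assms(1) d(2) d(4)]])
      (auto intro!: Ck_on_add assms(2) Suc.IH d(1,3) Ck_on_SucD[OF Suc.prems(1)] Ck_on_SucD[OF Suc.prems(2)])
qed

lemma Ck_on_compose:
  fixes f :: "'a::euclidean_space \<Rightarrow> 'c::euclidean_space"
  assumes "open S" "f ` S \<subseteq> T" "Ck_on k S f" "Ck_on k T g"
  shows "Ck_on k S (\<lambda>x. g (f x))"
  using assms(3,4)
proof (induction k arbitrary: g)
  case 0 then show ?case
    using continuous_on_compose2[OF _ _ assms(2)] by auto
next
  case (Suc k)
  note d = Ck_on_frechet[OF Suc.prems(1)] Ck_on_frechet[OF Suc.prems(2)]
  let ?f' = "\<lambda>x. frechet_derivative f (at x)" and ?g' = "\<lambda>x. frechet_derivative g (at x)"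
  \<comment> \<open>In x -> g'(f x)(f'(x) v) both the base point and the direction vary, but the
    inductive hypothesis treats g' only in a fixed direction. Expanding the direction in the basis
    separates the two dependencies.\<close>
  have e: "((\<lambda>x. g (f x)) has_derivative (\<lambda>v. \<Sum>b\<in>Basis. (?f' x v \<bullet> b) *\<^sub>R ?g' (f x) b)) (at x)"
    if "x \<in> S" for x
  proof -
    have "f x \<in> T" using that assms(2) by auto
    from d(4)[OF this] have lin: "bounded_linear (?g' (f x))" by (rule has_derivative_bounded_linear)
    have "?g' (f x) u = (\<Sum>b\<in>Basis. (u \<bullet> b) *\<^sub>R ?g' (f x) b)" for u
      using linear_sum[OF bounded_linear.linear[OF lin], of "\<lambda>b. (u \<bullet> b) *\<^sub>R b" Basis]
      by (simp add: euclidean_representation linear_cmul[OF bounded_linear.linear[OF lin]])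
    then have "(\<lambda>v. ?g' (f x) (?f' x v)) = (\<lambda>v. \<Sum>b\<in>Basis. (?f' x v \<bullet> b) *\<^sub>R ?g' (f x) b)"
      by (rule ext)
    then show ?thesis
      using has_derivative_compose[OF d(2)[OF that] d(4)[OF \<open>f x \<in> T\<close>]] by (simp only:)
  qed
  have f: "Ck_on k S f" by (rule Ck_on_SucD[OF Suc.prems(1)])
  show ?case
  proof (rule Ck_on_SucI[OF assms(1) e], assumption)
    show "Ck_on k S (\<lambda>x. \<Sum>b\<in>Basis. (?f' x v \<bullet> b) *\<^sub>R ?g' (f x) b)" for v
      by (intro Ck_on_sum[OF assms(1)] Ck_on_bilinear[OF bounded_bilinear_scaleR assms(1)]
        Ck_on_bilinear[OF bounded_bilinear_inner assms(1)] Suc.IH[OF f] d(1,3) Ck_on_const)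
  qed
qed

lemma Ck_on_Pair:
  assumes "open S" "Ck_on k S f" "Ck_on k S g" shows "Ck_on k S (\<lambda>x. (f x, g x))"
  using assms(2,3)
proof (induction k arbitrary: f g)
  case 0 then show ?case by (auto intro: continuous_intros)
next
  case (Suc k)
  note d = Ck_on_frechet[OF Suc.prems(1)] Ck_on_frechet[OF Suc.prems(2)]
  show ?case
    by (rule Ck_on_SucI[OF assms(1) has_derivative_Pair[OF d(2) d(4)]]) (use d Suc.IH in auto)
qed

text \<open>The exponent varies in the induction because differentiation lowers it. Exponent -1/2,
  applied to \<open>v \<bullet> v\<close>, later gives the smoothness of 1/|v| away from 0.\<close>

lemma Ck_on_powr: "Ck_on k {0<..} (\<lambda>x::real. x powr a)"
proof (induction k arbitrary: a)
  case 0 then show ?case by (auto intro!: continuous_intros)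
next
  case (Suc k)
  show ?case
    by (rule Ck_on_SucI[where f' = "\<lambda>x v. (a * x powr (a - 1)) * v"])
      (auto intro!: Ck_on_bilinear[OF bounded_bilinear_mult] Ck_on_const Suc
        has_field_derivative_imp_has_derivative has_real_derivative_powr)
qed

lemma smooth_on_const: "smooth_on S (\<lambda>x. c)"
  by (simp add: smooth_on_def Ck_on_const)

lemma smooth_on_bounded_linear: "bounded_linear f \<Longrightarrow> open S \<Longrightarrow> smooth_on S f"
  by (simp add: smooth_on_def Ck_on_bounded_linear)

lemma smooth_on_add:
  "open S \<Longrightarrow> smooth_on S f \<Longrightarrow> smooth_on S g \<Longrightarrow> smooth_on S (\<lambda>x. f x + g x)"
  by (simp add: smooth_on_def Ck_on_add)

lemma smooth_on_bilinear:
  "bounded_bilinear h \<Longrightarrow> open S \<Longrightarrow> smooth_on S f \<Longrightarrow> smooth_on S g \<Longrightarrow>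
    smooth_on S (\<lambda>x. h (f x) (g x))"
  by (simp add: smooth_on_def Ck_on_bilinear)

lemmas smooth_on_mult = smooth_on_bilinear[OF bounded_bilinear_mult]
lemmas smooth_on_scaleR = smooth_on_bilinear[OF bounded_bilinear_scaleR]
lemmas smooth_on_inner = smooth_on_bilinear[OF bounded_bilinear_inner]

lemma smooth_on_compose:
  fixes f :: "'a::euclidean_space \<Rightarrow> 'c::euclidean_space"
  shows "open S \<Longrightarrow> f ` S \<subseteq> T \<Longrightarrow> smooth_on S f \<Longrightarrow> smooth_on T g \<Longrightarrow> smooth_on S (\<lambda>x. g (f x))"
  by (simp add: smooth_on_def Ck_on_compose)

lemma smooth_on_Pair:
  "open S \<Longrightarrow> smooth_on S f \<Longrightarrow> smooth_on S g \<Longrightarrow> smooth_on S (\<lambda>x. (f x, g x))"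
  by (simp add: smooth_on_def Ck_on_Pair)

lemma smooth_on_powr: "smooth_on {0<..} (\<lambda>x::real. x powr a)"
  by (simp add: smooth_on_def Ck_on_powr)

section \<open>A smooth bump function\<close>

text \<open>The polynomial parameter makes the functions built on exp(-1/x) a family closed under
  differentiation, so that smoothness across 0 is an induction on the order for all \<open>p\<close>
  together.\<close>

definition flat_exp :: "real poly \<Rightarrow> real \<Rightarrow> real" where
  "flat_exp p x = (if x > 0 then poly p (1 / x) * exp (- (1 / x)) else 0)"

lemma flat_exp_tendsto_0: "(flat_exp p \<longlongrightarrow> 0) (at 0)"
proof -
  have "((\<lambda>y. \<Sum>i\<le>degree p. coeff p i * (y ^ i / exp y)) \<longlongrightarrow> (\<Sum>i\<le>degree p. coeff p i * 0)) at_top"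
    by (intro tendsto_intros tendsto_power_div_exp_0)
  then have "((\<lambda>y. poly p y * exp (- y)) \<longlongrightarrow> 0) at_top"
    by (simp add: poly_altdef sum_distrib_right exp_minus divide_inverse mult.assoc)
  then have "((\<lambda>x. poly p (inverse x) * exp (- inverse x)) \<longlongrightarrow> 0) (at_right 0)"
    by (rule filterlim_compose[OF _ filterlim_inverse_at_top_right])
  then have "(flat_exp p \<longlongrightarrow> 0) (at_right 0)"
    by (rule Lim_transform_eventually)
      (auto simp: eventually_at_filter flat_exp_def divide_inverse)
  moreover have "(flat_exp p \<longlongrightarrow> 0) (at_left 0)"
    by (rule Lim_transform_eventually[OF tendsto_const])
      (auto simp: eventually_at_filter flat_exp_def)
  ultimately show ?thesis by (simp add: filterlim_split_at)
qed

text \<open>With y = 1/x one has dy/dx = -y^2, so p(y) exp(-y) has derivative y^2 (p(y) - p'(y))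
  exp(-y); the factor \<open>[:0, 0, 1:]\<close> is y^2.\<close>

lemma flat_exp_derivative:
  "(flat_exp p has_real_derivative flat_exp ([:0, 0, 1:] * (p - pderiv p)) x) (at x)"
proof -
  consider "x > 0" | "x < 0" | "x = 0" by linarith
  then show ?thesis
  proof cases
    case 1
    have "((\<lambda>x. poly p (1 / x) * exp (- (1 / x))) has_real_derivative
        flat_exp ([:0, 0, 1:] * (p - pderiv p)) x) (at x)"
      using 1 by (auto intro!: derivative_eq_intros poly_DERIV DERIV_chain2[of "poly p"]
          simp: flat_exp_def field_simps power2_eq_square)
    then show ?thesis
      by (rule has_field_derivative_transform_within_open[where S = "{0<..}"])
        (use 1 in \<open>auto simp: flat_exp_def\<close>)
  next
    case 2
    show ?thesis
      by (rule has_field_derivative_transform_within_open[of "\<lambda>x. 0" _ _ "{..<0}"])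
        (use 2 in \<open>auto simp: flat_exp_def\<close>)
  next
    case 3
    \<comment> \<open>At 0 the difference quotient is again a member of the family, for the
      polynomial y p(y), and so tends to 0.\<close>
    have "((\<lambda>h. (flat_exp p h - flat_exp p 0) / (h - 0)) \<longlongrightarrow> 0) (at 0)"
      by (rule Lim_transform_eventually[OF flat_exp_tendsto_0[of "[:0, 1:] * p"]])
        (auto simp: flat_exp_def eventually_at_filter)
    then show ?thesis
      using 3 by (simp add: has_field_derivative_iff flat_exp_def)
  qed
qed

lemma smooth_on_flat_exp: "smooth_on UNIV (flat_exp p)"
  unfolding smooth_on_def
proof
  fix k show "Ck_on k UNIV (flat_exp p)"
  proof (induction k arbitrary: p)
    case 0
    show ?case using flat_exp_derivative by (auto intro!: DERIV_continuous_on)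
  next
    case (Suc k)
    show ?case
      by (rule Ck_on_SucI[where f' = "\<lambda>x v. flat_exp ([:0, 0, 1:] * (p - pderiv p)) x * v"])
        (auto intro!: Ck_on_bilinear[OF bounded_bilinear_mult] Ck_on_const Suc
          has_field_derivative_imp_has_derivative flat_exp_derivative simp del: mult_pCons_left)
  qed
qed

text \<open>Not compactly supported by itself. It is composed with
  \<open>\<rho>\<^sup>2 - (t - t0)\<^sup>2\<close> or with 1 - s^2 - t^2, which makes it positive
  exactly inside an interval or a disc.\<close>

definition bump :: "real \<Rightarrow> real" where "bump = flat_exp 1"

definition bump' :: "real \<Rightarrow> real" where "bump' = flat_exp [:0, 0, 1:]"

lemma bump_derivative: "(bump has_real_derivative bump' x) (at x)"
  using flat_exp_derivative[of 1] by (simp add: bump_def bump'_def)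

lemma continuous_bump': "continuous_on UNIV bump'"
  using smooth_on_flat_exp[of "[:0, 0, 1:]"] by (auto simp: bump'_def smooth_on_def elim: allE[of _ 0])

lemma smooth_on_bump: "smooth_on UNIV bump"
  by (simp add: bump_def smooth_on_flat_exp)

lemma bump_pos: "x > 0 \<Longrightarrow> bump x > 0" and bump_zero: "x \<le> 0 \<Longrightarrow> bump x = 0"
  and bump_nonneg: "bump x \<ge> 0"
  by (auto simp: bump_def flat_exp_def)


section \<open>Symmetry of second derivatives\<close>

text \<open>Symmetry of second derivatives follows by evaluating the second difference in both orders.\<close>

lemma second_difference_mean_value:
  fixes f :: "'a::euclidean_space \<Rightarrow> real"
  assumes f: "Ck_on 2 S f" and h: "h > 0" and S: "\<And>s t. \<lbrakk>0 \<le> s; s \<le> h; 0 \<le> t; t \<le> h\<rbrakk> \<Longrightarrow> a + s *\<^sub>R v + t *\<^sub>R w \<in> S"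
  obtains s t where "0 < s" "s < h" "0 < t" "t < h"
    "f (a + h *\<^sub>R v + h *\<^sub>R w) - f (a + h *\<^sub>R v) - f (a + h *\<^sub>R w) + f a =
      h * h * frechet_derivative (\<lambda>x. frechet_derivative f (at x) v) (at (a + s *\<^sub>R v + t *\<^sub>R w)) w"
proof -
  have line: "((\<lambda>s. b + s *\<^sub>R v) has_derivative (\<lambda>s. s *\<^sub>R v)) F" for b v :: 'a and F
    by (auto intro!: derivative_eq_intros)
  have along: "((\<lambda>s. g (b + s *\<^sub>R u)) has_real_derivative frechet_derivative g (at (b + s *\<^sub>R u)) u) (at s)"
    if "(g has_derivative frechet_derivative g (at (b + s *\<^sub>R u))) (at (b + s *\<^sub>R u))" for g :: "'a \<Rightarrow> real" and b u s
    using has_derivative_compose[OF line that] linear_cmul[OF bounded_linear.linear[OF has_derivative_bounded_linear[OF that]]]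
    by (simp add: has_field_derivative_def mult_commute_abs)
  have f': "Ck_on (Suc (Suc 0)) S f" using f by (simp add: numeral_2_eq_2)
  note d1 = Ck_on_frechet(2)[OF f'] and d2 = Ck_on_frechet(2)[OF Ck_on_frechet(1)[OF f']]
  let ?D = "\<lambda>x. frechet_derivative f (at x) v"
  let ?g = "\<lambda>s. f (a + h *\<^sub>R w + s *\<^sub>R v) - f (a + s *\<^sub>R v)"
  have "\<exists>s>0. s < h \<and> ?g h - ?g 0 = (h - 0) * (?D (a + h *\<^sub>R w + s *\<^sub>R v) - ?D (a + s *\<^sub>R v))"
  proof (rule MVT2[OF h])
    fix s assume s: "0 \<le> s" "s \<le> h"
    have "a + h *\<^sub>R w + s *\<^sub>R v \<in> S" "a + s *\<^sub>R v \<in> S"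
      using S[of s h] S[of s 0] s h by (auto simp: algebra_simps)
    then show "(?g has_real_derivative (?D (a + h *\<^sub>R w + s *\<^sub>R v) - ?D (a + s *\<^sub>R v))) (at s)"
      by (intro DERIV_diff along d1)
  qed
  then obtain s where s: "0 < s" "s < h"
    and 1: "?g h - ?g 0 = h * (?D (a + h *\<^sub>R w + s *\<^sub>R v) - ?D (a + s *\<^sub>R v))" by auto
  let ?k = "\<lambda>t. ?D (a + s *\<^sub>R v + t *\<^sub>R w)"
  have "\<exists>t>0. t < h \<and> ?k h - ?k 0 = (h - 0) * frechet_derivative ?D (at (a + s *\<^sub>R v + t *\<^sub>R w)) w"
    by (rule MVT2[OF h]) (intro along d2 S, use s in auto)
  then obtain t where t: "0 < t" "t < h"
    and 2: "?k h - ?k 0 = h * frechet_derivative ?D (at (a + s *\<^sub>R v + t *\<^sub>R w)) w" by auto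
  show ?thesis
    by (rule that[OF s t]) (use 1 2 in \<open>simp add: algebra_simps\<close>)
qed

lemma frechet_derivative_commute_real:
  fixes f :: "'a::euclidean_space \<Rightarrow> real"
  assumes "open S" "Ck_on 2 S f" "a \<in> S"
  shows "frechet_derivative (\<lambda>x. frechet_derivative f (at x) v) (at a) w =
    frechet_derivative (\<lambda>x. frechet_derivative f (at x) w) (at a) v"
proof -
  let ?D = "\<lambda>v w x. frechet_derivative (\<lambda>x. frechet_derivative f (at x) v) (at x) w"
  have cont: "continuous_on S (?D v w)" for v w
    using assms(2) by (simp add: numeral_2_eq_2)
  have near: "\<exists>d>0. \<forall>x. dist x a < d \<longrightarrow> x \<in> S \<and> dist (?D v w x) (?D v w a) < e" if e: "e > 0" for e v w
  proof -
    obtain d where "d > 0" "\<forall>x\<in>S. dist x a < d \<longrightarrow> dist (?D v w x) (?D v w a) < e"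
      using cont[of v w] assms(3) e unfolding continuous_on_iff by blast
    moreover obtain d' where "d' > 0" "\<forall>x. dist x a < d' \<longrightarrow> x \<in> S"
      using assms(1,3) by (auto simp: open_dist)
    ultimately show ?thesis by (intro exI[of _ "min d d'"]) auto
  qed
  have "dist (?D v w a) (?D w v a) \<le> e" if "e > 0" for e
  proof -
    obtain d1 where d1: "d1 > 0" "\<And>x. dist x a < d1 \<Longrightarrow> x \<in> S \<and> dist (?D v w x) (?D v w a) < e / 2"
      using near[of "e / 2" v w] \<open>e > 0\<close> by auto
    obtain d2 where d2: "d2 > 0" "\<And>x. dist x a < d2 \<Longrightarrow> x \<in> S \<and> dist (?D w v x) (?D w v a) < e / 2"
      using near[of "e / 2" w v] \<open>e > 0\<close> by auto
    \<comment> \<open>Small enough that the whole parallelogram with sides h v and h w lies in both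
      neighbourhoods; the summand 1 keeps the denominator positive when v = w = 0.\<close>
    define h where "h = min d1 d2 / (norm v + norm w + 1)"
    have h: "h > 0" using d1(1) d2(1) by (auto simp: h_def intro!: divide_pos_pos add_nonneg_pos)
    have "norm v + norm w + 1 > 0" by (simp add: add_nonneg_pos)
    then have "h * (norm v + norm w + 1) = min d1 d2" by (simp add: h_def)
    moreover have "h * (norm v + norm w) < h * (norm v + norm w + 1)" using h by simp
    ultimately have hm: "h * (norm v + norm w) < min d1 d2" by linarith
    have cl: "dist (a + s *\<^sub>R v + t *\<^sub>R w) a < min d1 d2" if "0 \<le> s" "s \<le> h" "0 \<le> t" "t \<le> h" for s t
    proof -
      have "dist (a + s *\<^sub>R v + t *\<^sub>R w) a \<le> s * norm v + t * norm w"
        using norm_triangle_ineq[of "s *\<^sub>R v" "t *\<^sub>R w"] that by (simp add: dist_norm algebra_simps)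
      also have "\<dots> \<le> h * norm v + h * norm w"
        using that by (intro add_mono mult_right_mono) auto
      finally show ?thesis using hm by (simp add: algebra_simps)
    qed
    obtain s t where st: "0 < s" "s < h" "0 < t" "t < h"
      "f (a + h *\<^sub>R v + h *\<^sub>R w) - f (a + h *\<^sub>R v) - f (a + h *\<^sub>R w) + f a = h * h * ?D v w (a + s *\<^sub>R v + t *\<^sub>R w)"
      by (rule second_difference_mean_value[OF assms(2) h, of a v w]) (use cl d1 in auto)
    obtain s' t' where st': "0 < s'" "s' < h" "0 < t'" "t' < h"
      "f (a + h *\<^sub>R w + h *\<^sub>R v) - f (a + h *\<^sub>R w) - f (a + h *\<^sub>R v) + f a = h * h * ?D w v (a + s' *\<^sub>R w + t' *\<^sub>R v)"
      by (rule second_difference_mean_value[OF assms(2) h, of a w v])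
        (use cl[of t s for s t] d1 in \<open>auto simp: add.assoc add.commute[of "_ *\<^sub>R w"]\<close>)
    have "h * h * ?D v w (a + s *\<^sub>R v + t *\<^sub>R w) = h * h * ?D w v (a + s' *\<^sub>R w + t' *\<^sub>R v)"
      using st(5) st'(5) by (simp add: algebra_simps)
    then have "?D v w (a + s *\<^sub>R v + t *\<^sub>R w) = ?D w v (a + s' *\<^sub>R w + t' *\<^sub>R v)" using h by simp
    moreover have "dist (?D v w (a + s *\<^sub>R v + t *\<^sub>R w)) (?D v w a) < e / 2"
      using cl[of s t] st d1(2) by simp
    moreover have "dist (?D w v (a + s' *\<^sub>R w + t' *\<^sub>R v)) (?D w v a) < e / 2"
      using cl[of t' s'] st' d2(2) by (simp add: add.commute add.left_commute)
    ultimately show ?thesis by (metis dist_commute dist_triangle_half_l less_imp_le)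
  qed
  then show ?thesis by (metis dist_le_zero_iff field_le_epsilon add_0)
qed

text \<open>Reduction to one coordinate at a time, since the mean value theorem behind the scalar
  case has no vector-valued form.\<close>

lemma frechet_derivative_commute:
  fixes f :: "'a::euclidean_space \<Rightarrow> 'b::euclidean_space"
  assumes S: "open S" and f: "Ck_on 2 S f" and a: "a \<in> S"
  shows "frechet_derivative (\<lambda>x. frechet_derivative f (at x) v) (at a) w =
    frechet_derivative (\<lambda>x. frechet_derivative f (at x) w) (at a) v"
proof (rule euclidean_eqI)
  fix b :: 'b
  have f': "Ck_on (Suc (Suc 0)) S f" using f by (simp add: numeral_2_eq_2)
  have comp: "frechet_derivative (\<lambda>x. g x \<bullet> b) (at x) v = frechet_derivative g (at x) v \<bullet> b"
    if "g differentiable (at x)" for g :: "'a \<Rightarrow> 'b" and x v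
    using frechet_derivative_at[OF has_derivative_inner_left[OF that[unfolded frechet_derivative_works]], of b]
    by metis
  have "Ck_on 2 S (\<lambda>x. f x \<bullet> b)"
    by (rule Ck_on_bilinear[OF bounded_bilinear_inner S f Ck_on_const])
  note c = frechet_derivative_commute_real[OF S this a, of v w]
  have *: "frechet_derivative (\<lambda>x. frechet_derivative (\<lambda>x. f x \<bullet> b) (at x) v) (at a) w =
      frechet_derivative (\<lambda>x. frechet_derivative f (at x) v) (at a) w \<bullet> b" for v w
  proof -
    have d: "((\<lambda>x. frechet_derivative f (at x) v \<bullet> b) has_derivative
        (\<lambda>w. frechet_derivative (\<lambda>x. frechet_derivative f (at x) v) (at a) w \<bullet> b)) (at a)"
      by (intro has_derivative_inner_left Ck_on_frechet[OF Ck_on_frechet(1)[OF f']] a)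
    have "((\<lambda>x. frechet_derivative (\<lambda>x. f x \<bullet> b) (at x) v) has_derivative
        (\<lambda>w. frechet_derivative (\<lambda>x. frechet_derivative f (at x) v) (at a) w \<bullet> b)) (at a)"
      by (rule has_derivative_transform_within_open[OF d S a]) (use f' comp in auto)
    from frechet_derivative_at[OF this] show ?thesis by metis
  qed
  show "frechet_derivative (\<lambda>x. frechet_derivative f (at x) v) (at a) w \<bullet> b =
    frechet_derivative (\<lambda>x. frechet_derivative f (at x) w) (at a) v \<bullet> b"
    using c by (simp only: *)
qed


section \<open>Integrals over compact sets\<close>

lemma integrable_on_compact_continuous:
  fixes f :: "'a::euclidean_space \<Rightarrow> real"
  assumes "compact K" "continuous_on K f" shows "f integrable_on K"
proof -
  have "integrable lborel (\<lambda>x. indicator K x *\<^sub>R f x)" by (rule borel_integrable_compact[OF assms])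
  from integrable_on_lborel[OF this] have "(\<lambda>x. if x \<in> K then f x else 0) integrable_on UNIV"
    by (rule back_subst[where P = "\<lambda>f. f integrable_on UNIV"]) auto
  then show ?thesis by (simp add: integrable_restrict_UNIV)
qed

text \<open>Uniform continuity of \<open>f'\<close> on the smaller compact tube over
  [-\<delta>/2, \<delta>/2] makes the error in the mean value theorem uniform in y, which suffices
  for any compact \<open>K\<close>, with no condition on its boundary.\<close>

lemma has_real_derivative_integral_compact:
  fixes f f' :: "real \<Rightarrow> 'a::euclidean_space \<Rightarrow> real"
  assumes K: "compact K" and \<delta>: "\<delta> > 0"
    and der: "\<And>e y. \<lbrakk>\<bar>e\<bar> < \<delta>; y \<in> K\<rbrakk> \<Longrightarrow> ((\<lambda>e. f e y) has_real_derivative f' e y) (at e)"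
    and contf: "\<And>e. \<bar>e\<bar> < \<delta> \<Longrightarrow> continuous_on K (f e)"
    and cont: "continuous_on ({-\<delta><..<\<delta>} \<times> K) (\<lambda>(e, y). f' e y)"
  shows "((\<lambda>e. integral K (f e)) has_real_derivative integral K (f' 0)) (at 0)"
proof -
  have cont0: "continuous_on K (f' 0)"
  proof -
    have "continuous_on K (\<lambda>y. (\<lambda>(e, y). f' e y) (0, y))"
      by (rule continuous_on_compose2[OF cont]) (use \<delta> in \<open>auto intro!: continuous_intros\<close>)
    then show ?thesis by simp
  qed
  have int: "f e integrable_on K" if "\<bar>e\<bar> < \<delta>" for e
    by (rule integrable_on_compact_continuous[OF K contf[OF that]])
  have int': "f' 0 integrable_on K" by (rule integrable_on_compact_continuous[OF K cont0])
  have int1: "(\<lambda>y. c::real) integrable_on K" for c by (rule integrable_on_compact_continuous[OF K]) simp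
  \<comment> \<open>The measure of \<open>K\<close> plus 1, so that dividing by it is harmless even
    when \<open>K\<close> is null.\<close>
  define M where "M = integral K (\<lambda>y. 1::real) + 1"
  have M: "M > 0" unfolding M_def using integral_nonneg[OF int1[of 1]] by simp
  have C: "compact ({-\<delta>/2..\<delta>/2} \<times> K)" by (intro compact_Times K compact_Icc)
  have "continuous_on ({-\<delta>/2..\<delta>/2} \<times> K) (\<lambda>(e, y). f' e y)"
    by (rule continuous_on_subset[OF cont]) (use \<delta> in auto)
  from compact_uniformly_continuous[OF this C]
  have uc: "\<exists>d>0. \<forall>x\<in>{-\<delta>/2..\<delta>/2} \<times> K. \<forall>x'\<in>{-\<delta>/2..\<delta>/2} \<times> K. dist x' x < d \<longrightarrow>
      dist ((\<lambda>(e, y). f' e y) x') ((\<lambda>(e, y). f' e y) x) < \<epsilon>" if "\<epsilon> > 0" for \<epsilon>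
    using that unfolding uniformly_continuous_on_def by blast
  have main: "\<exists>d>0. \<forall>e. norm (e - 0) < d \<longrightarrow>
     norm (integral K (f e) - integral K (f 0) - integral K (f' 0) * (e - 0)) \<le> \<epsilon> * norm (e - 0)"
    if "\<epsilon> > 0" for \<epsilon>
  proof -
    from uc[OF divide_pos_pos[OF that M]]
    obtain d where d0: "d > 0" and d1: "\<forall>x\<in>{-\<delta>/2..\<delta>/2} \<times> K. \<forall>x'\<in>{-\<delta>/2..\<delta>/2} \<times> K. dist x' x < d \<longrightarrow>
        dist ((\<lambda>(e, y). f' e y) x') ((\<lambda>(e, y). f' e y) x) < \<epsilon> / M" by blast
    have d: "d > 0" "\<And>e y e'. \<lbrakk>\<bar>e\<bar> \<le> \<delta>/2; \<bar>e'\<bar> \<le> \<delta>/2; y \<in> K; dist e' e < d\<rbrakk> \<Longrightarrow> dist (f' e' y) (f' e y) < \<epsilon> / M"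
      subgoal by (rule d0)
      subgoal for e y e'
      proof -
        assume *: "\<bar>e\<bar> \<le> \<delta>/2" "\<bar>e'\<bar> \<le> \<delta>/2" "y \<in> K" "dist e' e < d"
        then have "(e, y) \<in> {-\<delta>/2..\<delta>/2} \<times> K" "(e', y) \<in> {-\<delta>/2..\<delta>/2} \<times> K" by (auto simp: abs_le_iff)
        from d1[rule_format, OF this] *(4) show ?thesis by (simp add: dist_Pair_Pair)
      qed
      done
    show ?thesis
    proof (intro exI[of _ "min d (\<delta>/2)"] conjI allI impI)
      show "min d (\<delta>/2) > 0" using d \<delta> by simp
      fix e :: real assume "norm (e - 0) < min d (\<delta>/2)"
      then have e: "\<bar>e\<bar> < d" "\<bar>e\<bar> < \<delta>/2" by auto
      have e': "\<bar>e\<bar> < \<delta>" using e \<delta> by simp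
      have pt: "norm (f e y - f 0 y - f' 0 y * e) \<le> \<epsilon> / M * \<bar>e\<bar>" if y: "y \<in> K" for y
      proof -
        have "\<exists>x. \<bar>x\<bar> \<le> \<bar>e\<bar> \<and> f e y - f 0 y = e * f' x y"
        proof (cases e "0::real" rule: linorder_cases)
          case equal then show ?thesis by auto
        next
          case greater
          have "\<exists>z>0. z < e \<and> f e y - f 0 y = (e - 0) * f' z y"
            by (rule MVT2[OF greater]) (use e' in \<open>auto intro: der y\<close>)
          then obtain z where "0 < z" "z < e" "f e y - f 0 y = (e - 0) * f' z y" by auto
          then show ?thesis by (intro exI[of _ z]) auto
        next
          case less
          have "\<exists>z>e. z < 0 \<and> f 0 y - f e y = (0 - e) * f' z y"
            by (rule MVT2[OF less]) (use e' in \<open>auto intro: der y\<close>)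
          then obtain z where "e < z" "z < 0" "f 0 y - f e y = (0 - e) * f' z y" by auto
          then show ?thesis by (intro exI[of _ z]) auto
        qed
        then obtain x where x: "\<bar>x\<bar> \<le> \<bar>e\<bar>" "f e y - f 0 y = e * f' x y" by auto
        have "dist (f' x y) (f' 0 y) < \<epsilon> / M" using d(2)[of 0 x y] x e y \<delta> by auto
        then have "\<bar>e\<bar> * \<bar>f' x y - f' 0 y\<bar> \<le> \<bar>e\<bar> * (\<epsilon> / M)"
          by (intro mult_left_mono) (auto simp: dist_real_def)
        then show ?thesis using x by (simp add: abs_mult[symmetric] algebra_simps)
      qed
      have "norm (integral K (f e) - integral K (f 0) - integral K (f' 0) * (e - 0)) =
          norm (integral K (\<lambda>y. f e y - f 0 y - f' 0 y * e))"
        using int[OF e'] int[of 0] int' \<delta> by (simp add: integral_diff integrable_diff integrable_on_mult_left)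
      also have "\<dots> \<le> integral K (\<lambda>y. \<epsilon> / M * \<bar>e\<bar>)"
        using int[OF e'] int[of 0] int' \<delta> pt int1
        by (intro integral_norm_bound_integral integrable_diff integrable_on_mult_left) auto
      also have "\<dots> = \<epsilon> / M * \<bar>e\<bar> * integral K (\<lambda>y. 1)"
        using integral_mult_right[of K "\<epsilon> / M * \<bar>e\<bar>" "\<lambda>y. 1"] by simp
      also have "\<dots> \<le> \<epsilon> / M * \<bar>e\<bar> * M"
        using that M by (intro mult_left_mono) (auto simp: M_def)
      also have "\<dots> = \<epsilon> * norm (e - 0)" using M by simp
      finally show "norm (integral K (f e) - integral K (f 0) - integral K (f' 0) * (e - 0)) \<le> \<epsilon> * norm (e - 0)" .
    qed
  qed
  show ?thesis
    unfolding has_field_derivative_def has_derivative_within_alt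
    using main by (auto intro: bounded_linear_mult_right)
qed

section \<open>Integrals of divergences with compact support\<close>

lemma integral_compactly_supported_derivative:
  fixes V D :: "real \<times> real \<Rightarrow> real"
  assumes M: "M > 0" and V: "\<And>s t. ((\<lambda>s. V (s, t)) has_real_derivative D (s, t)) (at s)"
    and D: "continuous_on UNIV D" and supp: "\<And>t. V (M, t) = 0" "\<And>t. V (-M, t) = 0"
  shows "integral (cbox (-M, -M) (M, M)) D = 0"
proof -
  have D': "continuous_on X (\<lambda>(s, t). D (s, t))" for X using continuous_on_subset[OF D] by simp
  have "integral (cbox (-M, -M) (M, M)) D =
      integral (cbox (-M) M) (\<lambda>s. integral (cbox (-M) M) (\<lambda>t. D (s, t)))"
    by (rule integral_prod_continuous) (rule continuous_on_subset[OF D], simp)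
  also have "\<dots> = integral (cbox (-M) M) (\<lambda>t. integral (cbox (-M) M) (\<lambda>s. D (s, t)))"
    by (rule integral_swap_continuous) (rule D')
  also have "\<dots> = integral (cbox (-M) M) (\<lambda>t. 0)"
  proof (rule integral_cong)
    fix t
    have "((\<lambda>s. D (s, t)) has_integral V (M, t) - V (-M, t)) {-M..M}"
      by (rule fundamental_theorem_of_calculus)
        (use M V in \<open>auto simp: has_real_derivative_iff_has_vector_derivative[symmetric] intro: has_field_derivative_at_within\<close>)
    then show "integral (cbox (-M) M) (\<lambda>s. D (s, t)) = 0"
      using supp by (simp add: integral_unique)
  qed
  finally show ?thesis by simp
qed

text \<open>\<open>U\<close> and the complement of \<open>K\<close> are open and cover the plane; on
  the first the extension follows the old formula, on the second it is 0. The paths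
  \<open>l p\<close> through \<open>p\<close> let both coordinate directions be treated at
  once.\<close>

lemma extend_by_zero:
  fixes V D :: "real \<times> real \<Rightarrow> real"
  assumes U: "open U" and K: "compact K" "K \<subseteq> U"
    and l: "\<And>p. l p 0 = p" "\<And>p. continuous_on UNIV (l p)"
    and V: "\<And>p. p \<in> U \<Longrightarrow> ((\<lambda>h. V (l p h)) has_real_derivative D p) (at 0)"
    and D: "continuous_on U D" and supp: "\<And>p. p \<in> U - K \<Longrightarrow> V p = 0"
  defines "V0 \<equiv> \<lambda>p. if p \<in> K then V p else 0" and "D0 \<equiv> \<lambda>p. if p \<in> K then D p else 0"
  shows "((\<lambda>h. V0 (l p h)) has_real_derivative D0 p) (at 0)" and "continuous_on UNIV D0"
proof -
  have nbhd: "open {h. l p h \<in> X}" if "open X" for p X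
    using open_vimage[OF that l(2)] by (simp add: vimage_def)
  have oK: "open (- K)" using K(1) by (simp add: compact_imp_closed open_Compl)
  have out: "((\<lambda>h. V0 (l p h)) has_real_derivative 0) (at 0)" if "p \<in> - K" for p
    by (rule has_field_derivative_transform_within_open[of "\<lambda>h. 0" _ _ "{h. l p h \<in> - K}"])
      (use that nbhd[OF oK] in \<open>auto simp: V0_def l(1)\<close>)
  have inn: "((\<lambda>h. V0 (l p h)) has_real_derivative D p) (at 0)" if "p \<in> U" for p
  proof (rule has_field_derivative_transform_within_open[OF V[OF that] nbhd[OF U]])
    show "V (l p h) = V0 (l p h)" if "h \<in> {h. l p h \<in> U}" for h
      using supp[of "l p h"] that by (auto simp: V0_def)
  qed (use that in \<open>simp add: l(1)\<close>)
  \<comment> \<open>On \<open>U - K\<close> both descriptions of the extension apply, so uniqueness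
    of the derivative forces \<open>D\<close> to vanish there along with \<open>V\<close>.\<close>
  have D_eq: "D0 p = D p" if "p \<in> U" for p
    using DERIV_unique[OF out inn] that by (auto simp: D0_def)
  show "((\<lambda>h. V0 (l p h)) has_real_derivative D0 p) (at 0)"
    using out[of p] inn[of p] K(2) by (auto simp: D0_def)
  have "continuous_on U D0" using D D_eq by (simp cong: continuous_on_cong)
  moreover have "continuous_on (- K) D0"
    by (rule continuous_on_eq[of _ "\<lambda>p. 0"]) (auto simp: D0_def)
  ultimately have "continuous_on (U \<union> - K) D0" using U oK by (simp add: continuous_on_open_Un)
  moreover have "U \<union> - K = UNIV" using K(2) by auto
  ultimately show "continuous_on UNIV D0" by simp
qed


text \<open>Extending both components by zero moves the integral from \<open>K\<close> to a box,
  where Fubini and the fundamental theorem of calculus apply coordinate by coordinate.\<close>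

lemma integral_divergence_eq_0:
  fixes V1 V2 D1 D2 :: "real \<times> real \<Rightarrow> real"
  assumes U: "open U" and K: "compact K" "K \<subseteq> U"
    and V1: "\<And>s t. (s, t) \<in> U \<Longrightarrow> ((\<lambda>s. V1 (s, t)) has_real_derivative D1 (s, t)) (at s)"
    and V2: "\<And>s t. (s, t) \<in> U \<Longrightarrow> ((\<lambda>t. V2 (s, t)) has_real_derivative D2 (s, t)) (at t)"
    and D: "continuous_on U D1" "continuous_on U D2"
    and supp: "\<And>p. p \<in> U - K \<Longrightarrow> V1 p = 0" "\<And>p. p \<in> U - K \<Longrightarrow> V2 p = 0"
  shows "integral K (\<lambda>p. D1 p + D2 p) = 0"
proof -
  define V1' where "V1' p = (if p \<in> K then V1 p else 0)" for p
  define V2' where "V2' p = (if p \<in> K then V2 p else 0)" for p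
  define D1' where "D1' p = (if p \<in> K then D1 p else 0)" for p
  define D2' where "D2' p = (if p \<in> K then D2 p else 0)" for p
  let ?l1 = "\<lambda>p h. (fst p + h, snd p)" and ?l2 = "\<lambda>p h. (fst p, snd p + h)"
  have s1: "((\<lambda>h. V1 (?l1 p h)) has_real_derivative D1 p) (at 0)" if "p \<in> U" for p
    using V1[of "fst p" "snd p"] DERIV_shift[of "\<lambda>s. V1 (s, snd p)" "D1 p" 0 "fst p"] that
    by (simp add: add.commute)
  have s2: "((\<lambda>h. V2 (?l2 p h)) has_real_derivative D2 p) (at 0)" if "p \<in> U" for p
    using V2[of "fst p" "snd p"] DERIV_shift[of "\<lambda>t. V2 (fst p, t)" "D2 p" 0 "snd p"] that
    by (simp add: add.commute)
  have a: "((\<lambda>h. V1' (?l1 p h)) has_real_derivative D1' p) (at 0)" and b: "continuous_on UNIV D1'" for p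
    unfolding V1'_def D1'_def
    by (rule extend_by_zero[of U K ?l1, OF U K _ _ s1 D(1) supp(1)]; auto intro!: continuous_intros)+
  have a2: "((\<lambda>h. V2' (?l2 p h)) has_real_derivative D2' p) (at 0)" and b2: "continuous_on UNIV D2'" for p
    unfolding V2'_def D2'_def
    by (rule extend_by_zero[of U K ?l2, OF U K _ _ s2 D(2) supp(2)]; auto intro!: continuous_intros)+
  have c: "((\<lambda>s. V1' (s, t)) has_real_derivative D1' (s, t)) (at s)" for s t
    using a[of "(s, t)"] DERIV_shift[of "\<lambda>s. V1' (s, t)" "D1' (s, t)" 0 s] by (simp add: add.commute)
  have c2: "((\<lambda>t. V2' (s, t)) has_real_derivative D2' (s, t)) (at t)" for s t
    using a2[of "(s, t)"] DERIV_shift[of "\<lambda>t. V2' (s, t)" "D2' (s, t)" 0 t] by (simp add: add.commute)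
  obtain M where M: "M > 0" "\<And>p. p \<in> K \<Longrightarrow> norm p < M"
    using compact_imp_bounded[OF K(1)] by (meson bounded_pos_less)
  have coord: "\<bar>s\<bar> < M" "\<bar>t\<bar> < M" if "(s, t) \<in> K" for s t
    using M(2)[OF that] norm_fst_le[of s t] norm_snd_le[of t s] by auto
  let ?Q = "cbox (-M, -M) (M, M) :: (real \<times> real) set"
  have KQ: "K \<subseteq> ?Q" using coord by (force simp: cbox_Pair_eq)
  have i1: "integral ?Q D1' = 0"
  proof (rule integral_compactly_supported_derivative[OF M(1) c b])
    show "V1' (M, t) = 0" "V1' (-M, t) = 0" for t
      using coord[of M t] coord[of "-M" t] by (auto simp: V1'_def)
  qed
  have sw: "continuous_on UNIV (\<lambda>(s, t). D2' (t, s))"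
    unfolding case_prod_beta by (rule continuous_on_compose2[OF b2]) (auto intro!: continuous_intros)
  \<comment> \<open>The second component is reduced to the first by exchanging the
    coordinates.\<close>
  have "integral ?Q (\<lambda>(s, t). D2' (t, s)) = 0"
  proof (rule integral_compactly_supported_derivative[OF M(1), where V = "\<lambda>(s, t). V2' (t, s)"])
    show "(case (M, t) of (s, t) \<Rightarrow> V2' (t, s)) = 0" "(case (-M, t) of (s, t) \<Rightarrow> V2' (t, s)) = 0" for t
      using coord[of t M] coord[of t "-M"] by (auto simp: V2'_def)
    show "((\<lambda>s. case (s, t) of (s, t) \<Rightarrow> V2' (t, s)) has_real_derivative (case (s, t) of (s, t) \<Rightarrow> D2' (t, s))) (at s)"
      for s t using c2[of t s] by simp
  qed (rule sw)
  then have i2: "integral ?Q D2' = 0"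
    using integral_swap_2dim[of "-M" "-M" M M "\<lambda>s t. D2' (s, t)"] continuous_on_subset[OF b2] by simp
  have "integral K (\<lambda>p. D1 p + D2 p) = integral ?Q (\<lambda>p. if p \<in> K then D1 p + D2 p else 0)"
    using KQ by (simp add: integral_restrict_Int Int_absorb1 Int_absorb2)
  also have "\<dots> = integral ?Q (\<lambda>p. D1' p + D2' p)"
    by (rule integral_cong) (auto simp: D1'_def D2'_def)
  also have "\<dots> = integral ?Q D1' + integral ?Q D2'"
    by (intro integral_add integrable_continuous continuous_on_subset[OF b] continuous_on_subset[OF b2]) auto
  finally show ?thesis using i1 i2 by simp
qed

section \<open>The Finsler metrics\<close>

text \<open>Separates the existence of the derivative, known from smoothness, from its value, which
  is then computed along a line.\<close>

lemma frechet_derivative_eq_DERIV: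
  fixes f :: "'a::euclidean_space \<Rightarrow> real"
  assumes "f differentiable (at u)" "((\<lambda>t. f (u + t *\<^sub>R w)) has_real_derivative D) (at 0)"
  shows "frechet_derivative f (at u) w = D"
proof -
  have line: "((\<lambda>s. u + s *\<^sub>R w) has_derivative (\<lambda>s. s *\<^sub>R w)) (at 0)"
    by (auto intro!: derivative_eq_intros)
  have d: "(f has_derivative frechet_derivative f (at u)) (at (u + 0 *\<^sub>R w))"
    using assms(1) by (simp add: frechet_derivative_works)
  have "((\<lambda>t. f (u + t *\<^sub>R w)) has_real_derivative frechet_derivative f (at u) w) (at 0)"
    using has_derivative_compose[OF line d] linear_cmul[OF bounded_linear.linear[OF has_derivative_bounded_linear[OF d]]]
    by (simp add: has_field_derivative_def mult_commute_abs)
  from DERIV_unique[OF this assms(2)] show ?thesis .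
qed

lemma open_nonzero_tangent: "open {(x :: 'a::euclidean_space, v :: 'a). v \<noteq> 0}"
proof -
  have "{(x :: 'a, v :: 'a). v \<noteq> 0} = UNIV \<times> (- {0})" by auto
  then show ?thesis by (simp add: open_Times open_Compl)
qed

lemma phi_powr:
  assumes "v \<noteq> 0"
  shows "phi l x v = ((1 + l\<^sup>2 * (x \<bullet> x)) * (v \<bullet> v) + l\<^sup>2 * ((x \<bullet> v) * (x \<bullet> v))) * (v \<bullet> v) powr (- (1 / 2))"
proof -
  have "(v \<bullet> v) powr (- (1 / 2)) = inverse (norm v)"
    by (simp add: powr_minus powr_half_sqrt norm_eq_sqrt_inner)
  then show ?thesis
    by (simp only: phi_def power2_norm_eq_inner divide_inverse power2_eq_square[of "x \<bullet> v"])
qed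

lemma smooth_on_phi: "smooth_on {(x, v). v \<noteq> 0} (\<lambda>(x, v). phi l x v)"
proof -
  let ?S = "{(x :: real^3, v :: real^3). v \<noteq> 0}"
  note S = open_nonzero_tangent
  have sf: "smooth_on ?S fst" "smooth_on ?S snd"
    by (auto intro: smooth_on_bounded_linear bounded_linear_fst bounded_linear_snd S)
  have "smooth_on ?S (\<lambda>p. (snd p \<bullet> snd p) powr (- (1 / 2)))"
    by (rule smooth_on_compose[where T = "{0<..}", OF S _ _ smooth_on_powr])
      (auto intro: smooth_on_inner S sf)
  then have "smooth_on ?S (\<lambda>p. ((1 + l\<^sup>2 * (fst p \<bullet> fst p)) * (snd p \<bullet> snd p) +
      l\<^sup>2 * ((fst p \<bullet> snd p) * (fst p \<bullet> snd p))) * (snd p \<bullet> snd p) powr (- (1 / 2)))"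
    by (intro smooth_on_mult smooth_on_add smooth_on_inner smooth_on_const sf S)
  then show ?thesis
    unfolding smooth_on_def
    by (subst Ck_on_cong[OF S, where g = "\<lambda>p. ((1 + l\<^sup>2 * (fst p \<bullet> fst p)) * (snd p \<bullet> snd p) +
      l\<^sup>2 * ((fst p \<bullet> snd p) * (fst p \<bullet> snd p))) * (snd p \<bullet> snd p) powr (- (1 / 2))"])
      (auto simp: phi_powr)
qed

lemma smooth_on_phi_fibre: "smooth_on (- {0}) (phi l x)"
proof -
  have "smooth_on (- {0}) (\<lambda>v. (\<lambda>(x, v). phi l x v) (x, v))"
    by (rule smooth_on_compose[OF _ _ _ smooth_on_phi])
      (auto intro!: smooth_on_Pair smooth_on_const smooth_on_bounded_linear[OF bounded_linear_ident])
  then show ?thesis by simp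
qed

lemma phi_alt: "phi l x v = (1 + l\<^sup>2 * (x \<bullet> x)) * norm v + (l * (x \<bullet> v))\<^sup>2 / norm v"
  by (cases "v = 0") (simp_all add: phi_def power2_norm_eq_inner[symmetric] power2_eq_square field_simps)

lemma inner_sq_le: "(l * (x \<bullet> v))\<^sup>2 \<le> l\<^sup>2 * (x \<bullet> x) * (v \<bullet> v)" for l :: real
  using mult_left_mono[OF Cauchy_Schwarz_ineq[of x v], of "l\<^sup>2"] by (simp add: power_mult_distrib mult.assoc)

lemma phi_ge_norm: "norm v \<le> phi l x v"
  by (simp add: phi_alt algebra_simps)

lemma phi_nonneg: "0 \<le> phi l x v"
  using phi_ge_norm norm_ge_zero order_trans by blast

text \<open>The upper bound for the squeeze that proves continuity at the zero section, where the
  smoothness result says nothing.\<close>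

lemma phi_le: "phi l x v \<le> (1 + 2 * l\<^sup>2 * (x \<bullet> x)) * norm v"
proof (cases "v = 0")
  case False
  then have "(l * (x \<bullet> v))\<^sup>2 / norm v \<le> l\<^sup>2 * (x \<bullet> x) * norm v"
    using inner_sq_le[of l x v]
    by (simp add: pos_divide_le_eq power2_norm_eq_inner[symmetric] power2_eq_square mult.assoc)
  then show ?thesis by (simp add: phi_alt algebra_simps)
qed (simp add: phi_alt)

text \<open>The function \<sigma> -> A \<sigma> + p^2 / \<sigma> is nondecreasing once A \<sigma>^2
  >= p^2, and Cauchy-Schwarz puts \<open>s\<close> in this range, so \<open>s\<close> may be
  replaced by the larger \<open>a + b\<close>. The remaining quotient is split by (p + q)^2 / (a +
  b) <= p^2 / a + q^2 / b.\<close>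

lemma phi_triangle: "phi l x (v + w) \<le> phi l x v + phi l x w"
proof (cases "v = 0 \<or> w = 0 \<or> v + w = 0")
  case True
  moreover have "phi l x 0 = 0" by (simp add: phi_def)
  ultimately show ?thesis using phi_nonneg[of l x v] phi_nonneg[of l x w] by auto
next
  case False
  define A where "A = 1 + l\<^sup>2 * (x \<bullet> x)"
  define p where "p u = l * (x \<bullet> u)" for u
  define s where "s = norm (v + w)"
  define a where "a = norm v"
  define b where "b = norm w"
  have pos: "s > 0" "a > 0" "b > 0" "s \<le> a + b"
    using False norm_triangle_ineq by (auto simp: s_def a_def b_def)
  have add: "p (v + w) = p v + p w" by (simp add: p_def inner_add_right algebra_simps)
  have "(p (v + w))\<^sup>2 \<le> A * (s * s)"
  proof -
    have "(p (v + w))\<^sup>2 \<le> l\<^sup>2 * (x \<bullet> x) * (s * s)"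
      using inner_sq_le[of l x "v + w"]
      by (simp only: p_def s_def power2_norm_eq_inner[symmetric] power2_eq_square)
    also have "\<dots> \<le> A * (s * s)" by (simp add: A_def algebra_simps)
    finally show ?thesis .
  qed
  also have "\<dots> \<le> A * (s * (a + b))"
    using pos by (intro mult_left_mono) (auto simp: A_def)
  finally have "(p (v + w))\<^sup>2 * (a + b - s) \<le> A * (s * (a + b)) * (a + b - s)"
    using pos by (intro mult_right_mono) auto
  then have 1: "A * s + (p (v + w))\<^sup>2 / s \<le> A * (a + b) + (p (v + w))\<^sup>2 / (a + b)"
    using pos by (simp add: field_simps)
  have "0 \<le> (p v * b - p w * a)\<^sup>2" by simp
  then have "(p v + p w)\<^sup>2 * (a * b) \<le> ((p v)\<^sup>2 * b + (p w)\<^sup>2 * a) * (a + b)"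
    by (simp add: power2_eq_square algebra_simps)
  then have 2: "(p v + p w)\<^sup>2 / (a + b) \<le> (p v)\<^sup>2 / a + (p w)\<^sup>2 / b"
    using pos by (simp add: add_frac_eq divide_le_eq pos_le_divide_eq)
  show ?thesis
  proof -
    have "phi l x u = A * norm u + (p u)\<^sup>2 / norm u" for u
      by (simp add: phi_alt A_def p_def)
    then show ?thesis
      using 1 2 unfolding s_def a_def b_def add distrib_left by (simp add: add)
  qed
qed

lemma is_norm_phi: "is_norm (phi l x)"
  unfolding is_norm_def
proof (intro conjI allI)
  fix v w c
  show "0 \<le> phi l x v" by (rule phi_nonneg)
  show "phi l x v = 0 \<longleftrightarrow> v = 0"
    using phi_ge_norm[of v l x] by (auto simp: phi_def)
  show "phi l x (c *\<^sub>R v) = \<bar>c\<bar> * phi l x v"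
  proof (cases "c = 0 \<or> v = 0")
    case False
    have "(l * (x \<bullet> c *\<^sub>R v))\<^sup>2 = \<bar>c\<bar> * \<bar>c\<bar> * (l * (x \<bullet> v))\<^sup>2"
      by (simp add: power2_eq_square)
    then show ?thesis using False by (simp add: phi_alt field_simps)
  qed (auto simp: phi_def)
  show "phi l x (v + w) \<le> phi l x v + phi l x w" by (rule phi_triangle)
qed

lemma phi_sq:
  assumes "v \<noteq> 0"
  shows "(phi l x v)\<^sup>2 = (1 + l\<^sup>2 * (x \<bullet> x))\<^sup>2 * (v \<bullet> v) + 2 * (1 + l\<^sup>2 * (x \<bullet> x)) * (l * (x \<bullet> v))\<^sup>2 +
    (l * (x \<bullet> v)) ^ 4 / (v \<bullet> v)"
proof -
  have "(A * n + z / n)\<^sup>2 = A\<^sup>2 * n\<^sup>2 + 2 * A * z + z\<^sup>2 / n\<^sup>2" if "n \<noteq> 0" for A n z :: real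
    using that by (simp add: field_simps power2_eq_square)
  from this[of "norm v"] show ?thesis
    using assms unfolding phi_alt power2_norm_eq_inner[symmetric] by simp
qed

lemma hessian_phi_sq_pos:
  assumes v: "v \<noteq> 0" and w: "w \<noteq> 0"
  shows "hessian (\<lambda>u. (phi l x u)\<^sup>2) v w w > 0"
proof -
  define A where "A = 1 + l\<^sup>2 * (x \<bullet> x)"
  define P where "P u = l * (x \<bullet> u)" for u
  \<comment> \<open>The derivative along \<open>w\<close> of the closed form in
    \<open>phi_sq\<close>; differentiating it once more along \<open>w\<close> gives the
    Hessian.\<close>
  define G where "G u = 2 * A\<^sup>2 * (u \<bullet> w) + 4 * A * P u * P w + 4 * P u ^ 3 * P w / (u \<bullet> u) -
    2 * P u ^ 4 * (u \<bullet> w) / (u \<bullet> u)\<^sup>2" for u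
  define n m k p q where "n = v \<bullet> v" and "m = v \<bullet> w" and "k = w \<bullet> w" and "p = P v" and "q = P w"
  have lin: "P (u + t *\<^sub>R w) = P u + t * P w" for u t
    by (simp add: P_def inner_add_right algebra_simps)
  have quad: "(u + t *\<^sub>R w) \<bullet> (u + t *\<^sub>R w) = u \<bullet> u + 2 * t * (u \<bullet> w) + t\<^sup>2 * (w \<bullet> w)" for u t
    by (simp add: inner_add_right inner_add_left inner_commute power2_eq_square algebra_simps)
  have lin2: "(u + t *\<^sub>R w) \<bullet> w = u \<bullet> w + t * (w \<bullet> w)" for u t
    by (simp add: inner_add_left)
  have near: "\<forall>\<^sub>F t in nhds 0. u + t *\<^sub>R w \<noteq> 0" if "u \<noteq> 0" for u
  proof -
    have "((\<lambda>t. u + t *\<^sub>R w) \<longlongrightarrow> u + 0 *\<^sub>R w) (nhds 0)" by (intro tendsto_intros filterlim_ident)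
    then show ?thesis using that by (intro tendsto_imp_eventually_ne) auto
  qed
  have "smooth_on (- {0}) (\<lambda>u. phi l x u * phi l x u)"
    by (intro smooth_on_mult smooth_on_phi_fibre) auto
  then have ck: "Ck_on (Suc (Suc 0)) (- {0}) (\<lambda>u. (phi l x u)\<^sup>2)"
    by (simp only: smooth_on_def power2_eq_square)
  have G: "frechet_derivative (\<lambda>u. (phi l x u)\<^sup>2) (at u) w = G u" if u: "u \<noteq> 0" for u
  proof (rule frechet_derivative_eq_DERIV)
    show "(\<lambda>u. (phi l x u)\<^sup>2) differentiable (at u)" using ck u by simp
    have "((\<lambda>t. A\<^sup>2 * (u \<bullet> u + 2 * t * (u \<bullet> w) + t\<^sup>2 * (w \<bullet> w)) + 2 * A * (P u + t * P w)\<^sup>2 +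
      (P u + t * P w) ^ 4 / (u \<bullet> u + 2 * t * (u \<bullet> w) + t\<^sup>2 * (w \<bullet> w))) has_real_derivative G u) (at 0)"
      using u by (auto intro!: derivative_eq_intros simp: G_def field_simps power2_eq_square power3_eq_cube power4_eq_xxxx)
    then show "((\<lambda>t. (phi l x (u + t *\<^sub>R w))\<^sup>2) has_real_derivative G u) (at 0)"
      by (rule iffD1[OF DERIV_cong_ev, rotated -1])
        (use near[OF u] in \<open>auto elim!: eventually_mono simp: phi_sq A_def[symmetric] P_def[symmetric] quad lin\<close>)
  qed
  define D where "D = 2 * A\<^sup>2 * k + 4 * A * q\<^sup>2 + 12 * p\<^sup>2 * q\<^sup>2 / n - 16 * p ^ 3 * q * m / n\<^sup>2 +
    8 * p ^ 4 * m\<^sup>2 / n ^ 3 - 2 * p ^ 4 * k / n\<^sup>2"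
  have "hessian (\<lambda>u. (phi l x u)\<^sup>2) v w w = D"
    unfolding hessian_def
  proof (rule frechet_derivative_eq_DERIV)
    show "(\<lambda>u. frechet_derivative (\<lambda>u. (phi l x u)\<^sup>2) (at u) w) differentiable (at v)" using ck v by simp
    have "((\<lambda>t. 2 * A\<^sup>2 * (m + t * k) + 4 * A * (p + t * q) * q + 4 * (p + t * q) ^ 3 * q / (n + 2 * t * m + t\<^sup>2 * k) -
        2 * (p + t * q) ^ 4 * (m + t * k) / (n + 2 * t * m + t\<^sup>2 * k)\<^sup>2) has_real_derivative D) (at 0)"
      using v by (auto intro!: derivative_eq_intros simp: D_def n_def[symmetric])
        (simp_all add: n_def D_def field_simps power2_eq_square power3_eq_cube power4_eq_xxxx)
    then have "((\<lambda>t. G (v + t *\<^sub>R w)) has_real_derivative D) (at 0)"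
      by (simp add: G_def quad lin lin2 n_def m_def k_def p_def q_def)
    then show "((\<lambda>t. frechet_derivative (\<lambda>u. (phi l x u)\<^sup>2) (at (v + t *\<^sub>R w)) w) has_real_derivative D) (at 0)"
      by (rule iffD1[OF DERIV_cong_ev, rotated -1])
        (use near[OF v] in \<open>auto elim!: eventually_mono simp: G\<close>)
  qed
  also have "D > 0"
  proof -
    have n: "n > 0" and k: "k > 0" using v w by (auto simp: n_def k_def)
    have A: "A \<ge> 1" by (simp add: A_def)
    \<comment> \<open>This is the squared component of l x along v, hence at most A - 1. In terms of
      it, D = 2 (A^2 - z^2) k + 4 A q^2 + z (4 q^2 + 8 (q - p m / n)^2): one positive term and
      otherwise nonnegative ones.\<close>
    define z where "z = p\<^sup>2 / n"
    have z: "0 \<le> z" "z < A"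
    proof -
      have "p\<^sup>2 \<le> (A - 1) * n" using inner_sq_le[of l x v] by (simp add: p_def P_def A_def n_def)
      also have "\<dots> < A * n" using n by (simp add: algebra_simps)
      finally show "z < A" using n by (simp add: z_def pos_divide_less_eq)
    qed (use n in \<open>simp add: z_def\<close>)
    then have "z\<^sup>2 < A\<^sup>2" by (intro power_strict_mono) auto
    then have 1: "2 * A\<^sup>2 * k - 2 * z\<^sup>2 * k > 0" using k by simp
    have *: "12 * q\<^sup>2 - 16 * q * (p * m / n) + 8 * (p * m / n)\<^sup>2 =
        4 * q\<^sup>2 + 8 * (q - p * m / n)\<^sup>2"
      by (simp add: power2_eq_square algebra_simps)
    then have 2: "z * (12 * q\<^sup>2 - 16 * q * (p * m / n) + 8 * (p * m / n)\<^sup>2) \<ge> 0"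
      unfolding * using z by simp
    have "D = (2 * A\<^sup>2 * k - 2 * z\<^sup>2 * k) + 4 * A * q\<^sup>2 + z * (12 * q\<^sup>2 - 16 * q * (p * m / n) + 8 * (p * m / n)\<^sup>2)"
      using n by (simp add: D_def z_def field_simps power2_eq_square power3_eq_cube power4_eq_xxxx)
    moreover have "4 * A * q\<^sup>2 \<ge> 0" using A by simp
    ultimately show ?thesis using 1 2 by linarith
  qed
  finally show ?thesis .
qed

lemma continuous_phi: "continuous_on UNIV (\<lambda>(x, v). phi l x v)"
  unfolding continuous_on_eq_continuous_at[OF open_UNIV]
proof
  fix p :: "(real^3) \<times> (real^3)"
  obtain x v where p: "p = (x, v)" by (cases p)
  show "isCont (\<lambda>(x, v). phi l x v) p"
  proof (cases "v = 0")
    case False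
    have "continuous_on {(x, v). v \<noteq> 0} (\<lambda>(x, v). phi l x v)"
      using smooth_on_phi Ck_on_imp_continuous_on smooth_on_def by blast
    then show ?thesis
      using False p continuous_on_eq_continuous_at[OF open_nonzero_tangent, of "\<lambda>(x, v). phi l x v"] by blast
  next
    case True
    have lim: "((\<lambda>q. (1 + 2 * l\<^sup>2 * (fst q \<bullet> fst q)) * norm (snd q)) \<longlongrightarrow>
        (1 + 2 * l\<^sup>2 * (fst p \<bullet> fst p)) * norm (snd p)) (at p)"
      by (intro tendsto_intros)
    have "((\<lambda>(x, v). phi l x v) \<longlongrightarrow> 0) (at p)"
    proof (rule tendsto_sandwich[OF _ _ tendsto_const])
      show "((\<lambda>q. (1 + 2 * l\<^sup>2 * (fst q \<bullet> fst q)) * norm (snd q)) \<longlongrightarrow> 0) (at p)"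
        using lim True p by simp
    qed (simp_all add: case_prod_beta phi_nonneg phi_le)
    then show ?thesis using True p by (simp add: isCont_def phi_def)
  qed
qed

lemma finsler_metric_phi: "finsler_metric (phi l)"
  unfolding finsler_metric_def minkowski_norm_def
  using continuous_phi smooth_on_phi smooth_on_phi_fibre is_norm_phi hessian_phi_sq_pos by blast

section \<open>Geodesics\<close>

lemma Ck_on_has_vector_derivative:
  assumes "Ck_on (Suc k) I f" "t \<in> I"
  shows "(f has_vector_derivative frechet_derivative f (at t) 1) (at t)"
proof -
  have d: "(f has_derivative frechet_derivative f (at t)) (at t)" using assms by (rule Ck_on_frechet(2))
  have eq: "frechet_derivative f (at t) = (\<lambda>h. h *\<^sub>R frechet_derivative f (at t) 1)"
  proof
    show "frechet_derivative f (at t) h = h *\<^sub>R frechet_derivative f (at t) 1" for h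
      using linear_cmul[OF bounded_linear.linear[OF has_derivative_bounded_linear[OF d]], of h 1] by simp
  qed
  show ?thesis unfolding has_vector_derivative_def using d by (subst (asm) eq)
qed

text \<open>The total derivative of \<open>phi l\<close> at (x, v), for v nonzero, applied to (x',
  v'). In particular \<open>dphi l x v 0 w\<close> is the momentum paired with w.\<close>

definition dphi :: "real \<Rightarrow> real^3 \<Rightarrow> real^3 \<Rightarrow> real^3 \<Rightarrow> real^3 \<Rightarrow> real" where
  "dphi l x v x' v' = 2 * l\<^sup>2 * (x \<bullet> x') * norm v + (1 + l\<^sup>2 * (x \<bullet> x)) * (v \<bullet> v') / norm v
     + 2 * l\<^sup>2 * (x \<bullet> v) * (x' \<bullet> v + x \<bullet> v') / norm v - l\<^sup>2 * (x \<bullet> v)\<^sup>2 * (v \<bullet> v') / norm v ^ 3"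

lemma has_real_derivative_inner:
  assumes "(X has_vector_derivative X') (at e)" "(Y has_vector_derivative Y') (at e)"
  shows "((\<lambda>e. X e \<bullet> Y e) has_real_derivative (X' \<bullet> Y e + X e \<bullet> Y')) (at e)"
  using bounded_bilinear.has_vector_derivative[OF bounded_bilinear_inner assms]
  by (simp add: has_real_derivative_iff_has_vector_derivative add.commute)

lemma has_real_derivative_norm:
  fixes V :: "real \<Rightarrow> 'a::real_inner"
  assumes V: "(V has_vector_derivative V') (at e)" and "V e \<noteq> 0"
  shows "((\<lambda>e. norm (V e)) has_real_derivative (V e \<bullet> V' / norm (V e))) (at e)"
  unfolding norm_eq_sqrt_inner
  by (rule DERIV_cong[OF DERIV_chain2[OF DERIV_real_sqrt has_real_derivative_inner[OF V V]]])
    (use assms(2) in \<open>simp_all add: inner_commute field_simps\<close>)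

lemma phi_chain_rule:
  assumes X: "(X has_vector_derivative X') (at e)" and V: "(V has_vector_derivative V') (at e)" and nz: "V e \<noteq> 0"
  shows "((\<lambda>e. phi l (X e) (V e)) has_real_derivative dphi l (X e) (V e) X' V') (at e)"
proof -
  have "((\<lambda>e. (1 + l\<^sup>2 * xx e) * s e + (l * xv e)\<^sup>2 / s e) has_real_derivative
      l\<^sup>2 * xx' * s e + (1 + l\<^sup>2 * xx e) * s' + 2 * l\<^sup>2 * xv e * xv' / s e - l\<^sup>2 * (xv e)\<^sup>2 * s' / (s e)\<^sup>2) (at e)"
    if "(xx has_real_derivative xx') (at e)" "(xv has_real_derivative xv') (at e)" "(s has_real_derivative s') (at e)" "s e \<noteq> 0"
    for xx xv s :: "real \<Rightarrow> real" and xx' xv' s'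
    using that by (auto intro!: derivative_eq_intros simp: field_simps power2_eq_square)
  from this[OF has_real_derivative_inner[OF X X] has_real_derivative_inner[OF X V] has_real_derivative_norm[OF V nz]] nz
  show ?thesis
    by (simp add: phi_alt dphi_def inner_commute algebra_simps add_divide_distrib power2_eq_square power3_eq_cube)
qed

text \<open>The second derivative of \<open>phi l x\<close> at v in the directions a and w. Both
  directions enter only through their components orthogonal to v, which exhibits v as a kernel
  vector.\<close>

definition fibre_hessian :: "real \<Rightarrow> real^3 \<Rightarrow> real^3 \<Rightarrow> real^3 \<Rightarrow> real^3 \<Rightarrow> real" where
  "fibre_hessian l x v a w =
    ((1 + l\<^sup>2 * (x \<bullet> x) - l\<^sup>2 * (x \<bullet> v)\<^sup>2 / (v \<bullet> v)) * (a \<bullet> w - (a \<bullet> v) * (w \<bullet> v) / (v \<bullet> v)) +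
     2 * l\<^sup>2 * (x \<bullet> a - (x \<bullet> v) * (a \<bullet> v) / (v \<bullet> v)) * (x \<bullet> w - (x \<bullet> v) * (w \<bullet> v) / (v \<bullet> v))) / norm v"

text \<open>Strict Cauchy-Schwarz expresses that w is not parallel to v, so its orthogonal component
  is nonzero; the coefficient in front of that component is at least 1, again by
  Cauchy-Schwarz.\<close>

lemma fibre_hessian_pos:
  assumes v: "v \<noteq> 0" and ind: "(w \<bullet> v)\<^sup>2 < (v \<bullet> v) * (w \<bullet> w)"
  shows "fibre_hessian l x v w w > 0"
proof -
  have n: "v \<bullet> v > 0" using v by simp
  have "l\<^sup>2 * (x \<bullet> v)\<^sup>2 / (v \<bullet> v) \<le> l\<^sup>2 * (x \<bullet> x)"
    using inner_sq_le[of l x v] n by (simp add: pos_divide_le_eq power_mult_distrib)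
  then have "1 + l\<^sup>2 * (x \<bullet> x) - l\<^sup>2 * (x \<bullet> v)\<^sup>2 / (v \<bullet> v) > 0" by simp
  moreover have "w \<bullet> w - (w \<bullet> v) * (w \<bullet> v) / (v \<bullet> v) > 0"
    using ind n by (simp add: pos_divide_less_eq power2_eq_square mult.commute)
  moreover have "2 * l\<^sup>2 * (x \<bullet> w - (x \<bullet> v) * (w \<bullet> v) / (v \<bullet> v)) * (x \<bullet> w - (x \<bullet> v) * (w \<bullet> v) / (v \<bullet> v)) \<ge> 0"
    using zero_le_power2[of "l * (x \<bullet> w - (x \<bullet> v) * (w \<bullet> v) / (v \<bullet> v))"]
    by (simp add: power2_eq_square mult.commute mult.left_commute)
  ultimately show ?thesis using v unfolding fibre_hessian_def
    by (intro divide_pos_pos add_pos_nonneg mult_pos_pos) auto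
qed

text \<open>Because straight lines solve the Euler--Lagrange equation (Hamel's condition
  \<open>F\<^bsub>xv\<^esub>(v, w) = F\<^sub>x(w)\<close>), only the fibre Hessian survives.\<close>

lemma momentum_derivative:
  assumes X: "(X has_vector_derivative V t) (at t)" and V: "(V has_vector_derivative a) (at t)" and nz: "V t \<noteq> 0"
  shows "((\<lambda>t. dphi l (X t) (V t) 0 w) has_real_derivative
    (dphi l (X t) (V t) w 0 + fibre_hessian l (X t) (V t) a w)) (at t)"
proof -
  \<comment> \<open>A computation with scalar functions of t standing for the inner products and the
    speed. That the curve has velocity V enters through the derivatives \<open>2 * xv t\<close> of
    \<open>xx\<close>, \<open>(s t)\<^sup>2 + xa\<close> of \<open>xv\<close> and \<open>m t\<close>
    of \<open>q\<close>.\<close>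
  have *: "((\<lambda>t. (1 + l\<^sup>2 * xx t) * m t / s t + 2 * l\<^sup>2 * xv t * q t / s t - l\<^sup>2 * (xv t)\<^sup>2 * m t / s t ^ 3) has_real_derivative
      (2 * l\<^sup>2 * q t * s t + 2 * l\<^sup>2 * xv t * m t / s t) +
      ((1 + l\<^sup>2 * xx t - l\<^sup>2 * (xv t)\<^sup>2 / (s t)\<^sup>2) * (aw - av * m t / (s t)\<^sup>2) +
       2 * l\<^sup>2 * (xa - xv t * av / (s t)\<^sup>2) * (q t - xv t * m t / (s t)\<^sup>2)) / s t) (at t)"
    if "(xx has_real_derivative 2 * xv t) (at t)" "(xv has_real_derivative (s t)\<^sup>2 + xa) (at t)"
      "(s has_real_derivative av / s t) (at t)" "(m has_real_derivative aw) (at t)"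
      "(q has_real_derivative m t) (at t)" "s t \<noteq> 0"
    for xx xv s m q :: "real \<Rightarrow> real" and aw av xa
  proof -
    have "s t ^ 3 \<noteq> 0" using that(6) by simp
    note d = DERIV_divide[OF DERIV_mult[OF DERIV_add[OF DERIV_const DERIV_cmult[OF that(1)]] that(4)] that(3) that(6)]
      DERIV_divide[OF DERIV_mult[OF DERIV_cmult[OF that(2)] that(5)] that(3) that(6)]
      DERIV_divide[OF DERIV_mult[OF DERIV_cmult[OF DERIV_power[OF that(2), of 2]] that(4)] DERIV_power[OF that(3), of 3] this]
    show ?thesis
      by (rule DERIV_cong[OF DERIV_diff[OF DERIV_add[OF d(1,2)] d(3)]])
        (use that(6) in \<open>simp add: field_simps power2_eq_square power3_eq_cube\<close>)
  qed
  have w: "((\<lambda>t. w) has_vector_derivative 0) (at t)" by (rule has_vector_derivative_const)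
  show ?thesis
    using *[of "\<lambda>t. X t \<bullet> X t" "\<lambda>t. X t \<bullet> V t" "\<lambda>t. norm (V t)" "X t \<bullet> a" "a \<bullet> V t" "\<lambda>t. V t \<bullet> w" "a \<bullet> w" "\<lambda>t. X t \<bullet> w"]
      has_real_derivative_inner[OF X X] has_real_derivative_inner[OF X V] has_real_derivative_norm[OF V nz]
      has_real_derivative_inner[OF V w] has_real_derivative_inner[OF X w] nz
    by (simp add: dphi_def fibre_hessian_def inner_commute power2_norm_eq_inner mult.commute mult.left_commute)
qed

text \<open>Equality in Cauchy-Schwarz says that acceleration and velocity are parallel. If they
  were not, the weight \<open>H\<close> would be positive near \<open>t0\<close>; the first
  variation along \<open>\<eta> t *\<^sub>R w\<close> is minus the integral of
  \<open>\<eta> t * H t\<close>, hence nonzero.\<close>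

lemma geodesic_acceleration:
  assumes geo: "geodesic (phi l) I \<gamma>" and t0: "t0 \<in> I"
    and X: "\<And>t. t \<in> I \<Longrightarrow> (\<gamma> has_vector_derivative v t) (at t)"
    and V: "\<And>t. t \<in> I \<Longrightarrow> (v has_vector_derivative a t) (at t)"
    and a: "continuous_on I a" and nz: "\<And>t. t \<in> I \<Longrightarrow> v t \<noteq> 0"
  shows "(a t0 \<bullet> v t0)\<^sup>2 = (v t0 \<bullet> v t0) * (a t0 \<bullet> a t0)"
proof (rule ccontr)
  assume "(a t0 \<bullet> v t0)\<^sup>2 \<noteq> (v t0 \<bullet> v t0) * (a t0 \<bullet> a t0)"
  then have ind: "(a t0 \<bullet> v t0)\<^sup>2 < (v t0 \<bullet> v t0) * (a t0 \<bullet> a t0)"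
    using Cauchy_Schwarz_ineq[of "a t0" "v t0"] by (simp add: mult.commute)
  have I: "open I" and smooth: "smooth_on I \<gamma>" using geo by (auto simp: geodesic_def regular_curve_def)
  define w where "w = a t0"
  define H where "H t = fibre_hessian l (\<gamma> t) (v t) (a t) w" for t
  have cX: "continuous_on I \<gamma>" and cV: "continuous_on I v"
    using X V by (auto intro!: continuous_at_imp_continuous_on has_vector_derivative_continuous)
  have cH: "continuous_on I H"
    unfolding H_def fibre_hessian_def using nz by (intro continuous_intros cX cV a) auto
  have "H t0 > 0" unfolding H_def w_def using fibre_hessian_pos[OF nz[OF t0] ind] .
  then obtain d where d: "d > 0" "\<And>t. t \<in> I \<Longrightarrow> dist t t0 < d \<Longrightarrow> H t > 0"
    using cH t0 unfolding continuous_on_iff by (metis dist_real_def abs_diff_less_iff diff_zero diff_self)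
  obtain r where r: "r > 0" "cball t0 r \<subseteq> I" using I t0 by (meson open_contains_cball)
  define \<rho> where "\<rho> = min r (d / 2)"
  have \<rho>: "\<rho> > 0" "{t0-\<rho>..t0+\<rho>} \<subseteq> I" "\<And>t. t \<in> {t0-\<rho>..t0+\<rho>} \<Longrightarrow> H t > 0"
    subgoal using d r by (simp add: \<rho>_def)
    subgoal using r by (force simp: \<rho>_def dist_real_def)
    subgoal for t using r d by (intro d(2)) (force simp: \<rho>_def dist_real_def)+
    done
  let ?J = "{t0-\<rho>..t0+\<rho>}"
  define \<eta> where "\<eta> t = bump (\<rho>\<^sup>2 - (t - t0)\<^sup>2)" for t
  define \<eta>' where "\<eta>' t = bump' (\<rho>\<^sup>2 - (t - t0)\<^sup>2) * (- 2 * (t - t0))" for t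
  have \<eta>: "(\<eta> has_real_derivative \<eta>' t) (at t)" for t
    unfolding \<eta>_def \<eta>'_def by (rule DERIV_chain2[OF bump_derivative]) (auto intro!: derivative_eq_intros)
  have c\<eta>: "continuous_on S \<eta>" for S
    using DERIV_continuous_on[of S \<eta> \<eta>'] \<eta> has_field_derivative_at_within by blast
  have c\<eta>': "continuous_on S \<eta>'" for S
    unfolding \<eta>'_def by (intro continuous_intros continuous_on_compose2[OF continuous_bump']) auto
  have out: "\<eta> t = 0" if "t \<notin> {t0-\<rho><..<t0+\<rho>}" for t
  proof -
    have "\<bar>\<rho>\<bar> \<le> \<bar>t - t0\<bar>" using that \<rho>(1) by auto
    then show ?thesis by (auto simp: \<eta>_def abs_le_square_iff intro!: bump_zero)
  qed
  define \<Gamma> where "\<Gamma> e t = \<gamma> t + (e * \<eta> t) *\<^sub>R w" for e t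
  have "curve_variation I \<gamma> 1 (t0-\<rho>) (t0+\<rho>) \<Gamma>"
    unfolding curve_variation_def
  proof (intro conjI ballI)
    have U: "open ({-1<..<1::real} \<times> I)" by (intro open_Times I) auto
    have s1: "smooth_on ({-1<..<1::real} \<times> I) (\<lambda>p. \<gamma> (snd p))"
      by (rule smooth_on_compose[OF U _ _ smooth]) (auto intro: smooth_on_bounded_linear bounded_linear_snd U)
    have "smooth_on UNIV (\<lambda>t. bump (\<rho> * \<rho> + (- 1) * ((t + - t0) * (t + - t0))))"
      by (rule smooth_on_compose[OF _ _ _ smooth_on_bump])
        (intro smooth_on_add smooth_on_mult smooth_on_const smooth_on_bounded_linear[OF bounded_linear_ident] open_UNIV subset_UNIV)+
    moreover have "\<eta> = (\<lambda>t. bump (\<rho> * \<rho> + (- 1) * ((t + - t0) * (t + - t0))))"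
      by (simp add: \<eta>_def power2_eq_square fun_eq_iff)
    ultimately have "smooth_on UNIV \<eta>" by (simp only:)
    from smooth_on_compose[OF U subset_UNIV smooth_on_bounded_linear[OF bounded_linear_snd U] this]
    have s2: "smooth_on ({-1<..<1::real} \<times> I) (\<lambda>p. \<eta> (snd p))" .
    show "smooth_on ({- 1<..<1} \<times> I) (\<lambda>(e, t). \<Gamma> e t)"
      unfolding \<Gamma>_def case_prod_beta
      by (intro smooth_on_add smooth_on_scaleR smooth_on_mult smooth_on_const U s1 s2 smooth_on_bounded_linear bounded_linear_fst)
  qed (use \<rho> out in \<open>auto simp: \<Gamma>_def\<close>)
  with geo have D0: "((\<lambda>e. curve_length (phi l) (t0-\<rho>) (t0+\<rho>) (\<Gamma> e)) has_real_derivative 0) (at 0)"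
    by (auto simp: geodesic_def)
  define f where "f e t = phi l (\<gamma> t + (e * \<eta> t) *\<^sub>R w) (v t + (e * \<eta>' t) *\<^sub>R w)" for e t
  define f' where "f' e t = dphi l (\<gamma> t + (e * \<eta> t) *\<^sub>R w) (v t + (e * \<eta>' t) *\<^sub>R w) (\<eta> t *\<^sub>R w) (\<eta>' t *\<^sub>R w)" for e t
  have len: "curve_length (phi l) (t0-\<rho>) (t0+\<rho>) (\<Gamma> e) = integral ?J (f e)" for e
    unfolding curve_length_def
  proof (rule integral_cong)
    fix t assume "t \<in> ?J"
    then have t: "t \<in> I" using \<rho>(2) by auto
    have "(\<Gamma> e has_vector_derivative v t + (e * \<eta>' t) *\<^sub>R w) (at t)"
      unfolding \<Gamma>_def
      by (rule has_vector_derivative_eq_rhs, rule has_vector_derivative_add[OF X[OF t] has_vector_derivative_scaleR[OF DERIV_cmult[OF \<eta>] has_vector_derivative_const]]) simp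
    from vector_derivative_at[OF this] show "phi l (\<Gamma> e t) (vector_derivative (\<Gamma> e) (at t)) = f e t"
      by (simp add: f_def \<Gamma>_def)
  qed
  have cJ: "continuous_on ?J \<gamma>" "continuous_on ?J v" "continuous_on ?J a" "continuous_on ?J H"
    using cX cV a cH \<rho>(2) by (auto intro: continuous_on_subset)
  \<comment> \<open>\<open>phi l\<close> is differentiable only off the zero section, so the varied
    velocity must not vanish on the interval. The bound is the least speed divided by a bound for
    the velocity of the test field.\<close>
  obtain \<delta> where \<delta>: "\<delta> > 0" "\<And>e t. \<bar>e\<bar> < \<delta> \<Longrightarrow> t \<in> ?J \<Longrightarrow> v t + (e * \<eta>' t) *\<^sub>R w \<noteq> 0"
  proof -
    have J: "compact ?J" "?J \<noteq> {}" using \<rho>(1) by auto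
    obtain t1 where t1: "t1 \<in> ?J" "\<And>t. t \<in> ?J \<Longrightarrow> norm (v t1) \<le> norm (v t)"
      using continuous_attains_inf[OF J continuous_on_norm[OF cJ(2)]] by blast
    have "continuous_on ?J (\<lambda>t. norm (\<eta>' t *\<^sub>R w))" by (intro continuous_intros c\<eta>')
    then obtain t2 where t2: "t2 \<in> ?J" "\<And>t. t \<in> ?J \<Longrightarrow> norm (\<eta>' t *\<^sub>R w) \<le> norm (\<eta>' t2 *\<^sub>R w)"
      using continuous_attains_sup[OF J] by blast
    define B where "B = norm (\<eta>' t2 *\<^sub>R w) + 1"
    have B: "B > 0" by (simp add: B_def add_nonneg_pos)
    have c: "norm (v t1) > 0" using nz t1(1) \<rho>(2) by auto
    show ?thesis
    proof (rule that)
      show "norm (v t1) / B > 0" using B c by simp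
      fix e t assume e: "\<bar>e\<bar> < norm (v t1) / B" and t: "t \<in> ?J"
      show "v t + (e * \<eta>' t) *\<^sub>R w \<noteq> 0"
      proof
        assume "v t + (e * \<eta>' t) *\<^sub>R w = 0"
        then have "norm (v t) = norm (- (e *\<^sub>R (\<eta>' t *\<^sub>R w)))" by (metis add_eq_0_iff2 scaleR_scaleR)
        also have "\<dots> = \<bar>e\<bar> * norm (\<eta>' t *\<^sub>R w)" by (simp add: abs_mult)
        also have "\<dots> \<le> \<bar>e\<bar> * B" using t2(2)[OF t] by (intro mult_left_mono) (auto simp: B_def)
        also have "\<dots> < norm (v t1)" using e B by (simp add: pos_less_divide_eq)
        finally show False using t1(2)[OF t] by simp
      qed
    qed
  qed
  have "((\<lambda>e. integral ?J (f e)) has_real_derivative integral ?J (f' 0)) (at 0)"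
  proof (rule has_real_derivative_integral_compact[OF _ \<delta>(1)])
    fix e t assume e: "\<bar>e\<bar> < \<delta>" and t: "t \<in> ?J"
    have "((\<lambda>e. x + (e * c) *\<^sub>R w) has_vector_derivative c *\<^sub>R w) (at e)" for x c
      by (rule has_vector_derivative_eq_rhs, rule has_vector_derivative_add[OF has_vector_derivative_const has_vector_derivative_scaleR[OF _ has_vector_derivative_const]])
        (auto intro!: derivative_eq_intros)
    from phi_chain_rule[OF this this \<delta>(2)[OF e t]]
    show "((\<lambda>e. f e t) has_real_derivative f' e t) (at e)" unfolding f_def f'_def .
  next
    fix e assume e: "\<bar>e\<bar> < \<delta>"
    show "continuous_on ?J (f e)"
      unfolding f_def phi_def using \<delta>(2)[OF e] by (intro continuous_intros cJ c\<eta> c\<eta>') auto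
  next
    have c2: "continuous_on ({-\<delta><..<\<delta>} \<times> ?J) (\<lambda>p. g (snd p))" if "continuous_on ?J g" for g :: "real \<Rightarrow> 'b::topological_space"
      by (rule continuous_on_compose2[OF that]) (auto intro!: continuous_intros)
    show "continuous_on ({-\<delta><..<\<delta>} \<times> ?J) (\<lambda>(e, t). f' e t)"
      unfolding f'_def dphi_def case_prod_beta
      using \<delta>(2) by (intro continuous_intros c2 cJ c\<eta> c\<eta>') (auto simp: abs_less_iff)
  qed auto
  with D0 have int0: "integral ?J (f' 0) = 0" unfolding len by (rule DERIV_unique[symmetric])
  \<comment> \<open>The integrand is the derivative of the cutoff times the momentum:
    differentiating the cutoff gives the velocity part of the first variation, and
    \<open>momentum_derivative\<close> gives its position part plus the Hessian term. The cutoff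
    kills the boundary values.\<close>
  have "((\<lambda>t. f' 0 t + \<eta> t * H t) has_integral
      \<eta> (t0+\<rho>) * dphi l (\<gamma> (t0+\<rho>)) (v (t0+\<rho>)) 0 w - \<eta> (t0-\<rho>) * dphi l (\<gamma> (t0-\<rho>)) (v (t0-\<rho>)) 0 w) ?J"
  proof (rule fundamental_theorem_of_calculus)
    fix t assume "t \<in> ?J"
    then have t: "t \<in> I" using \<rho>(2) by auto
    have "((\<lambda>t. \<eta> t * dphi l (\<gamma> t) (v t) 0 w) has_real_derivative (f' 0 t + \<eta> t * H t)) (at t)"
      by (rule DERIV_cong[OF DERIV_mult[OF \<eta> momentum_derivative[OF X[OF t] V[OF t] nz[OF t]]]])
        (use nz[OF t] in \<open>simp add: f'_def dphi_def H_def field_simps\<close>)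
    then show "((\<lambda>t. \<eta> t * dphi l (\<gamma> t) (v t) 0 w) has_vector_derivative (f' 0 t + \<eta> t * H t)) (at t within ?J)"
      by (simp add: has_real_derivative_iff_has_vector_derivative has_vector_derivative_at_within)
  qed (use \<rho>(1) in simp)
  then have "((\<lambda>t. f' 0 t + \<eta> t * H t) has_integral 0) ?J" by (simp add: out)
  moreover have "continuous_on ?J (f' 0)"
    unfolding f'_def dphi_def using nz \<rho>(2) by (intro continuous_intros cJ c\<eta> c\<eta>') auto
  then have "(f' 0 has_integral 0) ?J"
    using int0 by (metis integrable_continuous_real integrable_integral)
  ultimately have "((\<lambda>t. f' 0 t + \<eta> t * H t - f' 0 t) has_integral 0 - 0) ?J"
    by (rule has_integral_diff)
  then have "((\<lambda>t. \<eta> t * H t) has_integral 0) (cbox (t0-\<rho>) (t0+\<rho>))" by simp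
  moreover have "continuous_on (cbox (t0-\<rho>) (t0+\<rho>)) (\<lambda>t. \<eta> t * H t)"
    using cJ(4) by (auto intro!: continuous_on_mult c\<eta>)
  moreover have "0 \<le> \<eta> t * H t" if "t \<in> box (t0-\<rho>) (t0+\<rho>)" for t
    using \<rho>(3)[of t] that by (auto intro!: mult_nonneg_nonneg simp: less_imp_le \<eta>_def bump_nonneg)
  ultimately have "\<eta> t0 * H t0 = 0"
    using \<rho>(1) by (intro has_integral_0_cbox_imp_0[of "t0-\<rho>" "t0+\<rho>" "\<lambda>t. \<eta> t * H t"]) auto
  moreover have "\<eta> t0 > 0" using \<rho>(1) by (simp add: \<eta>_def bump_pos)
  ultimately show False using \<open>H t0 > 0\<close> by simp
qed

text \<open>The speed may vary, so the velocity need not be constant, but its direction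
  \<open>d\<close> is. Then the component of the curve orthogonal to \<open>d\<close> has derivative
  0, and its constant value \<open>c\<close> fixes the line.\<close>

lemma parallel_acceleration_imp_line:
  fixes \<gamma> :: "real \<Rightarrow> 'a::euclidean_space"
  assumes I: "is_interval I" "I \<noteq> {}"
    and X: "\<And>t. t \<in> I \<Longrightarrow> (\<gamma> has_vector_derivative v t) (at t)"
    and V: "\<And>t. t \<in> I \<Longrightarrow> (v has_vector_derivative a t) (at t)"
    and nz: "\<And>t. t \<in> I \<Longrightarrow> v t \<noteq> 0"
    and par: "\<And>t. t \<in> I \<Longrightarrow> (a t \<bullet> v t)\<^sup>2 = (v t \<bullet> v t) * (a t \<bullet> a t)"
  shows "\<exists>L. affine L \<and> aff_dim L = 1 \<and> \<gamma> ` I \<subseteq> L"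
proof -
  obtain t0 where t0: "t0 \<in> I" using I by auto
  have conv: "convex I" using I(1) by (simp add: is_interval_convex)
  \<comment> \<open>By equality in Cauchy-Schwarz, what remains of the acceleration after projection
    to the velocity has norm 0.\<close>
  have a_eq: "a t = ((v t \<bullet> a t) / (norm (v t))\<^sup>2) *\<^sub>R v t" if t: "t \<in> I" for t
  proof -
    define c where "c = (v t \<bullet> a t) / (v t \<bullet> v t)"
    have "(a t - c *\<^sub>R v t) \<bullet> (a t - c *\<^sub>R v t) = 0"
      using par[OF t] nz[OF t] by (simp add: c_def inner_diff_left inner_diff_right inner_commute field_simps power2_eq_square)
    then show ?thesis by (simp add: c_def power2_norm_eq_inner)
  qed
  have "((\<lambda>t. inverse (norm (v t)) *\<^sub>R v t) has_vector_derivative 0) (at t within I)" if t: "t \<in> I" for t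
  proof -
    have i: "((\<lambda>t. inverse (norm (v t))) has_real_derivative - (v t \<bullet> a t / norm (v t)) / (norm (v t))\<^sup>2) (at t)"
      using DERIV_inverse'[OF has_real_derivative_norm[OF V[OF t] nz[OF t]]] nz[OF t]
      by (simp add: field_simps power2_eq_square)
    have "((\<lambda>t. inverse (norm (v t)) *\<^sub>R v t) has_vector_derivative 0) (at t)"
    proof (rule has_vector_derivative_eq_rhs[OF has_vector_derivative_scaleR[OF i V[OF t]]])
      have "inverse (norm (v t)) *\<^sub>R a t = (inverse (norm (v t)) * ((v t \<bullet> a t) / (norm (v t))\<^sup>2)) *\<^sub>R v t"
        by (subst a_eq[OF t]) simp
      also have "inverse (norm (v t)) * ((v t \<bullet> a t) / (norm (v t))\<^sup>2) = (v t \<bullet> a t / norm (v t)) / (norm (v t))\<^sup>2"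
        by (simp add: divide_inverse mult.commute)
      finally show "inverse (norm (v t)) *\<^sub>R a t + (- (v t \<bullet> a t / norm (v t)) / (norm (v t))\<^sup>2) *\<^sub>R v t = 0"
        by simp
    qed
    then show ?thesis by (rule has_vector_derivative_at_within)
  qed
  from has_vector_derivative_zero_constant[OF conv this]
  obtain d where d0: "\<And>t. t \<in> I \<Longrightarrow> inverse (norm (v t)) *\<^sub>R v t = d" by blast
  have v_eq: "v t = norm (v t) *\<^sub>R d" if "t \<in> I" for t
    using d0[OF that, symmetric] nz[OF that] by simp
  have dd: "d \<bullet> d = 1"
    using d0[OF t0] nz[OF t0] by (auto simp: dot_square_norm)
  have "((\<lambda>t. \<gamma> t - (\<gamma> t \<bullet> d) *\<^sub>R d) has_vector_derivative 0) (at t within I)" if t: "t \<in> I" for t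
  proof -
    have i: "((\<lambda>t. \<gamma> t \<bullet> d) has_real_derivative v t \<bullet> d) (at t)"
      using has_real_derivative_inner[OF X[OF t] has_vector_derivative_const[of d]] by simp
    have "((\<lambda>t. \<gamma> t - (\<gamma> t \<bullet> d) *\<^sub>R d) has_vector_derivative v t - (v t \<bullet> d) *\<^sub>R d) (at t)"
      using has_vector_derivative_diff[OF X[OF t] has_vector_derivative_scaleR[OF i has_vector_derivative_const[of d]]] by simp
    moreover have "v t - (v t \<bullet> d) *\<^sub>R d = 0"
      by (subst (1 2) v_eq[OF t]) (simp add: dd)
    ultimately show ?thesis by (metis has_vector_derivative_at_within)
  qed
  from has_vector_derivative_zero_constant[OF conv this]
  obtain c where c: "\<And>t. t \<in> I \<Longrightarrow> \<gamma> t - (\<gamma> t \<bullet> d) *\<^sub>R d = c" by blast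
  have "d \<noteq> 0" using dd by auto
  then have "aff_dim (affine hull {c, c + d}) = 1" by (simp add: aff_dim_2)
  moreover have "\<gamma> t \<in> affine hull {c, c + d}" if "t \<in> I" for t
  proof -
    have "\<gamma> t = (1 - \<gamma> t \<bullet> d) *\<^sub>R c + (\<gamma> t \<bullet> d) *\<^sub>R (c + d)"
      using c[OF that] by (simp add: algebra_simps)
    then show ?thesis unfolding affine_hull_2 by (intro CollectI exI conjI) auto
  qed
  ultimately show ?thesis by (intro exI[of _ "affine hull {c, c + d}"]) auto
qed

lemma geodesic_phi_straight:
  assumes geo: "geodesic (phi l) I \<gamma>"
  shows "\<exists>L. affine L \<and> aff_dim L = 1 \<and> \<gamma> ` I \<subseteq> L"
proof -
  define v where "v t = frechet_derivative \<gamma> (at t) 1" for t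
  define a where "a t = frechet_derivative v (at t) 1" for t
  have I: "is_interval I" "I \<noteq> {}" and smooth: "smooth_on I \<gamma>" and reg: "\<And>t. t \<in> I \<Longrightarrow> vector_derivative \<gamma> (at t) \<noteq> 0"
    using geo by (auto simp: geodesic_def regular_curve_def)
  have c1: "Ck_on (Suc (Suc (Suc 0))) I \<gamma>" using smooth smooth_on_def by blast
  from Ck_on_frechet(1)[OF this] have c2: "Ck_on (Suc (Suc 0)) I v" unfolding v_def .
  from Ck_on_frechet(1)[OF this] have "Ck_on (Suc 0) I a" unfolding a_def .
  then have ca: "continuous_on I a" by (rule Ck_on_imp_continuous_on)
  have X: "(\<gamma> has_vector_derivative v t) (at t)" if "t \<in> I" for t
    unfolding v_def by (rule Ck_on_has_vector_derivative[OF c1 that])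
  have V: "(v has_vector_derivative a t) (at t)" if "t \<in> I" for t
    unfolding a_def by (rule Ck_on_has_vector_derivative[OF c2 that])
  have nz: "v t \<noteq> 0" if "t \<in> I" for t using reg[OF that] vector_derivative_at[OF X[OF that]] by simp
  show ?thesis
    by (rule parallel_acceleration_imp_line[OF I X V nz geodesic_acceleration[OF geo _ X V ca nz]])
qed

section \<open>The area density\<close>

text \<open>The inner integral for a fixed slope m, with |x| the Jacobian of y = m x. The
  antiderivative x |x| / 2 is differentiable at 0 too, so one formula serves both signs.\<close>

lemma nn_integral_abs_le:
  assumes "0 \<le> h"
  shows "(\<integral>\<^sup>+x. ennreal \<bar>x\<bar> * indicator {x. x\<^sup>2 \<le> h} x \<partial>lborel) = ennreal h"
proof -
  have set: "{x. x\<^sup>2 \<le> h} = {- sqrt h..sqrt h}"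
  proof -
    have *: "x\<^sup>2 \<le> h \<longleftrightarrow> \<bar>x\<bar> \<le> sqrt h" for x
      unfolding real_sqrt_abs[symmetric] real_sqrt_le_iff ..
    show ?thesis
      unfolding set_eq_iff mem_Collect_eq atLeastAtMost_iff * abs_le_iff by (intro allI iffI; linarith)
  qed
  have d: "((\<lambda>x. x * \<bar>x\<bar> / 2) has_real_derivative \<bar>x\<bar>) (at x)" for x :: real
  proof (cases "x = 0")
    case True
    have "((\<lambda>h::real. \<bar>h\<bar> / 2) \<longlongrightarrow> 0) (at 0)" by (auto intro!: tendsto_eq_intros)
    then have "((\<lambda>h::real. (h * \<bar>h\<bar> / 2 - 0 * \<bar>0\<bar> / 2) / (h - 0)) \<longlongrightarrow> 0) (at 0)"
      by (rule Lim_transform_eventually) (auto simp: eventually_at_filter)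
    then show ?thesis using True by (simp add: has_field_derivative_iff)
  next
    case False
    then have sq: "((\<lambda>y. sgn x * (y * y / 2)) has_real_derivative \<bar>x\<bar>) (at x)"
      by (auto intro!: derivative_eq_intros simp: abs_sgn)
    have "open {y. x * y > 0}" by (intro open_Collect_less continuous_intros)
    from has_field_derivative_transform_within_open[OF sq this] show ?thesis
      using False by (auto simp: abs_if sgn_if zero_less_mult_iff not_less_iff_gr_or_eq)
  qed
  have "(\<integral>\<^sup>+x. ennreal \<bar>x\<bar> * indicator {- sqrt h..sqrt h} x \<partial>lborel) =
      ennreal (sqrt h * \<bar>sqrt h\<bar> / 2 - (- sqrt h) * \<bar>- sqrt h\<bar> / 2)"
    using assms by (intro nn_integral_FTC_Icc d) auto
  then show ?thesis using assms by (simp add: set)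
qed

text \<open>The half-lines are treated separately, the left one by reflection, and overlap in a null
  set. The second conclusion records the sign, because \<open>ennreal\<close> truncates negative
  values and would otherwise hide the true difference.\<close>

lemma nn_integral_FTC_real:
  fixes f F :: "real \<Rightarrow> real"
  assumes f: "f \<in> borel_measurable borel" and F: "\<And>x. (F has_real_derivative f x) (at x)"
    and nonneg: "\<And>x. 0 \<le> f x" and lim: "(F \<longlongrightarrow> T) at_top" "(F \<longlongrightarrow> S) at_bot"
  shows "(\<integral>\<^sup>+x. ennreal (f x) \<partial>lborel) = ennreal (T - S)" and "S \<le> T"
proof -
  have mono: "F x \<le> F y" if "x \<le> y" for x y
    using that F nonneg by (intro DERIV_nonneg_imp_nondecreasing[OF that]) auto
  have T: "F 0 \<le> T" by (rule tendsto_lowerbound[OF lim(1)]) (auto intro!: eventually_mono[OF eventually_ge_at_top[of 0]] mono)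
  have S: "S \<le> F 0" by (rule tendsto_upperbound[OF lim(2)]) (auto intro!: eventually_mono[OF eventually_le_at_bot[of 0]] mono)
  show "S \<le> T" using S T by simp
  note [measurable] = f
  have "(\<integral>\<^sup>+x. ennreal (f x) \<partial>lborel) =
      (\<integral>\<^sup>+x. ennreal (f x) * indicator {0..} x + ennreal (f x) * indicator {..0} x \<partial>lborel)"
    by (rule nn_integral_cong_AE, rule AE_mp[OF AE_lborel_singleton[of 0]]) (auto simp: indicator_def)
  also have "\<dots> = (\<integral>\<^sup>+x. ennreal (f x) * indicator {0..} x \<partial>lborel) + (\<integral>\<^sup>+x. ennreal (f x) * indicator {..0} x \<partial>lborel)"
    by (rule nn_integral_add) auto
  also have "(\<integral>\<^sup>+x. ennreal (f x) * indicator {0..} x \<partial>lborel) = ennreal (T - F 0)"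
    by (rule nn_integral_FTC_atLeast[OF f F nonneg lim(1)])
  also have "(\<integral>\<^sup>+x. ennreal (f x) * indicator {..0} x \<partial>lborel) =
      (\<integral>\<^sup>+x. ennreal (f (- x)) * indicator {0..} x \<partial>lborel)"
    by (subst nn_integral_real_affine[where c = "-1" and t = 0]) (auto simp: indicator_def intro!: nn_integral_cong)
  also have "\<dots> = ennreal (- S - (- F (- 0)))"
  proof (rule nn_integral_FTC_atLeast[where F = "\<lambda>x. - F (- x)"])
    show "((\<lambda>x. - F (- x)) has_real_derivative f (- x)) (at x)" for x
      using DERIV_minus[OF DERIV_chain2[OF F[of "- x"] DERIV_minus[OF DERIV_ident]]] by simp
    show "((\<lambda>x. - F (- x)) \<longlongrightarrow> - S) at_top"
      using tendsto_minus[OF filterlim_compose[OF lim(2) filterlim_uminus_at_bot_at_top]] by simp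
  qed (auto simp: nonneg)
  also have "ennreal (T - F 0) + ennreal (- S - (- F (- 0))) = ennreal (T - S)"
    using T S by (subst ennreal_plus[symmetric]) auto
  finally show "(\<integral>\<^sup>+x. ennreal (f x) \<partial>lborel) = ennreal (T - S)" .
qed

text \<open>The substitution \<open>y = m x\<close> turns the area into the integral over all slopes \<open>m\<close> of
  \<open>(\<alpha> + 2 \<beta> m + \<gamma> m\<^sup>2) / (a + 2 b m + c m\<^sup>2)\<^sup>2\<close>.\<close>

lemma area_quartic_region:
  fixes a b c \<alpha> \<beta> \<gamma> :: real
  defines "D \<equiv> a * c - b\<^sup>2"
  assumes c: "c > 0" and D: "D > 0" and Q1: "\<And>m. 0 \<le> \<alpha> + 2 * \<beta> * m + \<gamma> * m\<^sup>2"
  shows "measure lborel {(x, y). (a * x\<^sup>2 + 2 * b * x * y + c * y\<^sup>2)\<^sup>2 \<le> \<alpha> * x\<^sup>2 + 2 * \<beta> * x * y + \<gamma> * y\<^sup>2} =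
    pi * (\<alpha> * c - 2 * \<beta> * b + \<gamma> * a) / (2 * D * sqrt D)"
proof -
  define S where "S = {(x, y). (a * x\<^sup>2 + 2 * b * x * y + c * y\<^sup>2)\<^sup>2 \<le> \<alpha> * x\<^sup>2 + 2 * \<beta> * x * y + \<gamma> * y\<^sup>2}"
  define q where "q m = a + 2 * b * m + c * m\<^sup>2" for m
  define h where "h m = (\<alpha> + 2 * \<beta> * m + \<gamma> * m\<^sup>2) / (q m)\<^sup>2" for m
  have q_sq: "c * q m = (c * m + b)\<^sup>2 + D" for m
    by (simp add: q_def D_def power2_eq_square algebra_simps)
  have q_pos: "q m > 0" for m
  proof -
    have "c * q m > 0" unfolding q_sq using D by (intro add_nonneg_pos) auto
    then show ?thesis using c by (simp add: zero_less_mult_iff)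
  qed
  have h_nonneg: "0 \<le> h m" for m unfolding h_def using Q1 by (intro divide_nonneg_nonneg) auto
  have [measurable]: "h \<in> borel_measurable borel" unfolding h_def q_def by measurable
  have [measurable]: "S \<in> sets borel"
    unfolding S_def case_prod_beta by (intro borel_closed closed_Collect_le continuous_intros)
  have S2 [measurable]: "S \<in> sets (lborel \<Otimes>\<^sub>M lborel)" using \<open>S \<in> sets borel\<close> unfolding lborel_prod by simp
  have mem: "(x, x * m) \<in> S \<longleftrightarrow> x\<^sup>2 \<le> h m" if "x \<noteq> 0" for x m
  proof -
    have "(a * x\<^sup>2 + 2 * b * x * (x * m) + c * (x * m)\<^sup>2)\<^sup>2 = x\<^sup>2 * (x\<^sup>2 * (q m)\<^sup>2)"
      by (simp add: q_def power2_eq_square algebra_simps)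
    moreover have "\<alpha> * x\<^sup>2 + 2 * \<beta> * x * (x * m) + \<gamma> * (x * m)\<^sup>2 = x\<^sup>2 * (\<alpha> + 2 * \<beta> * m + \<gamma> * m\<^sup>2)"
      by (simp add: power2_eq_square algebra_simps)
    ultimately have "(x, x * m) \<in> S \<longleftrightarrow> x\<^sup>2 * (x\<^sup>2 * (q m)\<^sup>2) \<le> x\<^sup>2 * (\<alpha> + 2 * \<beta> * m + \<gamma> * m\<^sup>2)"
      unfolding S_def mem_Collect_eq case_prod_conv by (simp only:)
    also have "\<dots> \<longleftrightarrow> x\<^sup>2 * (q m)\<^sup>2 \<le> \<alpha> + 2 * \<beta> * m + \<gamma> * m\<^sup>2"
      using that by (intro mult_le_cancel_left_pos) simp
    also have "\<dots> \<longleftrightarrow> x\<^sup>2 \<le> h m" using q_pos[of m] by (simp add: h_def pos_le_divide_eq)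
    finally show ?thesis .
  qed
  \<comment> \<open>The constants solve \<open>C q + v q - (u + v m) q' = \<alpha> + 2 \<beta> m + \<gamma> m\<^sup>2\<close>.\<close>
  define C where "C = (\<alpha> * c - 2 * \<beta> * b + \<gamma> * a) / (2 * D)"
  define v where "v = C - \<gamma> / c"
  define u where "u = (C * b - \<beta>) / c"
  \<comment> \<open>The arctangent part has derivative C / q and the rational part (v q - (u + v m)
    q') / q^2; the equation for the constants makes their sum h. Only the arctangent survives in the
    limits at infinity.\<close>
  define F where "F m = C / sqrt D * arctan ((c * m + b) / sqrt D) + (u + v * m) / q m" for m
  have F: "(F has_real_derivative h m) (at m)" for m
  proof -
    have sD: "sqrt D > 0" "sqrt D * sqrt D = D" using D by auto
    have dq: "(q has_real_derivative 2 * b + 2 * c * m) (at m)"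
      unfolding q_def by (auto intro!: derivative_eq_intros)
    have d1: "((\<lambda>m. (c * m + b) / sqrt D) has_real_derivative c / sqrt D) (at m)"
      by (rule DERIV_cdivide) (auto intro!: derivative_eq_intros)
    have e1: "C / sqrt D * (inverse (1 + ((c * m + b) / sqrt D)\<^sup>2) * (c / sqrt D)) = C / q m"
    proof -
      have "1 + ((c * m + b) / sqrt D)\<^sup>2 = c * q m / D"
        unfolding power_divide real_sqrt_pow2[OF less_imp_le[OF D]] q_sq using D by (simp add: add_divide_distrib)
      then show ?thesis using sD c q_pos[of m] D by (simp add: divide_simps)
    qed
    have d2: "((\<lambda>m. (u + v * m) / q m) has_real_derivative (v * q m - (u + v * m) * (2 * b + 2 * c * m)) / (q m * q m)) (at m)"
      by (rule DERIV_cong[OF DERIV_divide[OF DERIV_add[OF DERIV_const DERIV_cmult[OF DERIV_ident]] dq]])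
        (use q_pos[of m] in auto)
    have e2: "C * q m + (v * q m - (u + v * m) * (2 * b + 2 * c * m)) = \<alpha> + 2 * \<beta> * m + \<gamma> * m\<^sup>2"
    proof -
      have vc: "v * c = C * c - \<gamma>" and uc: "u * c = C * b - \<beta>" using c by (auto simp: v_def u_def field_simps)
      have CD: "2 * C * (a * c - b\<^sup>2) = \<alpha> * c - 2 * \<beta> * b + \<gamma> * a" using D by (simp add: C_def D_def[symmetric])
      have "c * (C * a + v * a - 2 * u * b) = C * a * c + (v * c) * a - 2 * (u * c) * b" by (simp add: algebra_simps)
      also have "\<dots> = c * \<alpha>" unfolding vc uc using CD by (simp add: algebra_simps power2_eq_square)
      finally have c0: "C * a + v * a - 2 * u * b = \<alpha>" using c by simp
      have "C * q m + (v * q m - (u + v * m) * (2 * b + 2 * c * m)) =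
          (C * a + v * a - 2 * u * b) + 2 * (C * b - u * c) * m + (C * c - v * c) * m\<^sup>2"
        by (simp add: q_def algebra_simps power2_eq_square)
      then show ?thesis unfolding c0 vc uc by simp
    qed
    have "(F has_real_derivative C / q m + (v * q m - (u + v * m) * (2 * b + 2 * c * m)) / (q m * q m)) (at m)"
      unfolding F_def by (rule DERIV_cong[OF DERIV_add[OF DERIV_cmult[OF DERIV_chain2[OF DERIV_arctan d1]] d2]]) (simp only: e1)
    also have "C / q m + (v * q m - (u + v * m) * (2 * b + 2 * c * m)) / (q m * q m) = h m"
    proof -
      have "C / z + X / (z * z) = (C * z + X) / z\<^sup>2" if "z \<noteq> 0" for X z :: real
        using that by (simp add: add_divide_distrib power2_eq_square)
      from this[of "q m"] q_pos[of m] show ?thesis unfolding h_def e2[symmetric] by simp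
    qed
    finally show ?thesis .
  qed
  have lim0: "((\<lambda>m. (u + v * m) / q m) \<longlongrightarrow> 0) at_infinity"
  proof -
    have i: "(inverse \<longlongrightarrow> (0::real)) at_infinity" by (rule tendsto_inverse_0)
    have "((\<lambda>m. (u * (inverse m)\<^sup>2 + v * inverse m) / (a * (inverse m)\<^sup>2 + 2 * b * inverse m + c)) \<longlongrightarrow>
        (u * 0\<^sup>2 + v * 0) / (a * 0\<^sup>2 + 2 * b * 0 + c)) at_infinity"
      by (intro tendsto_intros i) (use c in auto)
    moreover have "\<forall>\<^sub>F m in at_infinity. (u * (inverse m)\<^sup>2 + v * inverse m) / (a * (inverse m)\<^sup>2 + 2 * b * inverse m + c) =
        (u + v * m) / q m"
    proof (rule eventually_mono[OF eventually_not_equal_at_infinity[of 0]])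
      fix m :: real assume m: "m \<noteq> 0"
      have "(u * (inverse m)\<^sup>2 + v * inverse m) / (a * (inverse m)\<^sup>2 + 2 * b * inverse m + c) =
          (m\<^sup>2 * (u * (inverse m)\<^sup>2 + v * inverse m)) / (m\<^sup>2 * (a * (inverse m)\<^sup>2 + 2 * b * inverse m + c))"
        using m by simp
      also have "m\<^sup>2 * (u * (inverse m)\<^sup>2 + v * inverse m) = u + v * m"
        using m by (simp add: field_simps power2_eq_square)
      also have "m\<^sup>2 * (a * (inverse m)\<^sup>2 + 2 * b * inverse m + c) = q m"
        using m by (simp add: q_def field_simps power2_eq_square)
      finally show "(u * (inverse m)\<^sup>2 + v * inverse m) / (a * (inverse m)\<^sup>2 + 2 * b * inverse m + c) = (u + v * m) / q m" .
    qed
    ultimately show ?thesis using Lim_transform_eventually by fastforce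
  qed
  have aff: "(\<lambda>m. (c * m + b) / sqrt D) = (\<lambda>m. b / sqrt D + c / sqrt D * m)"
    by (simp add: add_divide_distrib add.commute)
  have cD: "0 < c / sqrt D" using c D by simp
  have "filterlim (\<lambda>m. - (b / sqrt D) + c / sqrt D * (- m)) at_top at_bot"
    by (intro filterlim_tendsto_add_at_top[OF tendsto_const] filterlim_tendsto_pos_mult_at_top[OF tendsto_const cD]
        filterlim_uminus_at_top_at_bot)
  then have lim_bot: "filterlim (\<lambda>m. b / sqrt D + c / sqrt D * m) at_bot at_bot"
    by (simp add: filterlim_uminus_at_bot)
  have lim: "(F \<longlongrightarrow> C / sqrt D * (pi / 2) + 0) at_top" "(F \<longlongrightarrow> C / sqrt D * (- (pi / 2)) + 0) at_bot"
    subgoal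
      unfolding F_def
      by (intro tendsto_add tendsto_mult tendsto_const tendsto_mono[OF at_top_le_at_infinity lim0] filterlim_compose[OF tendsto_arctan_at_top], unfold aff)
        (intro filterlim_tendsto_add_at_top[OF tendsto_const] filterlim_tendsto_pos_mult_at_top[OF tendsto_const cD] filterlim_ident)
    subgoal
      unfolding F_def
      by (intro tendsto_add tendsto_mult tendsto_const tendsto_mono[OF at_bot_le_at_infinity lim0] filterlim_compose[OF tendsto_arctan_at_bot], unfold aff)
        (rule lim_bot)
    done
  have "emeasure lborel S = (\<integral>\<^sup>+x. \<integral>\<^sup>+y. indicator S (x, y) \<partial>lborel \<partial>lborel)"
    by (simp add: lborel.emeasure_pair_measure[OF S2, unfolded lborel_prod])
  also have "\<dots> = (\<integral>\<^sup>+x. \<integral>\<^sup>+m. ennreal \<bar>x\<bar> * indicator {x. x\<^sup>2 \<le> h m} x \<partial>lborel \<partial>lborel)"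
  \<comment> \<open>The substitution y = x m degenerates at x = 0, which is discarded as a null
    set.\<close>
  proof (rule nn_integral_cong_AE, rule AE_mp[OF AE_lborel_singleton[of 0]], rule AE_I2, rule impI)
    fix x :: real assume x: "x \<noteq> 0"
    have "(\<integral>\<^sup>+y. indicator S (x, y) \<partial>lborel) = ennreal \<bar>x\<bar> * (\<integral>\<^sup>+m. indicator S (x, 0 + x * m) \<partial>lborel)"
      by (rule nn_integral_real_affine[OF _ x]) measurable
    also have "\<dots> = (\<integral>\<^sup>+m. ennreal \<bar>x\<bar> * indicator S (x, 0 + x * m) \<partial>lborel)"
      by (rule nn_integral_cmult[symmetric]) measurable
    also have "\<dots> = (\<integral>\<^sup>+m. ennreal \<bar>x\<bar> * indicator {x. x\<^sup>2 \<le> h m} x \<partial>lborel)"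
      by (rule nn_integral_cong) (use mem[OF x] in \<open>auto simp: indicator_def\<close>)
    finally show "(\<integral>\<^sup>+y. indicator S (x, y) \<partial>lborel) = (\<integral>\<^sup>+m. ennreal \<bar>x\<bar> * indicator {x. x\<^sup>2 \<le> h m} x \<partial>lborel)" .
  qed
  also have "\<dots> = (\<integral>\<^sup>+m. \<integral>\<^sup>+x. ennreal \<bar>x\<bar> * indicator {x. x\<^sup>2 \<le> h m} x \<partial>lborel \<partial>lborel)"
    by (rule lborel_pair.Fubini') measurable
  also have "\<dots> = (\<integral>\<^sup>+m. ennreal (h m) \<partial>lborel)" by (simp add: nn_integral_abs_le h_nonneg)
  also have "\<dots> = ennreal ((C / sqrt D * (pi / 2) + 0) - (C / sqrt D * (- (pi / 2)) + 0))"
    by (rule nn_integral_FTC_real(1)[OF _ F h_nonneg lim]) measurable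
  also have "\<dots> = ennreal (C / sqrt D * pi)" by (simp add: field_simps)
  finally have em: "emeasure lborel S = ennreal (C / sqrt D * pi)" .
  \<comment> \<open>The sign is needed to read the extended value back as a real measure, since
    \<open>ennreal\<close> of a negative number is 0.\<close>
  have "C / sqrt D * (- (pi / 2)) + 0 \<le> C / sqrt D * (pi / 2) + 0"
    by (rule nn_integral_FTC_real(2)[OF _ F h_nonneg lim]) measurable
  then have "0 \<le> C / sqrt D * pi" by simp
  then have "measure lborel S = C / sqrt D * pi"
    using em by (simp add: measure_def)
  then show ?thesis by (simp add: S_def C_def)
qed


section \<open>The area integrand of \<open>phi l\<close>\<close>

definition area_form :: "real^3 \<Rightarrow> real^3 \<Rightarrow> real" where
  "area_form v1 v2 = (v1 \<bullet> v1) * (v2 \<bullet> v2) - (v1 \<bullet> v2)\<^sup>2"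

text \<open>For independent v1, v2 this is the Gram determinant \<open>area_form v1 v2\<close> times
  the squared norm of the projection of l x to their plane. Absorbing the determinant keeps the
  expression polynomial in the vectors.\<close>

definition tilt_form :: "real \<Rightarrow> real^3 \<Rightarrow> real^3 \<Rightarrow> real^3 \<Rightarrow> real" where
  "tilt_form l x v1 v2 = l\<^sup>2 * ((v1 \<bullet> v1) * (x \<bullet> v2)\<^sup>2 - 2 * (v1 \<bullet> v2) * (x \<bullet> v1) * (x \<bullet> v2) + (v2 \<bullet> v2) * (x \<bullet> v1)\<^sup>2)"

lemma area_form_cross: "area_form v1 v2 = (norm (cross3 v1 v2))\<^sup>2"
  unfolding norm_cross by (simp add: area_form_def power2_norm_eq_inner)

text \<open>The vector \<open>(x \<bullet> v2) *\<^sub>R v1 - (x \<bullet> v1) *\<^sub>R v2\<close>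
  is the triple product of x with the cross product of v1 and v2; the form is l^2 times its squared
  norm.\<close>

lemma tilt_form_nonneg: "0 \<le> tilt_form l x v1 v2"
proof -
  have "tilt_form l x v1 v2 = l\<^sup>2 * (((x \<bullet> v2) *\<^sub>R v1 - (x \<bullet> v1) *\<^sub>R v2) \<bullet> ((x \<bullet> v2) *\<^sub>R v1 - (x \<bullet> v1) *\<^sub>R v2))"
    by (simp add: tilt_form_def inner_diff_left inner_diff_right inner_commute power2_eq_square algebra_simps)
  then show ?thesis by simp
qed

lemma bivector_volume_phi:
  fixes v1 v2 x :: "real^3" and l :: real
  defines "A \<equiv> 1 + l\<^sup>2 * (x \<bullet> x)" and "W \<equiv> area_form v1 v2" and "T \<equiv> tilt_form l x v1 v2"
  assumes nz: "cross3 v1 v2 \<noteq> 0"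
  shows "bivector_volume {v. phi l x v \<le> 1} v1 v2 =
    pi * (2 * A * W + T) / (2 * (A * (A * W + T)) * sqrt (A * (A * W + T)))"
proof -
  define \<alpha> \<beta> \<gamma> p1 p2 where "\<alpha> = v1 \<bullet> v1" and "\<beta> = v1 \<bullet> v2" and "\<gamma> = v2 \<bullet> v2"
    and "p1 = l * (x \<bullet> v1)" and "p2 = l * (x \<bullet> v2)"
  \<comment> \<open>The coefficients, in the basis v1, v2, of the quadratic form A |v|^2 + (l <x,
    v>)^2; \<open>\<alpha>\<close>, \<open>\<beta>\<close>, \<open>\<gamma>\<close> are those of the
    Euclidean form.\<close>
  define a b c where "a = A * \<alpha> + p1\<^sup>2" and "b = A * \<beta> + p1 * p2" and "c = A * \<gamma> + p2\<^sup>2"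
  have A: "A \<ge> 1" by (simp add: A_def)
  have W: "W > 0" using nz by (simp add: W_def area_form_cross)
  have T: "T \<ge> 0" by (simp add: T_def tilt_form_nonneg)
  have D: "a * c - b\<^sup>2 = A * (A * W + T)"
    by (simp add: a_def b_def c_def W_def T_def area_form_def tilt_form_def \<alpha>_def[symmetric] \<beta>_def[symmetric] \<gamma>_def[symmetric]
      p1_def p2_def power2_eq_square algebra_simps)
  have Dpos: "a * c - b\<^sup>2 > 0" unfolding D using A W T by (intro mult_pos_pos add_pos_nonneg) auto
  \<comment> \<open>The left sides of \<open>D\<close> and \<open>N\<close> are the determinant and
    the trace of that form relative to the Euclidean one, each multiplied by
    \<open>W\<close>.\<close>
  have N: "\<alpha> * c - 2 * \<beta> * b + \<gamma> * a = 2 * A * W + T"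
    by (simp add: a_def b_def c_def W_def T_def area_form_def tilt_form_def \<alpha>_def[symmetric] \<beta>_def[symmetric] \<gamma>_def[symmetric]
      p1_def p2_def power2_eq_square algebra_simps)
  have v2: "v2 \<noteq> 0" using nz by auto
  then have cpos: "c > 0" using A by (auto simp: c_def \<gamma>_def intro!: add_pos_nonneg mult_pos_pos)
  have Q1: "\<alpha> * s\<^sup>2 + 2 * \<beta> * s * t + \<gamma> * t\<^sup>2 = (s *\<^sub>R v1 + t *\<^sub>R v2) \<bullet> (s *\<^sub>R v1 + t *\<^sub>R v2)" for s t
    by (simp add: \<alpha>_def \<beta>_def \<gamma>_def inner_add_left inner_add_right inner_commute power2_eq_square algebra_simps)
  have Q3: "a * s\<^sup>2 + 2 * b * s * t + c * t\<^sup>2 =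
      A * ((s *\<^sub>R v1 + t *\<^sub>R v2) \<bullet> (s *\<^sub>R v1 + t *\<^sub>R v2)) + (l * (x \<bullet> (s *\<^sub>R v1 + t *\<^sub>R v2)))\<^sup>2" for s t
    unfolding Q1[symmetric]
    by (simp add: a_def b_def c_def p1_def p2_def inner_add_right power2_eq_square algebra_simps)
  have ball: "phi l x v \<le> 1 \<longleftrightarrow> (A * (v \<bullet> v) + (l * (x \<bullet> v))\<^sup>2)\<^sup>2 \<le> v \<bullet> v" for v
  proof (cases "v = 0")
    case False
    then have n: "norm v > 0" by simp
    have "phi l x v = (A * (v \<bullet> v) + (l * (x \<bullet> v))\<^sup>2) / norm v"
      using n by (simp add: phi_alt A_def power2_norm_eq_inner[symmetric] power2_eq_square add_divide_distrib)
    then have "phi l x v \<le> 1 \<longleftrightarrow> A * (v \<bullet> v) + (l * (x \<bullet> v))\<^sup>2 \<le> norm v"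
      using n by (simp add: pos_divide_le_eq)
    also have "\<dots> \<longleftrightarrow> (A * (v \<bullet> v) + (l * (x \<bullet> v))\<^sup>2)\<^sup>2 \<le> (norm v)\<^sup>2"
      using A n by (intro power_mono_iff[symmetric]) (auto intro!: add_nonneg_nonneg mult_nonneg_nonneg)
    finally show ?thesis by (simp add: power2_norm_eq_inner)
  qed (simp add: phi_def)
  have "{(s, t). s *\<^sub>R v1 + t *\<^sub>R v2 \<in> {v. phi l x v \<le> 1}} =
      {(s, t). (a * s\<^sup>2 + 2 * b * s * t + c * t\<^sup>2)\<^sup>2 \<le> \<alpha> * s\<^sup>2 + 2 * \<beta> * s * t + \<gamma> * t\<^sup>2}"
    by (simp only: Q1 Q3 mem_Collect_eq ball)
  then have "bivector_volume {v. phi l x v \<le> 1} v1 v2 =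
      pi * (\<alpha> * c - 2 * \<beta> * b + \<gamma> * a) / (2 * (a * c - b\<^sup>2) * sqrt (a * c - b\<^sup>2))"
    unfolding bivector_volume_def
    using area_quartic_region[OF cpos Dpos, of \<alpha> \<beta> \<gamma>] Q1[of 1] by simp
  then show ?thesis unfolding D N .
qed

lemma hausdorff_integrand_phi:
  fixes v1 v2 x :: "real^3" and l :: real
  defines "A \<equiv> 1 + l\<^sup>2 * (x \<bullet> x)" and "W \<equiv> area_form v1 v2" and "T \<equiv> tilt_form l x v1 v2"
  assumes nz: "cross3 v1 v2 \<noteq> 0"
  shows "hausdorff_integrand (phi l) x v1 v2 =
    2 * (A * (A * W + T)) * sqrt (A * (A * W + T)) / (2 * A * W + T)"
proof -
  have A: "A \<ge> 1" by (simp add: A_def)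
  have W: "W > 0" using nz by (simp add: W_def area_form_cross)
  have T: "T \<ge> 0" by (simp add: T_def tilt_form_nonneg)
  have "A * (A * W + T) > 0" "2 * A * W + T > 0"
    using A W T by (auto intro!: mult_pos_pos add_pos_nonneg)
  then show ?thesis
    using nz bivector_volume_phi[OF nz, of l x]
    unfolding hausdorff_integrand_def A_def W_def T_def by simp
qed

text \<open>For dependent vectors both sides are 0, so the Euclidean integrand can be rewritten
  under the integral with no side condition.\<close>

lemma hausdorff_integrand_phi_0: "hausdorff_integrand (phi 0) x v1 v2 = sqrt (area_form v1 v2)"
proof (cases "cross3 v1 v2 = 0")
  case True
  then show ?thesis by (simp add: hausdorff_integrand_def area_form_cross)
next
  case False
  then have "area_form v1 v2 > 0" by (simp add: area_form_cross)
  then show ?thesis using hausdorff_integrand_phi[OF False, of 0 x] by (simp add: tilt_form_def)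
qed


section \<open>Derivatives along curves and parametrized planes\<close>

lemma has_vector_derivative_compose_frechet:
  assumes "(g has_vector_derivative u) (at s)" "F differentiable (at (g s))"
  shows "((\<lambda>s. F (g s)) has_vector_derivative frechet_derivative F (at (g s)) u) (at s)"
proof -
  have d: "(F has_derivative frechet_derivative F (at (g s))) (at (g s))"
    using assms(2) by (simp add: frechet_derivative_works)
  have "((\<lambda>s. F (g s)) has_derivative (\<lambda>h. frechet_derivative F (at (g s)) (h *\<^sub>R u))) (at s)"
    using has_derivative_compose[OF assms(1)[unfolded has_vector_derivative_def] d] .
  then show ?thesis
    by (simp add: has_vector_derivative_def linear_cmul[OF bounded_linear.linear[OF has_derivative_bounded_linear[OF d]]])
qed

lemma local_parametrization_affine:
  fixes p u1 u2 :: "real^3"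
  assumes orth: "u1 \<bullet> u1 = 1" "u2 \<bullet> u2 = 1" "u1 \<bullet> u2 = 0"
  defines "r \<equiv> \<lambda>y. p + fst y *\<^sub>R u1 + snd y *\<^sub>R u2"
  shows "local_parametrization (range r) UNIV r"
  unfolding local_parametrization_def
proof (intro conjI ballI)
  show "smooth_on UNIV r"
    unfolding r_def
    by (intro smooth_on_add smooth_on_scaleR smooth_on_const smooth_on_bounded_linear[OF bounded_linear_fst]
        smooth_on_bounded_linear[OF bounded_linear_snd] open_UNIV)
  have d: "(r has_derivative (\<lambda>h. fst h *\<^sub>R u1 + snd h *\<^sub>R u2)) (at y)" for y
    unfolding r_def by (auto intro!: derivative_eq_intros)
  have "partial_s r y = u1" "partial_t r y = u2" for y
    unfolding partial_s_def partial_t_def frechet_derivative_at[OF d, symmetric] by simp_all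
  moreover have "(norm (cross3 u1 u2))\<^sup>2 = 1" using orth by (simp add: area_form_cross[symmetric] area_form_def)
  ultimately show "cross3 (partial_s r y) (partial_t r y) \<noteq> 0" for y by auto
  define g where "g x = ((x - p) \<bullet> u1, (x - p) \<bullet> u2)" for x
  have "homeomorphism UNIV (range r) r g"
  proof (rule homeomorphismI)
    show gr: "g (r y) = y" for y
      using orth by (simp add: g_def r_def inner_add_left inner_add_right inner_commute)
    show "r (g x) = x" if "x \<in> range r" for x using that gr by auto
  qed (auto simp: r_def g_def intro!: continuous_intros)
  then show "\<exists>g. homeomorphism UNIV (r ` UNIV) r g" by blast
qed auto

lemma hyperplane_eq_range:
  fixes n p u1 u2 :: "real^3"
  assumes orth: "u1 \<bullet> u1 = 1" "u2 \<bullet> u2 = 1" "u1 \<bullet> u2 = 0" and n: "n \<bullet> u1 = 0" "n \<bullet> u2 = 0" "n \<noteq> 0"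
  shows "{x. n \<bullet> x = n \<bullet> p} = range (\<lambda>y. p + fst y *\<^sub>R u1 + snd y *\<^sub>R u2)"
proof safe
  fix x assume x: "n \<bullet> x = n \<bullet> p"
  \<comment> \<open>The part of x - p orthogonal to u1 and u2. Like n, it must be a multiple of the
    cross product \<open>w\<close> of u1 and u2; since it is also orthogonal to n, it
    vanishes.\<close>
  define z where "z = x - p - ((x - p) \<bullet> u1) *\<^sub>R u1 - ((x - p) \<bullet> u2) *\<^sub>R u2"
  have z: "z \<bullet> u1 = 0" "z \<bullet> u2 = 0" "n \<bullet> z = 0"
    using orth n x by (simp_all add: z_def inner_diff_left inner_diff_right inner_commute)
  define w where "w = cross3 u1 u2"
  have W: "w \<bullet> w = 1"
    using orth area_form_cross[of u1 u2] by (simp add: w_def area_form_def power2_norm_eq_inner)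
  have par: "v = (w \<bullet> v) *\<^sub>R w" if "v \<bullet> u1 = 0" "v \<bullet> u2 = 0" for v
  proof -
    have "cross3 w v = 0"
      unfolding w_def using that by (simp add: cross_skew[of _ v] Lagrange inner_commute)
    then have "cross3 w (cross3 w v) = 0" by simp
    then show ?thesis unfolding Lagrange W by simp
  qed
  have "n = (w \<bullet> n) *\<^sub>R w" by (rule par) (use n in \<open>auto simp: inner_commute\<close>)
  then have "w \<bullet> n \<noteq> 0" using n(3) by auto
  moreover have "(w \<bullet> n) * (w \<bullet> z) = 0"
    using z(3) \<open>n = (w \<bullet> n) *\<^sub>R w\<close> by (metis inner_scaleR_left)
  ultimately have "z = 0" using par[OF z(1,2)] by simp
  then have "x = p + ((x - p) \<bullet> u1) *\<^sub>R u1 + ((x - p) \<bullet> u2) *\<^sub>R u2"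
    unfolding z_def by (simp add: algebra_simps)
  then show "x \<in> range (\<lambda>y. p + fst y *\<^sub>R u1 + snd y *\<^sub>R u2)"
    by (intro range_eqI[of _ _ "((x - p) \<bullet> u1, (x - p) \<bullet> u2)"]) simp
qed (use n in \<open>simp add: inner_add_right\<close>)

section \<open>Planes are extremal for the Euclidean area\<close>

lemma parallel_to_normal:
  fixes n v :: "real^3"
  assumes "cross3 n v = 0"
  shows "(n \<bullet> n) *\<^sub>R v = (n \<bullet> v) *\<^sub>R n"
  using arg_cong[OF assms, of "cross3 n"] by (simp add: Lagrange)

lemma plane_is_surface:
  fixes n :: "real^3"
  assumes "n \<noteq> 0"
  shows "is_surface {x. n \<bullet> x = b}"
proof -
  define m where "m = n /\<^sub>R norm n"
  have m: "m \<bullet> m = 1" using assms by (simp add: m_def dot_square_norm power2_eq_square field_simps)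
  obtain y where y: "y \<noteq> 0" "orthogonal n y"
    using orthogonal_to_vector_exists[of n] by auto
  define u1 where "u1 = y /\<^sub>R norm y"
  define u2 where "u2 = cross3 m u1"
  have u1: "u1 \<bullet> u1 = 1" using y by (simp add: u1_def dot_square_norm power2_eq_square field_simps)
  have mu1: "m \<bullet> u1 = 0" using y by (simp add: m_def u1_def orthogonal_def)
  have u2: "u2 \<bullet> u2 = 1"
    using area_form_cross[of m u1] m u1 mu1 by (simp add: u2_def area_form_def power2_norm_eq_inner)
  have o: "u1 \<bullet> u2 = 0" "m \<bullet> u2 = 0" by (simp_all add: u2_def dot_cross_self)
  have n: "n \<bullet> u1 = 0" "n \<bullet> u2 = 0" using mu1 o(2) assms by (auto simp: m_def)
  define p where "p = (b / (n \<bullet> n)) *\<^sub>R n"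
  have p: "n \<bullet> p = b" using assms by (simp add: p_def)
  have range: "{x. n \<bullet> x = b} = range (\<lambda>y. p + fst y *\<^sub>R u1 + snd y *\<^sub>R u2)"
    using hyperplane_eq_range[OF u1 u2 o(1) n assms, of p] by (simp add: p)
  show ?thesis
    unfolding is_surface_def range
    using local_parametrization_affine[OF u1 u2 o(1), of p] by blast
qed

lemma has_real_derivative_sqrt_area_form:
  assumes X: "(X has_vector_derivative X') (at e)" and Y: "(Y has_vector_derivative Y') (at e)"
    and pos: "area_form (X e) (Y e) > 0"
  shows "((\<lambda>e. sqrt (area_form (X e) (Y e))) has_real_derivative
    (((X e \<bullet> X') * (Y e \<bullet> Y e) + (X e \<bullet> X e) * (Y e \<bullet> Y') - (X e \<bullet> Y e) * (X' \<bullet> Y e + X e \<bullet> Y')) / sqrt (area_form (X e) (Y e)))) (at e)"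
proof -
  have "((\<lambda>e. area_form (X e) (Y e)) has_real_derivative
      2 * ((X e \<bullet> X') * (Y e \<bullet> Y e) + (X e \<bullet> X e) * (Y e \<bullet> Y') - (X e \<bullet> Y e) * (X' \<bullet> Y e + X e \<bullet> Y'))) (at e)"
    unfolding area_form_def
    by (auto intro!: derivative_eq_intros has_real_derivative_inner[OF X X] has_real_derivative_inner[OF Y Y]
        has_real_derivative_inner[OF X Y] simp: inner_commute algebra_simps)
  note d = DERIV_chain2[OF DERIV_real_sqrt[OF pos] this]
  have e: "inverse q / 2 * (2 * z) = z / q" for q z :: real
    unfolding divide_inverse[of z] by simp
  show ?thesis by (rule DERIV_cong[OF d]) (rule e)
qed

lemma open_slices:
  assumes "open U"
  shows "open {s. (s, t) \<in> U}" and "open {t. (s, t) \<in> U}"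
proof -
  have "continuous_on UNIV (\<lambda>s. (s, t))" by (intro continuous_intros)
  from open_vimage[OF assms this] show "open {s. (s, t) \<in> U}" by (simp add: vimage_def)
  have "continuous_on UNIV (\<lambda>t. (s, t))" by (intro continuous_intros)
  from open_vimage[OF assms this] show "open {t. (s, t) \<in> U}" by (simp add: vimage_def)
qed

text \<open>Along a plane the unit normal N has zero derivative, so the first variation of |P_s x
  P_t| for a field X is the divergence of (X . (P_t x N), - X . (P_s x N)). X vanishes off
  \<open>K\<close>, and so does the integral of this divergence.\<close>

lemma euclidean_area_first_variation:
  fixes n :: "real^3"
  assumes n: "n \<noteq> 0" and loc: "local_parametrization {x. n \<bullet> x = b} U r" and var: "surface_variation U r \<delta> K R"
  shows "((\<lambda>e. hausdorff_area (phi 0) K (R e)) has_real_derivative 0) (at 0)"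
proof -
  have U: "open U" and reg: "\<And>y. y \<in> U \<Longrightarrow> cross3 (partial_s r y) (partial_t r y) \<noteq> 0"
    and rU: "\<And>y. y \<in> U \<Longrightarrow> n \<bullet> r y = b"
    using loc openin_imp_subset unfolding local_parametrization_def by blast+
  have \<delta>: "\<delta> > 0" and K: "compact K" "K \<subseteq> U" and R0: "\<And>y. y \<in> U \<Longrightarrow> R 0 y = r y"
    and Rout: "\<And>e y. \<lbrakk>e \<in> {-\<delta><..<\<delta>}; y \<in> U - K\<rbrakk> \<Longrightarrow> R e y = r y"
    and sm: "smooth_on ({-\<delta><..<\<delta>} \<times> U) (\<lambda>(e, y). R e y)"
    using var unfolding surface_variation_def by blast+
  define S where "S = {-\<delta><..<\<delta>} \<times> U"
  have S: "open S" unfolding S_def using U by (intro open_Times) auto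
  define Q where "Q = (\<lambda>(e, y). R e y)"
  define X where "X p = frechet_derivative Q (at p) (1, (0, 0))" for p
  define Ps where "Ps p = frechet_derivative Q (at p) (0, (1, 0))" for p
  define Pt where "Pt p = frechet_derivative Q (at p) (0, (0, 1))" for p
  have Q3: "Ck_on (Suc (Suc (Suc 0))) S Q" using sm unfolding smooth_on_def S_def Q_def by blast
  have Q2: "Ck_on (Suc (Suc 0)) S Q" using Q3 by (rule Ck_on_SucD)
  have cX: "Ck_on (Suc (Suc 0)) S X" "Ck_on (Suc (Suc 0)) S Ps" "Ck_on (Suc (Suc 0)) S Pt"
    unfolding X_def Ps_def Pt_def by (rule Ck_on_frechet(1)[OF Q3])+
  note cont = cX[THEN Ck_on_imp_continuous_on]
  have diff: "Q differentiable (at p)" "X differentiable (at p)" "Ps differentiable (at p)" "Pt differentiable (at p)" if "p \<in> S" for p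
    using Q3 cX that by simp_all
  have cont2: "continuous_on S (\<lambda>p. frechet_derivative F (at p) h)" if "Ck_on (Suc (Suc 0)) S F" for F :: "real \<times> real \<times> real \<Rightarrow> real^3" and h
    using Ck_on_imp_continuous_on[OF Ck_on_frechet(1)[OF that]] .
  have comm: "frechet_derivative (\<lambda>p. frechet_derivative Q (at p) v) (at p) w = frechet_derivative (\<lambda>p. frechet_derivative Q (at p) w) (at p) v" if "p \<in> S" for p v w
    by (rule frechet_derivative_commute[OF S _ that]) (use Q2 in \<open>simp add: numeral_2_eq_2\<close>)
  have ve: "((\<lambda>e. (e, y)) has_vector_derivative (1, (0, 0))) (at e)" for e :: real and y :: "real \<times> real"
    unfolding has_vector_derivative_def by (rule has_derivative_eq_rhs, (rule derivative_intros)+) (auto simp: zero_prod_def)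
  have vs: "((\<lambda>s. (e, (s, t))) has_vector_derivative (0, (1, 0))) (at s)" and vt: "((\<lambda>t. (e, (s, t))) has_vector_derivative (0, (0, 1))) (at t)" for e s t :: real
    unfolding has_vector_derivative_def by (rule has_derivative_eq_rhs, (rule derivative_intros)+, simp)+
  have part: "partial_s (R e) y = Ps (e, y)" "partial_t (R e) y = Pt (e, y)" if "(e, y) \<in> S" for e y
  proof -
    have "((\<lambda>y. Q (e, y)) has_derivative (\<lambda>h. frechet_derivative Q (at (e, y)) (0, h))) (at y)"
      by (rule has_derivative_compose[of "\<lambda>y. (e, y)" "\<lambda>h. (0, h)"])
        (use diff(1)[OF that] in \<open>auto simp: frechet_derivative_works intro!: derivative_intros\<close>)
    then have "(R e has_derivative (\<lambda>h. frechet_derivative Q (at (e, y)) (0, h))) (at y)" by (simp add: Q_def)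
    from frechet_derivative_at[OF this]
    show "partial_s (R e) y = Ps (e, y)" "partial_t (R e) y = Pt (e, y)"
      unfolding partial_s_def partial_t_def Ps_def Pt_def by (simp_all add: fun_eq_iff)
  qed
  have inS: "(0, y) \<in> S" if "y \<in> U" for y using that \<delta> by (simp add: S_def)
  have part0: "partial_s r y = Ps (0, y)" "partial_t r y = Pt (0, y)" if y: "y \<in> U" for y
  proof -
    have "(R 0 has_derivative f') (at y) \<longleftrightarrow> (r has_derivative f') (at y)" for f'
    proof
      show "(r has_derivative f') (at y)" if "(R 0 has_derivative f') (at y)"
        by (rule has_derivative_transform_within_open[OF that U y R0])
      show "(R 0 has_derivative f') (at y)" if "(r has_derivative f') (at y)"
        by (rule has_derivative_transform_within_open[OF that U y R0[symmetric]])
    qed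
    then have "frechet_derivative (R 0) (at y) = frechet_derivative r (at y)" by (simp add: frechet_derivative_def)
    then show "partial_s r y = Ps (0, y)" "partial_t r y = Pt (0, y)"
      using part[OF inS[OF y]] by (simp_all add: partial_s_def partial_t_def)
  qed
  define W where "W p = area_form (Ps p) (Pt p)" for p
  have cW: "continuous_on S W" unfolding W_def area_form_def by (intro continuous_intros cont)
  have W0: "W (0, y) > 0" if "y \<in> U" for y
    unfolding W_def part0[OF that, symmetric] area_form_cross using reg[OF that] by simp
  have "{p \<in> S. W p > 0} = S \<inter> W -` {0<..}" by auto
  then have 1: "open {p \<in> S. W p > 0}" using continuous_open_preimage[OF cW S, of "{0<..}"] by simp
  have 2: "compact ({0 :: real} \<times> K)" by (intro compact_Times K) auto
  have 3: "{0} \<times> K \<subseteq> {p \<in> S. W p > 0}" using W0 inS K(2) by auto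
  \<comment> \<open>By compactness of \<open>K\<close> the varied surfaces stay immersed over it for
    small e, so that the square root is differentiable; the bound \<open>\<delta>\<close> of the
    variation does not ensure this.\<close>
  obtain \<epsilon> where \<epsilon>: "\<epsilon> > 0" "(\<Union>p\<in>{0} \<times> K. ball p \<epsilon>) \<subseteq> {p \<in> S. W p > 0}"
    by (rule compact_subset_open_imp_ball_epsilon_subset[OF 2 1 3])
  have tube: "(e, y) \<in> S" "W (e, y) > 0" if "\<bar>e\<bar> < \<epsilon>" "y \<in> K" for e y
  proof -
    have "(e, y) \<in> ball (0, y) \<epsilon>" using that by (simp add: dist_Pair_Pair)
    then have "(e, y) \<in> {p \<in> S. W p > 0}" using \<epsilon>(2) that(2) by blast
    then show "(e, y) \<in> S" "W (e, y) > 0" by auto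
  qed
  define P where "P p = ((Ps p \<bullet> frechet_derivative Ps (at p) (1, (0, 0))) * (Pt p \<bullet> Pt p) + (Ps p \<bullet> Ps p) * (Pt p \<bullet> frechet_derivative Pt (at p) (1, (0, 0)))
    - (Ps p \<bullet> Pt p) * (frechet_derivative Ps (at p) (1, (0, 0)) \<bullet> Pt p + Ps p \<bullet> frechet_derivative Pt (at p) (1, (0, 0)))) / sqrt (W p)" for p
  have "((\<lambda>e. integral K (\<lambda>y. sqrt (W (e, y)))) has_real_derivative integral K (\<lambda>y. P (0, y))) (at 0)"
  proof (rule has_real_derivative_integral_compact[OF K(1) \<epsilon>(1), where f' = "\<lambda>e y. P (e, y)"])
    fix e y assume e: "\<bar>e\<bar> < \<epsilon>" and y: "y \<in> K"
    note p = tube[OF e y]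
    show "((\<lambda>e. sqrt (W (e, y))) has_real_derivative P (e, y)) (at e)"
      unfolding W_def P_def
      by (rule has_real_derivative_sqrt_area_form[OF has_vector_derivative_compose_frechet[OF ve] has_vector_derivative_compose_frechet[OF ve]])
        (use p diff in \<open>auto simp: W_def\<close>)
  next
    fix e assume e: "\<bar>e\<bar> < \<epsilon>"
    show "continuous_on K (\<lambda>y. sqrt (W (e, y)))"
      by (intro continuous_on_real_sqrt continuous_on_compose2[OF cW] continuous_intros) (use tube[OF e] in auto)
  next
    have sub: "{-\<epsilon><..<\<epsilon>} \<times> K \<subseteq> S" using tube(1) by (auto simp: abs_less_iff)
    have "continuous_on ({-\<epsilon><..<\<epsilon>} \<times> K) P"
      unfolding P_def
      by (intro continuous_intros continuous_on_subset[OF _ sub] cont cont2 cX cW)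
        (use tube(2) in \<open>force simp: abs_less_iff\<close>)
    then show "continuous_on ({-\<epsilon><..<\<epsilon>} \<times> K) (\<lambda>(e, y). P (e, y))" by simp
  qed
  moreover have "\<forall>\<^sub>F e in nhds 0. integral K (\<lambda>y. sqrt (W (e, y))) = hausdorff_area (phi 0) K (R e)"
    using eventually_nhds_in_open[OF open_ball centre_in_ball[THEN iffD2, OF \<epsilon>(1)], of "0 :: real"]
  proof (rule eventually_mono)
    fix e :: real assume "e \<in> ball 0 \<epsilon>"
    then have "\<bar>e\<bar> < \<epsilon>" by (simp add: dist_real_def)
    then show "integral K (\<lambda>y. sqrt (W (e, y))) = hausdorff_area (phi 0) K (R e)"
      unfolding hausdorff_area_def hausdorff_integrand_phi_0
      by (intro integral_cong) (simp add: part[OF tube(1)] W_def)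
  qed
  ultimately have deriv: "((\<lambda>e. hausdorff_area (phi 0) K (R e)) has_real_derivative integral K (\<lambda>y. P (0, y))) (at 0)"
    by (simp cong: DERIV_cong_ev)
  define N where "N y = cross3 (Ps (0, y)) (Pt (0, y)) /\<^sub>R sqrt (W (0, y))" for y
  have c0: "continuous_on U (\<lambda>y. F (0, y))" if "continuous_on S F" for F :: "real \<times> real \<times> real \<Rightarrow> 'b::topological_space"
    by (rule continuous_on_compose2[OF that]) (auto intro!: continuous_intros inS)
  have cN: "continuous_on U N"
    unfolding N_def by (intro continuous_intros continuous_on_cross c0 cont cW) (use W0 in force)
  have Nn: "(n \<bullet> n) *\<^sub>R N y = (n \<bullet> N y) *\<^sub>R n" if y: "y \<in> U" for y
  proof (rule parallel_to_normal)
    obtain s t where st: "y = (s, t)" by (cases y)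
    have Pn: "n \<bullet> Ps (0, y) = 0" "n \<bullet> Pt (0, y) = 0"
    proof -
      have o: "open {s. (s, t) \<in> U}" "open {t. (s, t) \<in> U}"
        by (rule open_slices[OF U])+
      have "((\<lambda>s. n \<bullet> Q (0, (s, t))) has_real_derivative 0 \<bullet> Q (0, (s, t)) + n \<bullet> Ps (0, (s, t))) (at s)"
        unfolding Ps_def
        by (rule has_real_derivative_inner[OF has_vector_derivative_const has_vector_derivative_compose_frechet[OF vs diff(1)]])
          (use inS y st in auto)
      moreover have "((\<lambda>s. n \<bullet> Q (0, (s, t))) has_real_derivative 0) (at s)"
        by (rule has_field_derivative_transform_within_open[OF DERIV_const[of b] o(1)])
          (use y st rU R0 in \<open>auto simp: Q_def\<close>)
      ultimately show "n \<bullet> Ps (0, y) = 0" using DERIV_unique st by fastforce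
      have "((\<lambda>t. n \<bullet> Q (0, (s, t))) has_real_derivative 0 \<bullet> Q (0, (s, t)) + n \<bullet> Pt (0, (s, t))) (at t)"
        unfolding Pt_def
        by (rule has_real_derivative_inner[OF has_vector_derivative_const has_vector_derivative_compose_frechet[OF vt diff(1)]])
          (use inS y st in auto)
      moreover have "((\<lambda>t. n \<bullet> Q (0, (s, t))) has_real_derivative 0) (at t)"
        by (rule has_field_derivative_transform_within_open[OF DERIV_const[of b] o(2)])
          (use y st rU R0 in \<open>auto simp: Q_def\<close>)
      ultimately show "n \<bullet> Pt (0, y) = 0" using DERIV_unique st by fastforce
    qed
    then show "cross3 n (N y) = 0" by (simp add: N_def cross_mult_right Lagrange)
  qed
  have NN: "N y \<bullet> N y = 1" if "y \<in> U" for y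
  proof -
    have c: "cross3 (Ps (0, y)) (Pt (0, y)) \<bullet> cross3 (Ps (0, y)) (Pt (0, y)) = W (0, y)"
      by (simp only: W_def area_form_cross power2_norm_eq_inner)
    have "inverse (sqrt w) * (inverse (sqrt w) * w) = 1" if "w > 0" for w :: real
      using that by (simp add: field_simps)
    with W0[OF that] show ?thesis by (simp add: N_def c)
  qed
  have Nsq: "(n \<bullet> N y)\<^sup>2 = n \<bullet> n" if y: "y \<in> U" for y
    using arg_cong[OF Nn[OF y], of "\<lambda>v. v \<bullet> N y"] NN[OF y] by (simp add: power2_eq_square)
  \<comment> \<open>N takes only the two values n/|n| and -n/|n|, and by continuity the sign is
    locally constant. It may differ between components of \<open>U\<close>, so no global constancy
    is claimed.\<close>
  have Nloc: "\<exists>T. open T \<and> y \<in> T \<and> T \<subseteq> U \<and> (\<forall>z\<in>T. N z = N y)" if y: "y \<in> U" for y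
  proof -
    have cc: "continuous_on U (\<lambda>z. (n \<bullet> N y) * (n \<bullet> N z))" by (intro continuous_intros cN)
    define T where "T = {z \<in> U. (n \<bullet> N y) * (n \<bullet> N z) > 0}"
    have "T = U \<inter> (\<lambda>z. (n \<bullet> N y) * (n \<bullet> N z)) -` {0<..}" by (auto simp: T_def)
    then have "open T" using continuous_open_preimage[OF cc U, of "{0<..}"] by simp
    moreover have "y \<in> T" using y Nsq[OF y] n by (simp add: T_def power2_eq_square)
    moreover have "N z = N y" if z: "z \<in> T" for z
    proof -
      have zU: "z \<in> U" and pos: "(n \<bullet> N y) * (n \<bullet> N z) > 0" using z by (auto simp: T_def)
      have "(n \<bullet> N z)\<^sup>2 = (n \<bullet> N y)\<^sup>2" using Nsq[OF y] Nsq[OF zU] by simp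
      then have "n \<bullet> N z = n \<bullet> N y" using pos by (auto simp: power2_eq_iff)
      then have "(n \<bullet> n) *\<^sub>R N z = (n \<bullet> n) *\<^sub>R N y" using Nn[OF y] Nn[OF zU] by simp
      then show ?thesis using n by simp
    qed
    moreover have "T \<subseteq> U" by (auto simp: T_def)
    ultimately show ?thesis by blast
  qed
  define Xs where "Xs y = frechet_derivative X (at (0, y)) (0, (1, 0))" for y
  define Xt where "Xt y = frechet_derivative X (at (0, y)) (0, (0, 1))" for y
  define Pts where "Pts y = frechet_derivative Pt (at (0, y)) (0, (1, 0))" for y
  \<comment> \<open>\<open>D1\<close> and \<open>D2\<close> differentiate X . (P_t x N) in s and - X
    . (P_s x N) in t with N held fixed. By symmetry of second derivatives the mixed derivative of
    the parametrization is the same in both and cancels in the sum.\<close>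
  define D1 where "D1 y = Xs y \<bullet> cross3 (Pt (0, y)) (N y) + X (0, y) \<bullet> cross3 (Pts y) (N y)" for y
  define D2 where "D2 y = - (Xt y \<bullet> cross3 (Ps (0, y)) (N y) + X (0, y) \<bullet> cross3 (Pts y) (N y))" for y
  have mixed: "frechet_derivative Ps (at (0, y)) (0, (0, 1)) = Pts y"
    "frechet_derivative Ps (at (0, y)) (1, (0, 0)) = Xs y" "frechet_derivative Pt (at (0, y)) (1, (0, 0)) = Xt y" if "y \<in> U" for y
    unfolding Ps_def Pt_def X_def Pts_def Xs_def Xt_def by (rule comm[OF inS[OF that]])+
  have dcross: "((\<lambda>s. cross3 (f s) v) has_vector_derivative cross3 f' v) (at s)" if "(f has_vector_derivative f') (at s)" for f f' v and s :: real
    using bounded_bilinear.has_vector_derivative[OF bilinear_cross[unfolded bilinear_conv_bounded_bilinear] that has_vector_derivative_const[of v]]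
    by simp
  have Xout: "X (0, y) = 0" if y: "y \<in> U - K" for y
  proof -
    have "((\<lambda>e. Q (e, y)) has_vector_derivative X (0, y)) (at 0)"
      unfolding X_def by (rule has_vector_derivative_compose_frechet[OF ve diff(1)]) (use inS y in auto)
    moreover have "((\<lambda>e. Q (e, y)) has_vector_derivative 0) (at 0)"
      by (rule has_vector_derivative_transform_within_open[OF has_vector_derivative_const[of "r y"], of "{-\<delta><..<\<delta>}"])
        (use Rout y \<delta> in \<open>auto simp: Q_def\<close>)
    ultimately show ?thesis by (rule vector_derivative_unique_at)
  qed
  have "integral K (\<lambda>y. D1 y + D2 y) = 0"
  proof (rule integral_divergence_eq_0[OF U K])
    fix s t assume st: "(s, t) \<in> U"
    obtain T where T: "open T" "(s, t) \<in> T" "T \<subseteq> U" "\<And>z. z \<in> T \<Longrightarrow> N z = N (s, t)" using Nloc[OF st] by blast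
    have o: "open {s. (s, t) \<in> T}" "open {t. (s, t) \<in> T}"
      by (rule open_slices[OF T(1)])+
    show "((\<lambda>s. (\<lambda>y. X (0, y) \<bullet> cross3 (Pt (0, y)) (N y)) (s, t)) has_real_derivative D1 (s, t)) (at s)"
    proof (rule has_field_derivative_transform_within_open[OF _ o(1)])
      show "((\<lambda>s'. X (0, (s', t)) \<bullet> cross3 (Pt (0, (s', t))) (N (s, t))) has_real_derivative D1 (s, t)) (at s)"
        unfolding D1_def Xs_def Pts_def
        by (intro has_real_derivative_inner dcross has_vector_derivative_compose_frechet vs diff inS st)
      show "s \<in> {s. (s, t) \<in> T}" using T(2) by simp
      show "X (0, (s', t)) \<bullet> cross3 (Pt (0, (s', t))) (N (s, t)) = (\<lambda>y. X (0, y) \<bullet> cross3 (Pt (0, y)) (N y)) (s', t)"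
        if "s' \<in> {s. (s, t) \<in> T}" for s' using T(4)[of "(s', t)"] that by simp
    qed
    show "((\<lambda>t. (\<lambda>y. - (X (0, y) \<bullet> cross3 (Ps (0, y)) (N y))) (s, t)) has_real_derivative D2 (s, t)) (at t)"
    proof (rule has_field_derivative_transform_within_open[OF _ o(2)])
      show "((\<lambda>t'. - (X (0, (s, t')) \<bullet> cross3 (Ps (0, (s, t'))) (N (s, t)))) has_real_derivative D2 (s, t)) (at t)"
        unfolding D2_def Xt_def mixed(1)[OF st, symmetric]
        by (intro DERIV_minus has_real_derivative_inner dcross has_vector_derivative_compose_frechet vt diff inS st)
      show "t \<in> {t. (s, t) \<in> T}" using T(2) by simp
      show "- (X (0, (s, t')) \<bullet> cross3 (Ps (0, (s, t'))) (N (s, t))) = (\<lambda>y. - (X (0, y) \<bullet> cross3 (Ps (0, y)) (N y))) (s, t')"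
        if "t' \<in> {t. (s, t) \<in> T}" for t' using T(4)[of "(s, t')"] that by simp
    qed
  next
    show "continuous_on U D1" "continuous_on U D2"
      unfolding D1_def D2_def Xs_def Xt_def Pts_def
      by (intro continuous_intros continuous_on_cross c0 cont cont2 cX cN)+
  qed (use Xout in auto)
  moreover have "P (0, y) = D1 y + D2 y" if y: "y \<in> U" for y
  proof -
    \<comment> \<open>With N = (P_s x P_t) / sqrt W, the Lagrange identity turns the triple products
      into the inner products in terms of which \<open>P\<close> is written.\<close>
    have tp: "v \<bullet> cross3 w (N y) = (v \<bullet> Ps (0, y) * (w \<bullet> Pt (0, y)) - v \<bullet> Pt (0, y) * (w \<bullet> Ps (0, y))) / sqrt (W (0, y))" for v w
      by (simp add: N_def cross_mult_right Lagrange inner_diff_right divide_inverse algebra_simps)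
    show ?thesis
      unfolding P_def D1_def D2_def mixed[OF y] tp
      by (simp add: inner_commute add_divide_distrib diff_divide_distrib algebra_simps)
  qed
  then have "integral K (\<lambda>y. P (0, y)) = integral K (\<lambda>y. D1 y + D2 y)"
    using K(2) by (intro integral_cong) auto
  ultimately show ?thesis using deriv by simp
qed

lemma plane_extremal_euclidean:
  assumes "affine P" "aff_dim P = 2"
  shows "hausdorff_extremal (phi 0) P"
proof -
  obtain n :: "real^3" and b where n: "n \<noteq> 0" "P = {x. n \<bullet> x = b}"
    using aff_dim_eq_hyperplane[of P] assms by (auto simp: affine_hull_eq[THEN iffD2])
  then show ?thesis
    unfolding hausdorff_extremal_def n(2)
    using plane_is_surface[OF n(1)] euclidean_area_first_variation[OF n(1)] by blast
qed

section \<open>A plane that is not extremal\<close>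

text \<open>Let F(A, T) = 2 D^(3/2) / S with D = A (A + T) and S = 2 A + T. The left side is F_A - 2
  F_T - 2 B (d/dB) F_T at T = B, where the last derivative moves A and B at the same rate, as
  happens along a plane. This is the Euler-Lagrange expression up to a constant factor.\<close>

lemma graph_first_variation_identity:
  fixes A B D S R :: real
  assumes A: "A > 0" and B: "B \<ge> 0" and D: "D = A * (A + B)" and S: "S = 2 * A + B" and R: "R = sqrt D"
  shows "(3 * R - 4 * D * R / S\<^sup>2) - 2 * (3 * R * A / S - 2 * D * R / S\<^sup>2)
      - 2 * B * (3 * (3 * A + B) / (2 * R) * A / S + 3 * R / S - 9 * R * A / S\<^sup>2 - 3 * R * (3 * A + B) / S\<^sup>2 + 12 * D * R / S ^ 3)
    = - 6 * D * R * B ^ 3 / ((A + B)\<^sup>2 * S ^ 3)"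
proof -
  have pos: "A + B > 0" "S > 0" "D > 0" using A B by (auto simp: D S)
  have Rp: "R > 0" "R * R = D" using pos by (auto simp: R)
  \<comment> \<open>Clears the one occurrence of R in a denominator, by R^2 = D; every term is then
    R times a rational function of A and B.\<close>
  have inv: "3 * (3 * A + B) / (2 * R) = R * (3 * (3 * A + B) / (2 * (A * (A + B))))"
    unfolding D[symmetric] Rp(2)[symmetric] using Rp(1) by (simp add: field_simps)
  have "((3 - 4 * D / S\<^sup>2) - 2 * (3 * A / S - 2 * D / S\<^sup>2)
      - 2 * B * (3 * (3 * A + B) / (2 * (A * (A + B))) * A / S + 3 / S - 9 * A / S\<^sup>2 - 3 * (3 * A + B) / S\<^sup>2 + 12 * D / S ^ 3))
    = - 6 * D * B ^ 3 / ((A + B)\<^sup>2 * S ^ 3)"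
    using pos A unfolding D by (simp add: divide_simps) (simp add: S eval_nat_numeral algebra_simps)
  from arg_cong[OF this, of "\<lambda>z. R * z"] show ?thesis
    unfolding inv by (simp add: algebra_simps)
qed

lemma plane_not_extremal:
  assumes l: "l \<noteq> 0"
  shows "\<exists>P. affine P \<and> aff_dim P = 2 \<and> \<not> hausdorff_extremal (phi l) P"
proof -
  define e1 e2 e3 :: "real^3" where "e1 = axis 1 1" and "e2 = axis 2 1" and "e3 = axis 3 1"
  have ip: "e1 \<bullet> e1 = 1" "e2 \<bullet> e2 = 1" "e3 \<bullet> e3 = 1" "e1 \<bullet> e2 = 0" "e1 \<bullet> e3 = 0" "e2 \<bullet> e3 = 0"
    "e2 \<bullet> e1 = 0" "e3 \<bullet> e1 = 0" "e3 \<bullet> e2 = 0"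
    by (simp_all add: e1_def e2_def e3_def inner_axis_axis)
  define r where "r = (\<lambda>y :: real \<times> real. e3 + fst y *\<^sub>R e1 + snd y *\<^sub>R e2)"
  have "e3 \<noteq> 0" using ip(3) by auto
  then have P: "range r = {x. e3 \<bullet> x = e3 \<bullet> e3}"
    unfolding r_def using hyperplane_eq_range[of e1 e2 e3 e3] ip by simp
  have dim: "aff_dim (range r) = 2" "affine (range r)"
    unfolding P using aff_dim_hyperplane[OF \<open>e3 \<noteq> 0\<close>] affine_hyperplane by auto
  have loc: "local_parametrization (range r) UNIV r"
    unfolding r_def by (rule local_parametrization_affine) (use ip in auto)
  define u where "u y = bump (1 - (fst y * fst y + snd y * snd y))" for y :: "real \<times> real"
  define us where "us y = bump' (1 - (fst y * fst y + snd y * snd y)) * (- 2 * fst y)" for y :: "real \<times> real"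
  define ut where "ut y = bump' (1 - (fst y * fst y + snd y * snd y)) * (- 2 * snd y)" for y :: "real \<times> real"
  have du: "(u has_derivative (\<lambda>h. fst h * us y + snd h * ut y)) (at y)" for y
  proof -
    have "((\<lambda>y. 1 - (fst y * fst y + snd y * snd y)) has_derivative (\<lambda>h. - 2 * fst y * fst h - 2 * snd y * snd h)) (at y)"
      by (auto intro!: derivative_eq_intros simp: algebra_simps)
    from has_derivative_compose[OF this bump_derivative[unfolded has_field_derivative_def]]
    show ?thesis unfolding u_def by (rule has_derivative_eq_rhs) (simp add: us_def ut_def fun_eq_iff algebra_simps)
  qed
  have cu: "continuous_on X u" for X
    using du by (auto intro!: continuous_at_imp_continuous_on has_derivative_continuous)
  have cus: "continuous_on X us" and cut: "continuous_on X ut" for X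
    unfolding us_def ut_def by (auto intro!: continuous_intros continuous_on_compose2[OF continuous_bump'])
  have u_nonneg: "0 \<le> u y" for y by (simp add: u_def bump_nonneg)
  \<comment> \<open>A box around the disc that supports \<open>u\<close>, so that the final
    vanishing argument for nonnegative integrands on boxes applies.\<close>
  let ?K = "cbox (-1, -1) (1, 1) :: (real \<times> real) set"
  have out: "u y = 0" if "y \<notin> ?K" for y
  proof -
    obtain s t where y: "y = (s, t)" by (cases y)
    have "1 \<le> \<bar>s\<bar> \<or> 1 \<le> \<bar>t\<bar>" using that by (auto simp: y cbox_Pair_eq)
    then have "1 \<le> s\<^sup>2 \<or> 1 \<le> t\<^sup>2" using abs_le_square_iff[of 1 s] abs_le_square_iff[of 1 t] by auto
    then have "1 \<le> s\<^sup>2 + t\<^sup>2" by (meson add_increasing add_increasing2 zero_le_power2)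
    then show ?thesis by (simp add: u_def y bump_zero power2_eq_square)
  qed
  have smooth_u: "smooth_on UNIV u"
  proof -
    have "smooth_on UNIV (\<lambda>y :: real \<times> real. bump (1 + (- 1) * (fst y * fst y + snd y * snd y)))"
      by (rule smooth_on_compose[OF _ _ _ smooth_on_bump])
        (intro smooth_on_add smooth_on_mult smooth_on_const smooth_on_bounded_linear[OF bounded_linear_fst]
          smooth_on_bounded_linear[OF bounded_linear_snd] open_UNIV subset_UNIV)+
    moreover have "u = (\<lambda>y. bump (1 + (- 1) * (fst y * fst y + snd y * snd y)))"
    proof
      have "1 + (- 1) * q = 1 - q" for q :: real by simp
      then show "u y = bump (1 + (- 1) * (fst y * fst y + snd y * snd y))" for y by (simp only: u_def)
    qed
    ultimately show ?thesis by (simp only:)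
  qed
  define R where "R e y = r y + (e * u y) *\<^sub>R e3" for e y
  have var: "surface_variation UNIV r 1 ?K R"
    unfolding surface_variation_def
  proof (intro conjI ballI)
    have U: "open ({-1<..<1::real} \<times> (UNIV :: (real \<times> real) set))" by (intro open_Times) auto
    have lin: "smooth_on ({-1<..<1::real} \<times> UNIV) (\<lambda>p :: real \<times> real \<times> real. f p)" if "bounded_linear f" for f :: "real \<times> real \<times> real \<Rightarrow> real"
      by (rule smooth_on_bounded_linear[OF that U])
    have 1: "smooth_on ({-1<..<1::real} \<times> UNIV) (\<lambda>p :: real \<times> real \<times> real. u (snd p))"
      by (rule smooth_on_compose[OF U subset_UNIV smooth_on_bounded_linear[OF bounded_linear_snd U] smooth_u])
    show "smooth_on ({- 1<..<1} \<times> UNIV) (\<lambda>(e, y). R e y)"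
      unfolding R_def r_def case_prod_beta
      by (intro smooth_on_add smooth_on_scaleR smooth_on_mult smooth_on_const U 1 lin bounded_linear_fst
          bounded_linear_compose[OF bounded_linear_fst bounded_linear_snd] bounded_linear_compose[OF bounded_linear_snd bounded_linear_snd])
  qed (use out in \<open>auto simp: R_def\<close>)
  have dR: "(R e has_derivative (\<lambda>h. fst h *\<^sub>R e1 + snd h *\<^sub>R e2 + (e * (fst h * us y + snd h * ut y)) *\<^sub>R e3)) (at y)" for e y
    unfolding R_def r_def
    by (rule has_derivative_eq_rhs, rule derivative_intros du | simp)+
  have ps: "partial_s (R e) y = e1 + (e * us y) *\<^sub>R e3" and pt: "partial_t (R e) y = e2 + (e * ut y) *\<^sub>R e3" for e y
    unfolding partial_s_def partial_t_def frechet_derivative_at[OF dR, symmetric] by simp_all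
  define z where "z e y = 1 + e * u y" for e y
  define A where "A e y = 1 + l\<^sup>2 * ((fst y)\<^sup>2 + (snd y)\<^sup>2 + (z e y)\<^sup>2)" for e y
  define W where "W e y = 1 + e\<^sup>2 * ((us y)\<^sup>2 + (ut y)\<^sup>2)" for e y
  \<comment> \<open>\<open>q1\<close> and \<open>q2\<close> are the inner products of the position
    on the graph with its two tangent vectors.\<close>
  define q1 where "q1 e y = fst y + e * us y * z e y" for e y
  define q2 where "q2 e y = snd y + e * ut y * z e y" for e y
  define T where "T e y = l\<^sup>2 * ((1 + e\<^sup>2 * (us y)\<^sup>2) * (q2 e y)\<^sup>2 - 2 * (e\<^sup>2 * us y * ut y) * q1 e y * q2 e y + (1 + e\<^sup>2 * (ut y)\<^sup>2) * (q1 e y)\<^sup>2)" for e y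
  define D where "D e y = A e y * (A e y * W e y + T e y)" for e y
  define S where "S e y = 2 * A e y * W e y + T e y" for e y
  define f where "f e y = 2 * D e y * sqrt (D e y) / S e y" for e y
  have WT: "area_form (partial_s (R e) y) (partial_t (R e) y) = W e y" "tilt_form l (R e y) (partial_s (R e) y) (partial_t (R e) y) = T e y"
    "1 + l\<^sup>2 * (R e y \<bullet> R e y) = A e y" for e y
    unfolding ps pt R_def r_def area_form_def tilt_form_def
    by (simp_all add: ip inner_add_left inner_add_right W_def T_def A_def q1_def q2_def z_def power2_eq_square algebra_simps)
  have Wpos: "W e y > 0" for e y unfolding W_def by (intro add_pos_nonneg) auto
  have Apos: "A e y > 0" for e y unfolding A_def by (intro add_pos_nonneg) auto
  have Tpos: "T e y \<ge> 0" for e y unfolding WT(2)[symmetric] by (rule tilt_form_nonneg)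
  have Dpos: "D e y > 0" and Spos: "S e y > 0" for e y
    unfolding D_def S_def using Wpos[of e y] Apos[of e y] Tpos[of e y] by (auto intro!: mult_pos_pos add_pos_nonneg)
  have area: "hausdorff_area (phi l) ?K (R e) = integral ?K (f e)" for e
    unfolding hausdorff_area_def
  proof (rule integral_cong)
    fix y
    have "cross3 (partial_s (R e) y) (partial_t (R e) y) \<noteq> 0"
      using Wpos[of e y] WT(1)[of e y] by (auto simp: area_form_cross)
    from hausdorff_integrand_phi[OF this, of l "R e y"]
    show "hausdorff_integrand (phi l) (R e y) (partial_s (R e) y) (partial_t (R e) y) = f e y"
      unfolding WT f_def D_def S_def .
  qed
  define A' where "A' e y = 2 * l\<^sup>2 * z e y * u y" for e y
  define W' where "W' e y = 2 * e * ((us y)\<^sup>2 + (ut y)\<^sup>2)" for e y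
  define q1' where "q1' e y = us y * z e y + e * us y * u y" for e y
  define q2' where "q2' e y = ut y * z e y + e * ut y * u y" for e y
  define T' where "T' e y = l\<^sup>2 * (2 * e * (us y)\<^sup>2 * (q2 e y)\<^sup>2 + (1 + e\<^sup>2 * (us y)\<^sup>2) * (2 * q2 e y * q2' e y)
    - (4 * e * us y * ut y * q1 e y * q2 e y + 2 * (e\<^sup>2 * us y * ut y) * (q1' e y * q2 e y + q1 e y * q2' e y))
    + 2 * e * (ut y)\<^sup>2 * (q1 e y)\<^sup>2 + (1 + e\<^sup>2 * (ut y)\<^sup>2) * (2 * q1 e y * q1' e y))" for e y
  define D' where "D' e y = A' e y * (A e y * W e y + T e y) + A e y * (A' e y * W e y + A e y * W' e y + T' e y)" for e y
  define S' where "S' e y = 2 * A' e y * W e y + 2 * A e y * W' e y + T' e y" for e y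
  define f' where "f' e y = 3 * sqrt (D e y) * D' e y / S e y - 2 * D e y * sqrt (D e y) * S' e y / (S e y)\<^sup>2" for e y
  have dz: "((\<lambda>e. z e y) has_real_derivative u y) (at e)" for e y
    unfolding z_def by (auto intro!: derivative_eq_intros)
  have dA: "((\<lambda>e. A e y) has_real_derivative A' e y) (at e)" for e y
    unfolding A_def A'_def by (auto intro!: derivative_eq_intros dz)
  have dW: "((\<lambda>e. W e y) has_real_derivative W' e y) (at e)" for e y
    unfolding W_def W'_def by (auto intro!: derivative_eq_intros)
  have dq1: "((\<lambda>e. q1 e y) has_real_derivative q1' e y) (at e)" for e y
    unfolding q1_def q1'_def by (auto intro!: derivative_eq_intros dz)
  have dq2: "((\<lambda>e. q2 e y) has_real_derivative q2' e y) (at e)" for e y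
    unfolding q2_def q2'_def by (auto intro!: derivative_eq_intros dz)
  have dT: "((\<lambda>e. T e y) has_real_derivative T' e y) (at e)" for e y
    unfolding T_def T'_def by (auto intro!: derivative_eq_intros dq1 dq2 simp: algebra_simps)
  have dD: "((\<lambda>e. D e y) has_real_derivative D' e y) (at e)" for e y
    unfolding D_def D'_def by (auto intro!: derivative_eq_intros dA dW dT simp: algebra_simps)
  have dS: "((\<lambda>e. S e y) has_real_derivative S' e y) (at e)" for e y
    unfolding S_def S'_def by (auto intro!: derivative_eq_intros dA dW dT simp: algebra_simps)
  \<comment> \<open>Stated for arbitrary functions because it serves twice: for the variation in e
    and for the derivative of \<open>G\<close> within the plane.\<close>
  have quot: "((\<lambda>x. 2 * D x * sqrt (D x) / S x) has_real_derivative 3 * sqrt (D e) * D' / S e - 2 * D e * sqrt (D e) * S' / (S e)\<^sup>2) (at e)"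
    if "(D has_real_derivative D') (at e)" "(S has_real_derivative S') (at e)" "D e > 0" "S e > 0"
    for D S :: "real \<Rightarrow> real" and D' S' e :: real
  proof -
    have sq: "((\<lambda>x. sqrt (D x)) has_real_derivative inverse (sqrt (D e)) / 2 * D') (at e)"
      by (rule DERIV_chain2[OF DERIV_real_sqrt[OF that(3)] that(1)])
    have r: "sqrt (D e) * sqrt (D e) = D e" "sqrt (D e) > 0" using that(3) by auto
    have "D e * inverse (sqrt (D e)) = sqrt (D e)"
      using r by (metis inverse_eq_divide mult.assoc nonzero_mult_div_cancel_left order_less_irrefl times_divide_eq_right mult.right_neutral)
    then have *: "2 * D' * sqrt (D e) + (inverse (sqrt (D e)) / 2 * D') * (2 * D e) = 3 * sqrt (D e) * D'"
      by (simp add: algebra_simps)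
    have "S e \<noteq> 0" using that(4) by simp
    show ?thesis
      by (rule DERIV_cong[OF DERIV_divide[OF DERIV_mult[OF DERIV_cmult[OF that(1)] sq] that(2) \<open>S e \<noteq> 0\<close>]], unfold *)
        (use that(4) in \<open>simp add: field_simps power2_eq_square\<close>)
  qed
  have df: "((\<lambda>e. f e y) has_real_derivative f' e y) (at e)" for e y
    unfolding f_def f'_def by (rule quot[OF dD dS Dpos Spos])
  have cf: "continuous_on UNIV (\<lambda>p. f (fst p) (snd p))" and cf': "continuous_on UNIV (\<lambda>p. f' (fst p) (snd p))"
  proof -
    have c: "continuous_on UNIV (\<lambda>p :: real \<times> real \<times> real. g (snd p))" if "continuous_on UNIV g" for g :: "real \<times> real \<Rightarrow> real"
      by (rule continuous_on_compose2[OF that]) (auto intro!: continuous_intros)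
    have ne: "S e y \<noteq> 0" for e y using Spos[of e y] by simp
    note [continuous_intros] = c[OF cu] c[OF cus] c[OF cut]
    have 1: "continuous_on UNIV (\<lambda>p :: real \<times> real \<times> real. z (fst p) (snd p))" unfolding z_def by (intro continuous_intros)
    have 2: "continuous_on UNIV (\<lambda>p :: real \<times> real \<times> real. q1 (fst p) (snd p))" "continuous_on UNIV (\<lambda>p :: real \<times> real \<times> real. q2 (fst p) (snd p))"
      "continuous_on UNIV (\<lambda>p :: real \<times> real \<times> real. q1' (fst p) (snd p))" "continuous_on UNIV (\<lambda>p :: real \<times> real \<times> real. q2' (fst p) (snd p))"
      unfolding q1_def q2_def q1'_def q2'_def by (intro continuous_intros 1)+
    have 3: "continuous_on UNIV (\<lambda>p :: real \<times> real \<times> real. A (fst p) (snd p))" "continuous_on UNIV (\<lambda>p :: real \<times> real \<times> real. A' (fst p) (snd p))"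
      "continuous_on UNIV (\<lambda>p :: real \<times> real \<times> real. W (fst p) (snd p))" "continuous_on UNIV (\<lambda>p :: real \<times> real \<times> real. W' (fst p) (snd p))"
      "continuous_on UNIV (\<lambda>p :: real \<times> real \<times> real. T (fst p) (snd p))" "continuous_on UNIV (\<lambda>p :: real \<times> real \<times> real. T' (fst p) (snd p))"
      unfolding A_def A'_def W_def W'_def T_def T'_def by (intro continuous_intros 1 2)+
    have 4: "continuous_on UNIV (\<lambda>p :: real \<times> real \<times> real. D (fst p) (snd p))" "continuous_on UNIV (\<lambda>p :: real \<times> real \<times> real. D' (fst p) (snd p))"
      "continuous_on UNIV (\<lambda>p :: real \<times> real \<times> real. S (fst p) (snd p))" "continuous_on UNIV (\<lambda>p :: real \<times> real \<times> real. S' (fst p) (snd p))"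
      unfolding D_def D'_def S_def S'_def by (intro continuous_intros 3)+
    show "continuous_on UNIV (\<lambda>p. f (fst p) (snd p))" unfolding f_def by (intro continuous_intros 4) (simp_all add: ne)
    show "continuous_on UNIV (\<lambda>p. f' (fst p) (snd p))" unfolding f'_def by (intro continuous_intros 4) (simp_all add: ne)
  qed
  have cD: "continuous_on X (f e)" for X e
    using continuous_on_compose2[OF cf, of X "\<lambda>y. (e, y)"] by (simp add: continuous_on_Pair)
  have deriv: "((\<lambda>e. hausdorff_area (phi l) ?K (R e)) has_real_derivative integral ?K (f' 0)) (at 0)"
    unfolding area
  proof (rule has_real_derivative_integral_compact[where \<delta> = 1])
    show "continuous_on ({-1<..<1} \<times> ?K) (\<lambda>(e, y). f' e y)"
      unfolding case_prod_beta by (rule continuous_on_subset[OF cf']) simp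
  qed (use df cD in auto)
  \<comment> \<open>From here on, \<open>B\<close>, \<open>a\<close>, \<open>d\<close> and
    \<open>sg\<close> denote the values of \<open>T\<close>, \<open>A\<close>, \<open>D\<close> and
    \<open>S\<close> on the unvaried plane, where \<open>W\<close> is 1.\<close>
  define B where "B y = l\<^sup>2 * ((fst y)\<^sup>2 + (snd y)\<^sup>2)" for y :: "real \<times> real"
  define a where "a y = 1 + l\<^sup>2 + B y" for y
  define d where "d y = a y * (a y + B y)" for y
  define sg where "sg y = 2 * a y + B y" for y
  \<comment> \<open>The partial derivative of 2 D^(3/2) / S with respect to T at W = 1; it is the
    coefficient of the gradient of \<open>u\<close> in the first variation. \<open>G'\<close> is its
    derivative in B, with \<open>a\<close> growing at the same rate as \<open>B\<close>.\<close>
  define G where "G y = 3 * sqrt (d y) * a y / sg y - 2 * d y * sqrt (d y) / (sg y)\<^sup>2" for y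
  define G' where "G' y = 3 * (3 * a y + B y) / (2 * sqrt (d y)) * a y / sg y + 3 * sqrt (d y) / sg y - 9 * sqrt (d y) * a y / (sg y)\<^sup>2
    - 3 * sqrt (d y) * (3 * a y + B y) / (sg y)\<^sup>2 + 12 * d y * sqrt (d y) / sg y ^ 3" for y
  define E where "E y = - 6 * d y * sqrt (d y) * B y ^ 3 / ((a y + B y)\<^sup>2 * sg y ^ 3)" for y
  have Bn: "B y \<ge> 0" for y by (simp add: B_def)
  have ap: "a y > 0" for y unfolding a_def using Bn[of y] zero_le_power2[of l] by linarith
  have dp: "d y > 0" and sp: "sg y > 0" and abp: "a y + B y > 0" for y
    using ap[of y] Bn[of y] by (auto simp: d_def sg_def intro!: mult_pos_pos)
  have dG: "((\<lambda>x. G (p x)) has_real_derivative G' (p x) * b) (at x)" if b: "((\<lambda>x. B (p x)) has_real_derivative b) (at x)" for p x b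
  proof -
    have a': "((\<lambda>x. a (p x)) has_real_derivative b) (at x)"
      unfolding a_def by (auto intro!: derivative_eq_intros b)
    have d': "((\<lambda>x. d (p x)) has_real_derivative (3 * a (p x) + B (p x)) * b) (at x)"
      unfolding d_def by (auto intro!: derivative_eq_intros b a' simp: algebra_simps)
    have s': "((\<lambda>x. sg (p x)) has_real_derivative 3 * b) (at x)"
      unfolding sg_def by (auto intro!: derivative_eq_intros b a')
    have sq: "((\<lambda>x. sqrt (d (p x))) has_real_derivative inverse (sqrt (d (p x))) / 2 * ((3 * a (p x) + B (p x)) * b)) (at x)"
      by (rule DERIV_chain2[OF DERIV_real_sqrt[OF dp] d'])
    have ne: "sg (p x) \<noteq> 0" "sqrt (d (p x)) \<noteq> 0" using sp[of "p x"] dp[of "p x"] by auto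
    have 1: "((\<lambda>x. 3 * sqrt (d (p x)) * a (p x) / sg (p x)) has_real_derivative
        (3 * (3 * a (p x) + B (p x)) / (2 * sqrt (d (p x))) * a (p x) / sg (p x) + 3 * sqrt (d (p x)) / sg (p x) - 9 * sqrt (d (p x)) * a (p x) / (sg (p x))\<^sup>2) * b) (at x)"
      by (rule DERIV_cong[OF DERIV_divide[OF DERIV_mult[OF DERIV_cmult[OF sq] a'] s' ne(1)]])
        (use ne in \<open>simp add: field_simps power2_eq_square\<close>)
    have 2: "((\<lambda>x. d (p x) * 2 * sqrt (d (p x)) / (sg (p x) * sg (p x))) has_real_derivative
        (3 * sqrt (d (p x)) * (3 * a (p x) + B (p x)) / (sg (p x))\<^sup>2 - 12 * d (p x) * sqrt (d (p x)) / sg (p x) ^ 3) * b) (at x)"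
    proof -
      have q: "((\<lambda>x. 2 * d (p x) * sqrt (d (p x)) / sg (p x)) has_real_derivative
          3 * sqrt (d (p x)) * ((3 * a (p x) + B (p x)) * b) / sg (p x) - 2 * d (p x) * sqrt (d (p x)) * (3 * b) / (sg (p x))\<^sup>2) (at x)"
        by (rule quot[OF d' s' dp sp])
      have "((\<lambda>x. 2 * d (p x) * sqrt (d (p x)) / sg (p x) / sg (p x)) has_real_derivative
          (3 * sqrt (d (p x)) * (3 * a (p x) + B (p x)) / (sg (p x))\<^sup>2 - 12 * d (p x) * sqrt (d (p x)) / sg (p x) ^ 3) * b) (at x)"
        by (rule DERIV_cong[OF DERIV_divide[OF q s' ne(1)]])
          (use ne(1) in \<open>simp add: field_simps power2_eq_square power3_eq_cube\<close>)
      then show ?thesis by (simp add: mult.commute mult.left_commute)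
    qed
    show ?thesis unfolding G_def G'_def
      using DERIV_diff[OF 1 2] by (simp add: algebra_simps power2_eq_square)
  qed
  \<comment> \<open>Together with \<open>D2\<close>, the divergence of the field 2 l^2 u G y, where
    y is the position in the plane. Subtracting it from the first variation removes all derivatives
    of \<open>u\<close>.\<close>
  define D1 where "D1 y = 2 * l\<^sup>2 * (us y * G y * fst y + u y * (G' y * (2 * l\<^sup>2 * fst y) * fst y + G y))" for y
  define D2 where "D2 y = 2 * l\<^sup>2 * (ut y * G y * snd y + u y * (G' y * (2 * l\<^sup>2 * snd y) * snd y + G y))" for y
  have cB: "continuous_on X B" for X unfolding B_def by (intro continuous_intros)
  have ca: "continuous_on X a" for X unfolding a_def by (intro continuous_intros cB)
  have cd: "continuous_on X d" for X unfolding d_def by (intro continuous_intros cB ca)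
  have cs: "continuous_on X sg" for X unfolding sg_def by (intro continuous_intros cB ca)
  have ne: "sg y \<noteq> 0" "d y \<noteq> 0" "a y + B y \<noteq> 0" for y using sp[of y] dp[of y] abp[of y] by auto
  have cG: "continuous_on X G" for X unfolding G_def by (intro continuous_intros ca cd cs) (simp_all add: ne)
  have cG': "continuous_on X G'" for X unfolding G'_def by (intro continuous_intros ca cd cs cB) (simp_all add: ne)
  have cE: "continuous_on X E" for X unfolding E_def by (intro continuous_intros ca cd cs cB) (simp_all add: ne)
  have c12: "continuous_on X D1" "continuous_on X D2" for X
    unfolding D1_def D2_def by (intro continuous_intros cu cus cut cG cG')+
  have dus: "((\<lambda>s. u (s, t)) has_real_derivative us (s, t)) (at s)" for s t
    unfolding u_def us_def fst_conv snd_conv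
    by (rule DERIV_chain2[OF bump_derivative]) (auto intro!: derivative_eq_intros)
  have dut: "((\<lambda>t. u (s, t)) has_real_derivative ut (s, t)) (at t)" for s t
    unfolding u_def ut_def fst_conv snd_conv
    by (rule DERIV_chain2[OF bump_derivative]) (auto intro!: derivative_eq_intros)
  have div: "integral ?K (\<lambda>y. D1 y + D2 y) = 0"
  proof (rule integral_divergence_eq_0[OF open_UNIV compact_cbox subset_UNIV])
    fix s t
    have "((\<lambda>s. B (s, t)) has_real_derivative 2 * l\<^sup>2 * s) (at s)" unfolding B_def by (auto intro!: derivative_eq_intros)
    note g = dG[OF this]
    show "((\<lambda>s. (\<lambda>y. 2 * l\<^sup>2 * (u y * (G y * fst y))) (s, t)) has_real_derivative D1 (s, t)) (at s)"
      unfolding D1_def fst_conv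
      by (rule DERIV_cong[OF DERIV_cmult[OF DERIV_mult[OF dus DERIV_mult[OF g DERIV_ident]]]]) (simp add: algebra_simps)
    have "((\<lambda>t. B (s, t)) has_real_derivative 2 * l\<^sup>2 * t) (at t)" unfolding B_def by (auto intro!: derivative_eq_intros)
    note g = dG[OF this]
    show "((\<lambda>t. (\<lambda>y. 2 * l\<^sup>2 * (u y * (G y * snd y))) (s, t)) has_real_derivative D2 (s, t)) (at t)"
      unfolding D2_def snd_conv
      by (rule DERIV_cong[OF DERIV_cmult[OF DERIV_mult[OF dut DERIV_mult[OF g DERIV_ident]]]]) (simp add: algebra_simps)
  qed (use c12 out in auto)
  \<comment> \<open>The gradient of B paired with y is 2 B, so the divergence contributes u (2 G + 2
    B G'); what is left of the coefficient of u is E.\<close>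
  have split: "f' 0 y = (D1 y + D2 y) + 2 * l\<^sup>2 * (u y * E y)" for y
  proof -
    have 0: "A 0 y = a y" "T 0 y = B y" "W 0 y = 1" "W' 0 y = 0" "A' 0 y = 2 * l\<^sup>2 * u y" "T' 0 y = 2 * l\<^sup>2 * (us y * fst y + ut y * snd y)"
      by (simp_all add: A_def T_def W_def W'_def A'_def T'_def z_def q1_def q2_def q1'_def q2'_def a_def B_def algebra_simps)
    then have 1: "D 0 y = d y" "S 0 y = sg y" "D' 0 y = 2 * l\<^sup>2 * (u y * sg y + a y * (us y * fst y + ut y * snd y))"
      "S' 0 y = 2 * l\<^sup>2 * (2 * u y + (us y * fst y + ut y * snd y))"
      by (simp_all add: D_def S_def d_def sg_def D'_def S'_def algebra_simps)
    \<comment> \<open>The derivative of D in A at W = 1 is 2 A + T = S, which cancels the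
      denominator in the first term.\<close>
    have gA: "3 * sqrt (d y) * sg y / sg y - 4 * d y * sqrt (d y) / (sg y)\<^sup>2 = 3 * sqrt (d y) - 4 * d y * sqrt (d y) / (sg y)\<^sup>2"
      using ne(1)[of y] by simp
    have f'0: "f' 0 y = 2 * l\<^sup>2 * (u y * (3 * sqrt (d y) * sg y / sg y - 4 * d y * sqrt (d y) / (sg y)\<^sup>2) + (us y * fst y + ut y * snd y) * G y)"
      unfolding f'_def 1 G_def by (simp add: add_divide_distrib diff_divide_distrib algebra_simps del: nonzero_mult_div_cancel_right)
    have "E y = (3 * sqrt (d y) - 4 * d y * sqrt (d y) / (sg y)\<^sup>2) - 2 * G y - 2 * B y * G' y"
      unfolding E_def G_def G'_def
      by (rule graph_first_variation_identity[OF ap Bn d_def sg_def refl, symmetric])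
    then have gA': "3 * sqrt (d y) - 4 * d y * sqrt (d y) / (sg y)\<^sup>2 = E y + 2 * G y + 2 * B y * G' y" by simp
    have D12: "D1 y + D2 y = 2 * l\<^sup>2 * ((us y * fst y + ut y * snd y) * G y + u y * (2 * G y + 2 * B y * G' y))"
      by (simp add: D1_def D2_def B_def algebra_simps power2_eq_square)
    show ?thesis unfolding f'0 gA gA' D12 by (simp add: algebra_simps)
  qed
  have "\<not> hausdorff_extremal (phi l) (range r)"
  proof
    assume "hausdorff_extremal (phi l) (range r)"
    then have "((\<lambda>e. hausdorff_area (phi l) ?K (R e)) has_real_derivative 0) (at 0)"
      using loc var unfolding hausdorff_extremal_def by blast
    from DERIV_unique[OF deriv this] have "integral ?K (\<lambda>y. (D1 y + D2 y) + 2 * l\<^sup>2 * (u y * E y)) = 0"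
      unfolding split .
    moreover have "integral ?K (\<lambda>y. (D1 y + D2 y) + 2 * l\<^sup>2 * (u y * E y)) =
        integral ?K (\<lambda>y. D1 y + D2 y) + integral ?K (\<lambda>y. 2 * l\<^sup>2 * (u y * E y))"
      by (intro integral_add integrable_continuous continuous_intros c12 cu cE)
    ultimately have "integral ?K (\<lambda>y. 2 * l\<^sup>2 * (u y * E y)) = 0" using div by simp
    then have "integral ?K (\<lambda>y. - (2 * l\<^sup>2 * (u y * E y))) = 0" by simp
    moreover have cI: "continuous_on ?K (\<lambda>y. - (2 * l\<^sup>2 * (u y * E y)))" by (intro continuous_intros cu cE)
    ultimately have hi: "((\<lambda>y. - (2 * l\<^sup>2 * (u y * E y))) has_integral 0) ?K"
      by (metis integrable_continuous integrable_integral)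
    have neg: "E y \<le> 0" for y
      unfolding E_def using dp[of y] sp[of y] Bn[of y] abp[of y]
      by (auto intro!: divide_nonpos_nonneg mult_nonneg_nonneg mult_nonpos_nonneg simp: less_imp_le)
    \<comment> \<open>E vanishes at the centre, so the contradiction is drawn at a point off it but
      inside the unit disc, where \<open>u\<close> is positive.\<close>
    let ?y = "(1/2, 0) :: real \<times> real"
    have "- (2 * l\<^sup>2 * (u ?y * E ?y)) = 0"
    proof (rule has_integral_0_cbox_imp_0[OF cI _ hi])
      show "0 \<le> - (2 * l\<^sup>2 * (u y * E y))" for y
        using mult_nonneg_nonpos[OF u_nonneg neg, of y y] by (simp add: mult_nonneg_nonpos)
      have "(0, 0) \<in> box (-1, -1) (1 :: real, 1 :: real)" by (auto simp: mem_box Basis_prod_def)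
      then show "box (-1, -1) (1 :: real, 1 :: real) \<noteq> {}" by blast
      show "?y \<in> ?K" by (simp add: cbox_Pair_eq)
    qed
    moreover have "u ?y \<noteq> 0" unfolding u_def using bump_pos[of "1 - (1/2 * (1/2) + 0 * 0)"] by simp
    moreover have "B ?y \<noteq> 0" using l by (simp add: B_def)
    then have "E ?y \<noteq> 0" using ne[of ?y] by (simp add: E_def)
    ultimately show False using l by simp
  qed
  then show ?thesis using dim by blast
qed

theorem theorem4p5:
  "(\<forall>l. finsler_metric (phi l) \<and>
        (\<forall>I \<gamma>. geodesic (phi l) I \<gamma> \<longrightarrow> (\<exists>L. affine L \<and> aff_dim L = 1 \<and> \<gamma> ` I \<subseteq> L))) \<and>
   (\<forall>l. (\<forall>P. affine P \<and> aff_dim P = 2 \<longrightarrow> hausdorff_extremal (phi l) P) \<longleftrightarrow> l = 0)"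
  using finsler_metric_phi geodesic_phi_straight plane_extremal_euclidean plane_not_extremal by metis

end
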